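(* Let $q,\xi\in[0,1)$ and let $\mathbb{Z}'=\mathbb{Z}+\tfrac12$. Let $z_1,\dots,z_k\in\mathbb{Z}'$. The correlation function of the squared type $q$-Plancherel measure is given by $$\rho(z_1,\dots,z_k)=\det_{1\le i,j\le k}K_{q\mathrm{B}}(z_i,z_j),$$ with the correlation kernel (the $q$-Bessel kernel) $$K_{q\mathrm{B}}(r,s)=\xi\,\frac{J_{r+\frac12}J_{s-\frac12}-J_{r-\frac12}J_{s+\frac12}}{q^{\frac12(r-s)}-q^{-\frac12(r-s)}},\qquad r,s\in\mathbb{Z}+\tfrac12,$$ where $J_n=J_n^{(3)}(2\xi;q)$ is the Hahn--Exton $q$-Bessel function.
   Context: Let $\mathsf{P}$ be the set of all partitions $\lambda=(\lambda_1\ge\lambda_2\ge\cdots)$, with transpose $\lambda^{\mathrm T}$, size $|\lambda|=\sum_i\lambda_i$, $b(\lambda)=\sum_{i\ge1}(i-1)\lambda_i$, and hook lengths $h(i,j)=\lambda_i+\lambda^{\mathrm T}_j-i-j+1$ for $(i,j)\in\lambda$. The squared type $q$-Plancherel measure is the probability measure on $\mathsf{P}$ $$\mu_{q\mathrm{PP}_S}[\lambda;\xi,q]=M(\xi;q)^{-1}(\xi^2q)^{|\lambda|}q^{2b(\lambda)}\prod_{(i,j)\in\lambda}\frac1{(1-q^{h(i,j)})^2},\qquad M(\xi;q)=\prod_{n\ge1}\frac1{(1-\xi^2q^n)^n}.$$ For $\lambda\in\mathsf{P}$ put $\Xi(\lambda)=\{\lambda_i-i+\tfrac12\}_{i\ge1}\subset\mathbb{Z}'$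 (with $\lambda_i=0$ beyond the length of $\lambda$). For a finite subset $\mathsf{Z}=\{z_1,\dots,z_k\}\subset\mathbb{Z}'$, the correlation function is $\rho(\mathsf{Z})=\rho(z_1,\dots,z_k)=\mathbb{P}[\mathsf{Z}\subset\Xi(\lambda)]$, the probability being taken with respect to this measure. With $(a;q)_n=\prod_{k=0}^{n-1}(1-aq^k)$ and $(a;q)_\infty=\prod_{k\ge0}(1-aq^k)$, the Hahn--Exton $q$-Bessel function is $$J^{(3)}_\nu(x;q)=\frac{(q^{\nu+1};q)_\infty}{(q;q)_\infty}\Big(\frac x2\Big)^\nu\sum_{k\ge0}\frac{(-1)^kq^{k(k-1)/2}}{(q;q)_k\,(q^{\nu+1};q)_k}\Big(\frac{qx^2}4\Big)^k;$$ for integer orders (including negative ones) it is given by the generating function $\dfrac{(qx/2z;q)_\infty}{(xz/2;q)_\infty}=\sum_{n\in\mathbb{Z}}z^nJ^{(3)}_n(x;q)$. The quotient formula for $K_{q\mathrm{B}}(r,s)$ is the closed form of the series $q^{\frac12(r+s)}\sum_{k\in\{\frac12,\frac32,\dots\}}q^kJ_{r+k}J_{s+k}$. *)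

theory Defs
  imports "HOL-Analysis.Analysis" "Jordan_Normal_Form.Determinant"
begin

text \<open>
  A partition is a weakly decreasing, finitely supported sequence of naturals. Sequences are
  indexed from 0, so \<open>lam i\<close> is the part $\lambda_{i+1}$ of the usual notation, and the cell
  \<open>(i, j)\<close> is the cell $(i+1, j+1)$.
\<close>

definition partitions :: "(nat \<Rightarrow> nat) set" where
  "partitions = {lam. antimono lam \<and> finite {i. lam i \<noteq> 0}}"

definition psize :: "(nat \<Rightarrow> nat) \<Rightarrow> nat" where
  "psize lam = (\<Sum>i | lam i \<noteq> 0. lam i)"

definition pb :: "(nat \<Rightarrow> nat) \<Rightarrow> nat" where
  "pb lam = (\<Sum>i | lam i \<noteq> 0. i * lam i)"

definition ptranspose :: "(nat \<Rightarrow> nat) \<Rightarrow> nat \<Rightarrow> nat" where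
  "ptranspose lam j = card {i. j < lam i}"

definition cells :: "(nat \<Rightarrow> nat) \<Rightarrow> (nat \<times> nat) set" where
  "cells lam = {(i, j). j < lam i}"

text \<open>
  With 1-based \<open>i\<close>, \<open>j\<close> the hook length is $\lambda_i + \lambda^{\mathrm T}_j - i - j + 1$; the
  shift to 0-based indices turns the final $+1$ into $-1$. On \<open>cells lam\<close> the subtractions do
  not truncate.
\<close>

definition hook :: "(nat \<Rightarrow> nat) \<Rightarrow> nat \<Rightarrow> nat \<Rightarrow> nat" where
  "hook lam i j = lam i + ptranspose lam j - i - j - 1"

definition half_ints :: "real set" where
  "half_ints = range (\<lambda>n::int. of_int n + 1/2)"

text \<open>The term $\lambda_i - i + \frac12$ with \<open>i\<close> shifted by one.\<close>

definition Xi :: "(nat \<Rightarrow> nat) \<Rightarrow> real set" where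
  "Xi lam = range (\<lambda>i. real (lam i) - real (Suc i) + 1/2)"

text \<open>The squared type $q$-Plancherel measure and its correlation function. For \<open>q = 0\<close> the
  convention $0^0 = 1$ makes it the point mass at the empty partition.\<close>

definition qPP_norm :: "real \<Rightarrow> real \<Rightarrow> real" where
  "qPP_norm \<xi> q = (\<Prod>n. 1 / (1 - \<xi>\<^sup>2 * q ^ Suc n) ^ Suc n)"

definition qPP_weight :: "real \<Rightarrow> real \<Rightarrow> (nat \<Rightarrow> nat) \<Rightarrow> real" where
  "qPP_weight \<xi> q lam =
     inverse (qPP_norm \<xi> q) * (\<xi>\<^sup>2 * q) ^ psize lam * q ^ (2 * pb lam) *
     (\<Prod>(i, j)\<in>cells lam. 1 / (1 - q ^ hook lam i j)\<^sup>2)"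

definition qPP :: "real \<Rightarrow> real \<Rightarrow> (nat \<Rightarrow> nat) measure" where
  "qPP \<xi> q = point_measure partitions (\<lambda>lam. ennreal (qPP_weight \<xi> q lam))"

definition correlation :: "real \<Rightarrow> real \<Rightarrow> real set \<Rightarrow> real" where
  "correlation \<xi> q Z = measure (qPP \<xi> q) {lam \<in> partitions. Z \<subseteq> Xi lam}"

definition qpoch_inf :: "'a::real_normed_field \<Rightarrow> 'a \<Rightarrow> 'a" where
  "qpoch_inf a q = (\<Prod>k. 1 - a * q ^ k)"

text \<open>
  The Hahn--Exton $q$-Bessel function $J^{(3)}_n(x; q)$ of integer order \<open>n\<close>, as the Laurent
  coefficient of $z^n$ in $(qx/2z; q)_\infty / (xz/2; q)_\infty$ on the annulus
  \<open>0 < \<bar>z\<bar> < 2 / \<bar>x\<bar>\<close> (the punctured plane if \<open>x = 0\<close>), on which the denominator has no zeros.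
  The coefficient family is uniquely determined for \<open>0 \<le> q < 1\<close>.
\<close>

definition hahn_exton_J :: "int \<Rightarrow> real \<Rightarrow> real \<Rightarrow> real" where
  "hahn_exton_J n x q =
     (THE J :: int \<Rightarrow> real. \<forall>z::complex. z \<noteq> 0 \<and> norm (of_real x * z) < 2 \<longrightarrow>
        ((\<lambda>m. z powi m * of_real (J m)) has_sum
           qpoch_inf (of_real q * of_real x / (2 * z)) (of_real q) /
           qpoch_inf (of_real x * z / 2) (of_real q)) UNIV) n"

text \<open>
  The $q$-Bessel kernel. The quotient formula is $0/0$ on the diagonal; there the kernel is
  the series $q^{\frac12(r+s)} \sum_{k \in \{\frac12, \frac32, \ldots\}} q^k J_{r+k} J_{s+k}$ whose
  closed form the quotient is, with \<open>r = s\<close> and \<open>k\<close> replaced by \<open>k + 1/2\<close>. Its exponents are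
  integers and are written with \<open>powi\<close>, so that the terms have the right values for \<open>q = 0\<close>,
  too (\<open>0 powi 0 = 1\<close>, unlike \<open>0 powr 0\<close>). Off the diagonal, the denominator of the quotient
  is infinite in the limit $q \to 0$; in HOL it is 0 for \<open>q = 0\<close>, and both readings give the
  kernel the value 0.
\<close>

definition qBessel_kernel :: "real \<Rightarrow> real \<Rightarrow> real \<Rightarrow> real \<Rightarrow> real" where
  "qBessel_kernel \<xi> q r s =
     (let J = (\<lambda>t. hahn_exton_J \<lfloor>t\<rfloor> (2 * \<xi>) q) in
      if r = s then (\<Sum>k. q powi \<lfloor>r + (real k + 1/2)\<rfloor> * (J (r + (real k + 1/2)))\<^sup>2)
      else \<xi> * (J (r + 1/2) * J (s - 1/2) - J (r - 1/2) * J (s + 1/2)) /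
             (q powr ((r - s) / 2) - q powr (- ((r - s) / 2))))"

end

theory Submission
  imports Defs
begin

text \<open>
  The weight of a partition is the square of the Schur function $s_\lambda$ at
  $x_i = \xi q^{i + 1/2}$, $i \ge 0$. Truncating to the variables $x_0, \ldots, x_{N-1}$ gives a
  measure on $N$-point subsets $\{\lambda_i + N - i\}$ of the naturals whose weights are squared
  Vandermonde determinants in $q^{\lambda_i + N - i}$. Such an ensemble is determinantal with the
  projection kernel $K_N$ onto the span of the sequences $(x_i^n)_n$. Since this span is the model
  space of the Blaschke product $\prod_i (z - x_i) / (1 - x_i z)$, the kernel is a sum of products
  of the Taylor coefficients of the Blaschke product, and these converge to rescaled Hahn--Exton
  $q$-Bessel functions. The truncated weights increase to the weight of the full measure, so the
  correlation functions converge by monotone convergence. The quotient formula for the kernel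
  follows from the three-term recurrence of the $q$-Bessel functions by telescoping.
\<close>

subsection \<open>Determinants of kernels\<close>

text \<open>The Gram matrix 1/(1 - x_i x_j) of the sequences (x_i^n)_n has an explicit inverse, with
  entries w_i w_j / (1 - x_i x_j), where w_i is the reciprocal derivative of the Blaschke product at
  its zero x_i. Expanding this last denominator as a geometric series gives the kernel the shape of
  the q-Bessel series. Positions have to be counted from N: the point a + 1/2 of
  \<open>Xi lam\<close> becomes the natural number N + a, and at such indices the rescaled Blaschke
  coefficients converge. Rearranging sums over configurations requires terms of one sign, but the
  determinant of the inverse Gram matrix is known only through its square. A sign is therefore
  carried along as a factor and settled at the end by the total mass. The truncated weight of a
  partition is the full weight times the square of a product of factors 1 - q^c whose exponents c
  grow with N; this is the source of the monotonicity.\<close>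

definition kdet :: "('a \<Rightarrow> 'a \<Rightarrow> real) \<Rightarrow> 'a list \<Rightarrow> real" where
  "kdet K xs = Determinant.det (Matrix.mat (length xs) (length xs) (\<lambda>(i, j). K (xs ! i) (xs ! j)))"

lemma kdet_Nil [simp]: "kdet K [] = 1"
  by (simp add: kdet_def det_dim_zero)

lemma kdet_eq_0:
  assumes "\<not> distinct xs"
  shows "kdet K xs = 0"
proof -
  obtain i j where ij: "i < length xs" "j < length xs" "i \<noteq> j" "xs ! i = xs ! j"
    using assms by (auto simp: distinct_conv_nth)
  show ?thesis unfolding kdet_def
    by (rule det_identical_rows[where n = "length xs" and i = i and j = j])
       (use ij in \<open>auto intro!: eq_vecI\<close>)
qed

text \<open>The same permutation acts on rows and on columns, so its sign enters twice. A point set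
  may thus be listed in any order.\<close>

lemma kdet_mset_cong:
  assumes "mset xs = mset ys"
  shows "kdet K xs = kdet K ys"
proof -
  let ?n = "length ys"
  obtain p where p: "p permutes {..<?n}" and xs: "permute_list p ys = xs"
    using mset_eq_permutation[OF assms] by blast
  have p': "p permutes {0..<?n}" using p by (simp add: atLeast0LessThan)
  have len: "length xs = ?n" using xs by auto
  have nth: "xs ! i = ys ! p i" if "i < ?n" for i
    using xs permute_list_nth[OF p that] by auto
  have pl: "p i < ?n" if "i < ?n" for i
    using permutes_in_image[OF p, of i] that by auto
  define A where "A = Matrix.mat ?n ?n (\<lambda>(i, j). K (ys ! i) (ys ! j))"
  define B where "B = Matrix.mat ?n ?n (\<lambda>(i, j). A $$ (p i, j))"
  have A: "A \<in> carrier_mat ?n ?n" and B: "B \<in> carrier_mat ?n ?n" by (auto simp: A_def B_def)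
  have dB: "Determinant.det B = signof p * Determinant.det A"
    unfolding B_def by (rule det_permute_rows[OF A p'])
  define C where "C = Matrix.mat ?n ?n (\<lambda>(i, j). transpose_mat B $$ (p i, j))"
  have "Determinant.det C = signof p * Determinant.det (transpose_mat B)"
    unfolding C_def by (rule det_permute_rows[OF _ p']) (use B in auto)
  also have "\<dots> = signof p * signof p * Determinant.det A"
    using det_transpose[OF B] dB by simp
  also have "(signof p :: real) * signof p = 1" by (auto simp: sign_def)
  finally have "Determinant.det C = Determinant.det A" by simp
  moreover have "transpose_mat C = Matrix.mat ?n ?n (\<lambda>(i, j). K (xs ! i) (xs ! j))"
    by (rule eq_matI) (auto simp: C_def B_def A_def nth pl)
  moreover have "Determinant.det (transpose_mat C) = Determinant.det C"
    by (rule det_transpose[of _ ?n]) (auto simp: C_def)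
  ultimately show ?thesis by (simp add: kdet_def A_def len)
qed

text \<open>Laplace expansion along the last column, then along the last row. The border enters only
  through its corner and through products of one entry from each side, which the reproducing
  property of a kernel can sum.\<close>

lemma det_bordered:
  fixes B :: "'a :: comm_ring_1 mat"
  assumes B: "B \<in> carrier_mat (Suc k) (Suc k)"
  defines "A \<equiv> Matrix.mat k k (\<lambda>(i, j). B $$ (i, j))"
  shows "Determinant.det B = B $$ (k, k) * Determinant.det A -
           (\<Sum>i<k. \<Sum>j<k. B $$ (i, k) * B $$ (k, j) * cofactor A i j)"
proof -
  have "Determinant.det B = (\<Sum>i<Suc k. B $$ (i, k) * cofactor B i k)"
    by (rule laplace_expansion_column[OF B]) simp
  also have "\<dots> = (\<Sum>i<k. B $$ (i, k) * cofactor B i k) + B $$ (k, k) * cofactor B k k" by simp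
  also have "cofactor B k k = Determinant.det A"
  proof -
    have "mat_delete B k k = A"
      by (rule eq_matI) (use B in \<open>auto simp: A_def mat_delete_def\<close>)
    thus ?thesis by (simp add: cofactor_def)
  qed
  also have "(\<Sum>i<k. B $$ (i, k) * cofactor B i k) =
      (\<Sum>i<k. \<Sum>j<k. - (B $$ (i, k) * B $$ (k, j) * cofactor A i j))"
  proof (rule sum.cong[OF refl])
    fix i assume i: "i \<in> {..<k}"
    define M where "M = mat_delete B i k"
    have M: "M \<in> carrier_mat k k" using mat_delete_carrier[OF B] by (simp add: M_def)
    obtain k' where k': "k = Suc k'" using i by (cases k) auto
    \<comment> \<open>With row i gone, the last row of B is row k' = k - 1 of M; this shift by one
      produces the minus sign in \<open>sgn\<close>.\<close>
    have "Determinant.det M = (\<Sum>j<k. M $$ (k', j) * cofactor M k' j)"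
      by (rule laplace_expansion_row[OF M]) (simp add: k')
    also have "\<dots> = (\<Sum>j<k. B $$ (k, j) * ((-1) ^ (k' + j) * Determinant.det (mat_delete A i j)))"
    proof (rule sum.cong[OF refl])
      fix j assume j: "j \<in> {..<k}"
      have "mat_delete M k' j = mat_delete A i j"
        by (rule eq_matI) (use B i j in \<open>auto simp: A_def M_def mat_delete_def k'\<close>)
      moreover have "M $$ (k', j) = B $$ (k, j)"
        using B i j by (auto simp: M_def mat_delete_def k')
      ultimately show "M $$ (k', j) * cofactor M k' j =
          B $$ (k, j) * ((-1) ^ (k' + j) * Determinant.det (mat_delete A i j))"
        by (simp add: cofactor_def)
    qed
    finally have d: "Determinant.det M =
      (\<Sum>j<k. B $$ (k, j) * ((-1) ^ (k' + j) * Determinant.det (mat_delete A i j)))" .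
    have sgn: "(-1 :: 'a) ^ (i + k) * (-1) ^ (k' + j) = - ((-1) ^ (i + j))" for j
    proof -
      have "(-1 :: 'a) ^ (i + k) * (-1) ^ (k' + j) = (-1) ^ (2 * k' + Suc (i + j))"
        by (simp add: k' power_add[symmetric] mult_2 add_ac)
      thus ?thesis by (simp add: power_add power_mult)
    qed
    have "B $$ (i, k) * cofactor B i k = B $$ (i, k) * ((-1) ^ (i + k) * Determinant.det M)"
      by (simp add: cofactor_def M_def)
    also have "\<dots> = (\<Sum>j<k. B $$ (i, k) * B $$ (k, j) * ((-1) ^ (i + k) * (-1) ^ (k' + j)) *
          Determinant.det (mat_delete A i j))"
      unfolding d by (simp add: sum_distrib_left mult_ac)
    also have "\<dots> = (\<Sum>j<k. - (B $$ (i, k) * B $$ (k, j) * cofactor A i j))"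
      unfolding sgn by (simp add: cofactor_def mult_ac)
    finally show "B $$ (i, k) * cofactor B i k =
        (\<Sum>j<k. - (B $$ (i, k) * B $$ (k, j) * cofactor A i j))" .
  qed
  finally show ?thesis by (simp add: sum_negf)
qed

lemma has_sum_diff:
  fixes f g :: "'a \<Rightarrow> 'b :: real_normed_vector"
  assumes "(f has_sum a) A" "(g has_sum b) A"
  shows "((\<lambda>x. f x - g x) has_sum (a - b)) A"
  using has_sum_add[OF assms(1), of "\<lambda>x. - g x" "- b"] assms(2) by (simp add: has_sum_uminus)

lemma has_sum_sum':
  fixes f :: "'i \<Rightarrow> 'a \<Rightarrow> 'b :: real_normed_vector"
  assumes "\<And>i. i \<in> I \<Longrightarrow> (f i has_sum s i) A"
  shows "((\<lambda>x. \<Sum>i\<in>I. f i x) has_sum (\<Sum>i\<in>I. s i)) A"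
  using assms by (induction I rule: infinite_finite_induct) (auto intro!: has_sum_add)

text \<open>Integrating out one point: the corner of the bordered determinant sums to the trace, and
  each product of border entries sums to an entry of the kernel. The correction then contains one
  Laplace expansion of \<open>kdet K xs\<close> per row, hence \<open>length xs\<close> copies of
  it.\<close>

lemma has_sum_kdet_snoc:
  assumes rep: "\<And>a b. ((\<lambda>y. K a y * K y b) has_sum K a b) UNIV"
    and tr: "((\<lambda>y. K y y) has_sum t) UNIV"
  shows "((\<lambda>x. kdet K (xs @ [x])) has_sum (t - real (length xs)) * kdet K xs) UNIV"
proof -
  let ?k = "length xs"
  define A where "A = Matrix.mat ?k ?k (\<lambda>(i, j). K (xs ! i) (xs ! j))"
  have A: "A \<in> carrier_mat ?k ?k" by (simp add: A_def)
  have kA: "kdet K xs = Determinant.det A" by (simp add: kdet_def A_def)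
  have eq: "kdet K (xs @ [x]) = K x x * kdet K xs -
      (\<Sum>i<?k. \<Sum>j<?k. K (xs ! i) x * K x (xs ! j) * cofactor A i j)" for x
  proof -
    define B where "B = Matrix.mat (Suc ?k) (Suc ?k) (\<lambda>(i, j). K ((xs @ [x]) ! i) ((xs @ [x]) ! j))"
    have B: "B \<in> carrier_mat (Suc ?k) (Suc ?k)" by (simp add: B_def)
    have AB: "Matrix.mat ?k ?k (\<lambda>(i, j). B $$ (i, j)) = A"
      by (rule eq_matI) (auto simp: A_def B_def nth_append)
    show ?thesis
      using det_bordered[OF B] unfolding AB kA by (simp add: kdet_def B_def nth_append)
  qed
  have "((\<lambda>x. kdet K (xs @ [x])) has_sum
      (t * kdet K xs - (\<Sum>i<?k. \<Sum>j<?k. K (xs ! i) (xs ! j) * cofactor A i j))) UNIV"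
    unfolding eq
    by (intro has_sum_diff has_sum_cmult_left has_sum_sum' rep tr)
  also have "(\<Sum>i<?k. \<Sum>j<?k. K (xs ! i) (xs ! j) * cofactor A i j) = (\<Sum>i<?k. Determinant.det A)"
    by (rule sum.cong[OF refl], subst laplace_expansion_row[OF A]) (auto simp: A_def)
  finally show ?thesis by (simp add: kA algebra_simps)
qed

text \<open>The change from monomials to the monic Newton polynomials P_j = prod_{i<j} (X - x_i) is
  unitriangular, and P_j vanishes at x_i for i < j, so the matrix of values becomes lower
  triangular.\<close>

lemma det_vandermonde:
  fixes x :: "nat \<Rightarrow> real"
  shows "Determinant.det (Matrix.mat n n (\<lambda>(i, j). x i ^ j)) = (\<Prod>j<n. \<Prod>i<j. x j - x i)"
proof -
  define P where "P j = (\<Prod>i<j. [:- x i, 1:])" for j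
  have deg: "degree (P j) = j" for j
    unfolding P_def by (subst degree_prod_eq_sum_degree) auto
  have lc: "coeff (P j) j = 1" for j
    using lead_coeff_prod[of "\<lambda>i. [:- x i, 1:]" "{..<j}"] by (simp add: deg P_def[symmetric])
  have pP: "poly (P j) t = (\<Prod>i<j. t - x i)" for j t
    by (simp add: P_def poly_prod)
  define V where "V = Matrix.mat n n (\<lambda>(i, j). x i ^ j)"
  define U where "U = Matrix.mat n n (\<lambda>(i, j). coeff (P j) i)"
  define L where "L = Matrix.mat n n (\<lambda>(i, j). poly (P j) (x i))"
  have "V * U = L"
  proof (rule eq_matI)
    fix i j assume "i < dim_row L" "j < dim_col L"
    hence ij: "i < n" "j < n" by (auto simp: L_def)
    have "(V * U) $$ (i, j) = (\<Sum>k<n. x i ^ k * coeff (P j) k)"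
      using ij by (simp add: V_def U_def scalar_prod_def atLeast0LessThan)
    also have "\<dots> = (\<Sum>k\<le>j. x i ^ k * coeff (P j) k)"
      by (rule sum.mono_neutral_right) (use ij deg[of j] in \<open>auto simp: coeff_eq_0\<close>)
    also have "\<dots> = poly (P j) (x i)"
      by (simp add: poly_altdef deg mult.commute)
    finally show "(V * U) $$ (i, j) = L $$ (i, j)" using ij by (simp add: L_def)
  qed (auto simp: V_def U_def L_def)
  moreover have "Determinant.det U = 1"
    by (subst det_upper_triangular[of _ n])
       (auto simp: U_def prod_list_diag_prod lc upper_triangular_def deg coeff_eq_0)
  moreover have "Determinant.det L = (\<Prod>j<n. \<Prod>i<j. x j - x i)"
  proof (subst det_lower_triangular[of n])
    fix i j :: nat assume "i < j" "j < n"
    thus "L $$ (i, j) = 0" by (auto simp: L_def pP intro!: prod_zero)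
  qed (auto simp: L_def prod_list_diag_prod pP atLeast0LessThan)
  moreover have "Determinant.det (V * U) = Determinant.det V * Determinant.det U"
    by (rule det_mult[of _ n]) (auto simp: V_def U_def)
  ultimately show ?thesis by (simp add: V_def)
qed

section \<open>Sums of determinants over the N-point sets containing given points\<close>

definition kdet_set :: "('a :: linorder \<Rightarrow> 'a \<Rightarrow> real) \<Rightarrow> 'a set \<Rightarrow> real" where
  "kdet_set K A = kdet K (sorted_list_of_set A)"

lemma kdet_eq_kdet_set: "distinct xs \<Longrightarrow> kdet K xs = kdet_set K (set xs)"
  unfolding kdet_set_def
  by (rule kdet_mset_cong) (auto simp: set_eq_iff_mset_eq_distinct[symmetric])

text \<open>Induction on the number of missing points. Pairs (x, S) with x in S - A are summed in
  two ways: over S first for fixed x, where the induction hypothesis applies, and over x first for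
  fixed S, where each S is counted N - card A times. The exchange rests on terms of one sign; the
  factor \<epsilon> stands for that sign, which is determined only later.\<close>

lemma has_sum_kdet_set_supersets:
  fixes K :: "'a :: linorder \<Rightarrow> 'a \<Rightarrow> real"
  assumes rep: "\<And>a b. ((\<lambda>y. K a y * K y b) has_sum K a b) UNIV"
    and tr: "((\<lambda>y. K y y) has_sum real N) UNIV"
    and nonneg: "\<And>S. finite S \<Longrightarrow> card S = N \<Longrightarrow> 0 \<le> \<epsilon> * kdet_set K S"
    and A: "finite A" "card A \<le> N"
  shows "((\<lambda>S. \<epsilon> * kdet_set K S) has_sum \<epsilon> * kdet_set K A) {S. finite S \<and> card S = N \<and> A \<subseteq> S}"
  using A
proof (induction "N - card A" arbitrary: A)
  case 0
  hence A: "finite A" "card A = N" by simp_all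
  have "S = A" if "finite S" "card S = N" "A \<subseteq> S" for S
    using card_subset_eq[OF that(1) that(3)] that(2) A(2) by simp
  hence "{S. finite S \<and> card S = N \<and> A \<subseteq> S} = {A}"
    using A by blast
  thus ?case by (simp add: has_sum_finiteI)
next
  case (Suc m)
  define k where "k = card A"
  define g where "g S = \<epsilon> * kdet_set K S" for S
  define \<Omega> where "\<Omega> B = {S. finite S \<and> card S = N \<and> B \<subseteq> S}" for B :: "'a set"
  have kN: "k < N" using Suc by (simp add: k_def)
  have g_nonneg: "0 \<le> g S" if "S \<in> \<Omega> B" for S B
    using that nonneg by (auto simp: g_def \<Omega>_def)
  have IH: "(g has_sum g (insert x A)) (\<Omega> (insert x A))" if "x \<notin> A" for x
    unfolding g_def \<Omega>_def by (rule Suc.hyps(1)) (use Suc.hyps(2) Suc.prems that in auto)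
  let ?xs = "sorted_list_of_set A"
  have "((\<lambda>x. kdet K (?xs @ [x])) has_sum (real N - real k) * kdet_set K A) UNIV"
    using has_sum_kdet_snoc[OF rep tr, of ?xs] by (simp add: kdet_set_def k_def)
  also have "?this \<longleftrightarrow> ((\<lambda>x. kdet_set K (insert x A)) has_sum (real N - real k) * kdet_set K A) (- A)"
  proof (rule has_sum_cong_neutral)
    fix x assume "x \<in> UNIV - - A"
    thus "kdet K (?xs @ [x]) = 0" using Suc.prems by (intro kdet_eq_0) auto
  next
    fix x assume "x \<in> UNIV \<inter> - A"
    thus "kdet K (?xs @ [x]) = kdet_set K (insert x A)"
      using Suc.prems by (subst kdet_eq_kdet_set) auto
  qed auto
  finally have "((\<lambda>x. \<epsilon> * kdet_set K (insert x A)) has_sum \<epsilon> * ((real N - real k) * kdet_set K A)) (- A)"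
    by (rule has_sum_cmult_right)
  hence outer: "((\<lambda>x. g (insert x A)) has_sum (real N - real k) * g A) (- A)"
    by (simp add: g_def mult_ac)
  have sig: "((\<lambda>(x, S). g S) has_sum (real N - real k) * g A) (Sigma (- A) (\<lambda>x. \<Omega> (insert x A)))"
  proof (rule has_sum_SigmaI[where g = "\<lambda>x. g (insert x A)"])
    show "(\<lambda>(x, S). g S) summable_on Sigma (- A) (\<lambda>x. \<Omega> (insert x A))"
    proof (rule summable_on_SigmaI[where g = "\<lambda>x. g (insert x A)"])
      show "(\<lambda>x. g (insert x A)) summable_on - A"
        by (rule has_sum_imp_summable[OF outer])
    qed (auto intro: g_nonneg IH)
  qed (auto intro: outer IH)
  also have "?this \<longleftrightarrow> ((\<lambda>(S, x). g S) has_sum (real N - real k) * g A) (Sigma (\<Omega> A) (\<lambda>S. S - A))"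
    by (rule has_sum_reindex_bij_witness[of _ "\<lambda>(S, x). (x, S)" "\<lambda>(x, S). (S, x)"]) (auto simp: \<Omega>_def)
  finally have "((\<lambda>(S, x). g S) has_sum (real N - real k) * g A) (Sigma (\<Omega> A) (\<lambda>S. S - A))" .
  hence "((\<lambda>S. real (N - k) * g S) has_sum (real N - real k) * g A) (\<Omega> A)"
  proof (rule has_sum_SigmaD)
    fix S assume S: "S \<in> \<Omega> A"
    hence "card (S - A) = N - k" using Suc.prems by (auto simp: \<Omega>_def k_def card_Diff_subset)
    thus "((\<lambda>x. case (S, x) of (S, x) \<Rightarrow> g S) has_sum real (N - k) * g S) (S - A)"
      using S by (intro has_sum_finiteI) (auto simp: \<Omega>_def)
  qed
  hence "((\<lambda>S. inverse (real (N - k)) * (real (N - k) * g S)) has_sum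
      inverse (real (N - k)) * ((real N - real k) * g A)) (\<Omega> A)"
    by (rule has_sum_cmult_right)
  moreover have "inverse (real (N - k)) * (real (N - k) * t) = t"
    and "inverse (real (N - k)) * ((real N - real k) * t) = t" for t
    using kN by (auto simp: of_nat_diff)
  ultimately show ?case by (simp add: g_def \<Omega>_def)
qed

subsection \<open>The projection kernel of a finite Blaschke product\<close>

lemma has_sum_geometric_real:
  fixes t :: real
  assumes "\<bar>t\<bar> < 1"
  shows "((\<lambda>n. t ^ n) has_sum 1 / (1 - t)) UNIV"
  using assms by (intro norm_summable_imp_has_sum) (auto intro: geometric_sums summable_geometric simp: power_abs)

locale blaschke_nodes =
  fixes N :: nat and x :: "nat \<Rightarrow> real"
  assumes x_pos: "\<And>i. i < N \<Longrightarrow> 0 < x i"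
    and x_lt_1: "\<And>i. i < N \<Longrightarrow> x i < 1"
    and x_inj: "inj_on x {..<N}"
begin

text \<open>\<open>w i\<close> is $1 / B'(x_i)$ for the Blaschke product $B(z) = \prod_i (z - x_i) / (1 - x_i z)$, and
  \<open>\<beta> n\<close> is the Taylor coefficient of $B$ at $z^{n+1}$.\<close>

definition w :: "nat \<Rightarrow> real" where
  "w i = (\<Prod>k<N. 1 - x i * x k) / (\<Prod>k\<in>{..<N} - {i}. x i - x k)"

text \<open>By \<open>C_inverse_Cauchy\<close> this is the inverse of the Gram matrix of the
  sequences (x_i^n)_n, which makes \<open>K\<close> the orthogonal projection onto their
  span.\<close>

definition C :: "nat \<Rightarrow> nat \<Rightarrow> real" where
  "C i j = w i * w j / (1 - x i * x j)"

definition \<beta> :: "nat \<Rightarrow> real" where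
  "\<beta> n = (\<Sum>i<N. w i * x i ^ n)"

definition K :: "nat \<Rightarrow> nat \<Rightarrow> real" where
  "K a b = (\<Sum>i<N. \<Sum>j<N. C i j * x i ^ a * x j ^ b)"

lemma x_neq: "i < N \<Longrightarrow> j < N \<Longrightarrow> i \<noteq> j \<Longrightarrow> x i \<noteq> x j"
  using x_inj by (auto simp: inj_on_def)

lemma xx_lt_1: "i < N \<Longrightarrow> j < N \<Longrightarrow> x i * x j < 1"
  using mult_strict_mono[of "x i" 1 "x j" 1] x_pos[of i] x_lt_1[of i] x_pos[of j] x_lt_1[of j] by simp

lemma abs_xx_lt_1: "i < N \<Longrightarrow> j < N \<Longrightarrow> \<bar>x i * x j\<bar> < 1"
  using xx_lt_1[of i j] x_pos[of i] x_pos[of j] by (simp add: abs_mult)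

lemma w_nonzero: "i < N \<Longrightarrow> w i \<noteq> 0"
  using xx_lt_1[of i] x_neq[of i] by (force simp: w_def)

text \<open>Both sides have degree at most N and agree at N + 1 points: at 0 by the choice of b, and
  at each 1/x_k, where all summands but one vanish. The identity is kept among polynomials because
  it is read both for real functions and for power series.\<close>

lemma partial_fraction_poly:
  obtains b where "(\<Prod>i<N. [:- x i, 1:]) =
    Polynomial.smult b (\<Prod>i<N. [:1, - x i:]) + (\<Sum>j<N. Polynomial.smult (w j / x j) (\<Prod>i\<in>{..<N} - {j}. [:1, - x i:]))"
proof -
  define p where "p = (\<Prod>i<N. [:- x i, 1:])"
  define r where "r = (\<Sum>j<N. Polynomial.smult (w j / x j) (\<Prod>i\<in>{..<N} - {j}. [:1, - x i:]))"
  define b where "b = poly p 0 - poly r 0"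
  define A where "A = insert 0 ((\<lambda>i. 1 / x i) ` {..<N})"
  have deg_le: "degree (\<Prod>i\<in>I. [:1, - x i:]) \<le> card I" for I
    using degree_prod_sum_le[of I "\<lambda>i. [:1, - x i:]"]
    by (cases "finite I") (auto intro: order.trans[OF _ order.trans[OF sum_bounded_above[of I _ 1]]])
  have "card A = Suc N"
  proof -
    have "inj_on (\<lambda>i. 1 / x i) {..<N}"
      using x_inj x_pos by (auto simp: inj_on_def field_simps)
    moreover have "0 \<notin> (\<lambda>i. 1 / x i) ` {..<N}" using x_pos by force
    ultimately show ?thesis by (simp add: A_def card_image)
  qed
  moreover have "degree p \<le> N"
    unfolding p_def by (rule order.trans[OF degree_prod_sum_le]) auto
  moreover have "degree (Polynomial.smult b (\<Prod>i<N. [:1, - x i:]) + r) \<le> N"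
    unfolding r_def
    by (intro degree_add_le degree_sum_le order.trans[OF degree_smult_le] order.trans[OF deg_le])
       (auto intro: card_mono)
  moreover have "poly p z = poly (Polynomial.smult b (\<Prod>i<N. [:1, - x i:]) + r) z" if z_A: "z \<in> A" for z
  proof (cases "z = 0")
    case True
    thus ?thesis by (simp add: b_def poly_prod)
  next
    case False
    then obtain k where k: "k < N" "z = 1 / x k" using z_A by (auto simp: A_def)
    have xk: "x k \<noteq> 0" using x_pos[of k] k by simp
    have z: "1 - x k * z = 0" using k xk by simp
    have z1: "1 - x i * z = (x k - x i) / x k" and z2: "z - x i = (1 - x k * x i) / x k" for i
      using k xk by (simp_all add: field_simps)
    have "poly r z = (\<Sum>j<N. w j / x j * (\<Prod>i\<in>{..<N} - {j}. 1 - x i * z))"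
      by (simp add: r_def poly_sum poly_prod mult.commute)
    also have "\<dots> = (\<Sum>j\<in>{k}. w j / x j * (\<Prod>i\<in>{..<N} - {j}. 1 - x i * z))"
    proof (rule sum.mono_neutral_right)
      show "\<forall>j\<in>{..<N} - {k}. w j / x j * (\<Prod>i\<in>{..<N} - {j}. 1 - x i * z) = 0"
        using k z by (auto intro!: bexI[of _ k])
    qed (use k in auto)
    also have "\<dots> = w k / x k * (\<Prod>i\<in>{..<N} - {k}. (x k - x i) / x k)"
      by (simp add: z1)
    also have "\<dots> = w k * (\<Prod>i\<in>{..<N} - {k}. x k - x i) / (x k * (\<Prod>i\<in>{..<N} - {k}. x k))"
      by (simp add: prod_dividef)
    also have "w k * (\<Prod>i\<in>{..<N} - {k}. x k - x i) = (\<Prod>i<N. 1 - x k * x i)"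
      using x_neq[of k] k by (force simp: w_def)
    also have "x k * (\<Prod>i\<in>{..<N} - {k}. x k) = (\<Prod>i<N. x k)"
      using k by (subst (2) prod.remove[of _ k]) auto
    also have "(\<Prod>i<N. 1 - x k * x i) / (\<Prod>i<N. x k) = (\<Prod>i<N. z - x i)"
      by (simp only: z2 prod_dividef)
    finally have "poly r z = (\<Prod>i<N. z - x i)" .
    moreover have "poly (\<Prod>i<N. [:1, - x i:]) z = 0"
      using k z by (auto simp: poly_prod mult.commute intro!: bexI[of _ k])
    ultimately show ?thesis by (simp add: p_def poly_prod)
  qed
  ultimately have "p = Polynomial.smult b (\<Prod>i<N. [:1, - x i:]) + r"
    by (intro poly_eqI_degree[of A]) auto
  thus ?thesis using that by (simp add: p_def r_def)
qed

lemma partial_fraction: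
  obtains b where "\<And>z. (\<And>i. i < N \<Longrightarrow> x i * z \<noteq> 1) \<Longrightarrow>
    (\<Prod>i<N. (z - x i) / (1 - x i * z)) = b + (\<Sum>j<N. w j / x j / (1 - x j * z))"
proof -
  obtain b where b: "(\<Prod>i<N. [:- x i, 1:]) =
    Polynomial.smult b (\<Prod>i<N. [:1, - x i:]) + (\<Sum>j<N. Polynomial.smult (w j / x j) (\<Prod>i\<in>{..<N} - {j}. [:1, - x i:]))"
    by (rule partial_fraction_poly)
  show ?thesis
  proof (rule that[of b])
    fix z assume z: "\<And>i. i < N \<Longrightarrow> x i * z \<noteq> 1"
    hence nz: "(\<Prod>i<N. 1 - x i * z) \<noteq> 0" by force
    have "(\<Prod>i<N. z - x i) = poly (\<Prod>i<N. [:- x i, 1:]) z" by (simp add: poly_prod)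
    also have "\<dots> = b * (\<Prod>i<N. 1 - x i * z) +
        (\<Sum>j<N. w j / x j * (\<Prod>i\<in>{..<N} - {j}. 1 - x i * z))"
      unfolding b by (simp add: poly_prod poly_sum mult.commute)
    also have "(\<Sum>j<N. w j / x j * (\<Prod>i\<in>{..<N} - {j}. 1 - x i * z)) =
        (\<Sum>j<N. w j / x j / (1 - x j * z) * (\<Prod>i<N. 1 - x i * z))"
    proof (rule sum.cong[OF refl])
      fix j assume j: "j \<in> {..<N}"
      have "(\<Prod>i<N. 1 - x i * z) = (1 - x j * z) * (\<Prod>i\<in>{..<N} - {j}. 1 - x i * z)"
        using j by (subst prod.remove[of _ j]) auto
      thus "w j / x j * (\<Prod>i\<in>{..<N} - {j}. 1 - x i * z) =
          w j / x j / (1 - x j * z) * (\<Prod>i<N. 1 - x i * z)" using z[of j] j by simp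
    qed
    finally have "(\<Prod>i<N. z - x i) = (b + (\<Sum>j<N. w j / x j / (1 - x j * z))) * (\<Prod>i<N. 1 - x i * z)"
      by (simp add: algebra_simps sum_distrib_left)
    thus "(\<Prod>i<N. (z - x i) / (1 - x i * z)) = b + (\<Sum>j<N. w j / x j / (1 - x j * z))"
      using nz by (simp add: prod_dividef)
  qed
qed

text \<open>F(z) = sum_j (w_j / x_j) / (1 - x_j z) is the Blaschke product minus a constant, so it
  takes the same value at all nodes. Off the diagonal the sum is a multiple of the difference
  quotient of F between two nodes, which is 0; on the diagonal it is w_i times the derivative of the
  Blaschke product at x_i, which is 1/w_i.\<close>

lemma C_inverse_Cauchy:
  assumes i: "i < N" and k: "k < N"
  shows "(\<Sum>j<N. C i j / (1 - x j * x k)) = (if i = k then 1 else 0)"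
proof -
  obtain b where b: "\<And>z. (\<And>i. i < N \<Longrightarrow> x i * z \<noteq> 1) \<Longrightarrow>
    (\<Prod>i<N. (z - x i) / (1 - x i * z)) = b + (\<Sum>j<N. w j / x j / (1 - x j * z))"
    using partial_fraction by blast
  have zero: "(\<Sum>j<N. w j / x j / (1 - x j * x l)) = - b" if "l < N" for l
  proof -
    have "(\<Prod>i<N. (x l - x i) / (1 - x i * x l)) = 0"
      using that by (intro prod_zero) auto
    moreover have "x i * x l \<noteq> 1" if "i < N" for i
      using xx_lt_1[OF that \<open>l < N\<close>] by simp
    ultimately show ?thesis using b[of "x l"] by simp
  qed
  show ?thesis
  proof (cases "i = k")
    case False
    have "C i j / (1 - x j * x k) =
        w i * (w j / x j / (1 - x j * x i) - w j / x j / (1 - x j * x k)) / (x i - x k)" if "j < N" for j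
    proof -
      have "x j \<noteq> 0" "1 - x j * x i \<noteq> 0" "1 - x j * x k \<noteq> 0" "x i - x k \<noteq> 0"
        using x_pos[OF that] xx_lt_1[OF that] i k x_neq[of i k] False by force+
      thus ?thesis unfolding C_def mult.commute[of "x i" "x j"]
        by (simp add: divide_simps) (simp add: algebra_simps)
    qed
    hence "(\<Sum>j<N. C i j / (1 - x j * x k)) =
      w i * ((\<Sum>j<N. w j / x j / (1 - x j * x i)) - (\<Sum>j<N. w j / x j / (1 - x j * x k))) / (x i - x k)"
      by (simp add: sum_divide_distrib[symmetric] sum_distrib_left[symmetric] sum_subtractf)
    thus ?thesis using False zero i k by simp
  next
    case True
    \<comment> \<open>The two functions are the difference quotient of the Blaschke product at its
      zero x_i, computed from the partial fractions and from the product. They agree near x_i away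
      from x_i itself, hence so do their limits.\<close>
    have lim1: "((\<lambda>z. \<Sum>j<N. w j / ((1 - x j * z) * (1 - x j * x i))) \<longlongrightarrow>
        (\<Sum>j<N. w j / ((1 - x j * x i) * (1 - x j * x i)))) (at (x i))"
      using xx_lt_1[OF _ i] by (intro tendsto_intros) force+
    have lim2: "((\<lambda>z. (\<Prod>j\<in>{..<N} - {i}. z - x j) / (\<Prod>j<N. 1 - x j * z)) \<longlongrightarrow>
        (\<Prod>j\<in>{..<N} - {i}. x i - x j) / (\<Prod>j<N. 1 - x j * x i)) (at (x i))"
      using xx_lt_1[OF _ i] by (intro tendsto_intros) force+
    have "eventually (\<lambda>z. \<forall>j<N. 1 - x j * z > 0) (at (x i))"
    proof -
      have "eventually (\<lambda>z. 1 - x j * z > 0) (at (x i))" if "j < N" for j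
        by (rule order_tendstoD(1)[of _ "1 - x j * x i"])
           (use xx_lt_1[OF that i] in \<open>auto intro!: tendsto_intros\<close>)
      thus ?thesis by (auto simp: eventually_ball_finite_distrib[of "{..<N}", simplified Ball_def lessThan_iff])
    qed
    moreover have "eventually (\<lambda>z. z \<noteq> x i) (at (x i))"
      by (simp add: eventually_at_filter)
    ultimately have ev: "eventually (\<lambda>z. (\<Sum>j<N. w j / ((1 - x j * z) * (1 - x j * x i))) =
        (\<Prod>j\<in>{..<N} - {i}. z - x j) / (\<Prod>j<N. 1 - x j * z)) (at (x i))"
    proof eventually_elim
      case (elim z)
      have "w j / ((1 - x j * z) * (1 - x j * x i)) =
          (w j / x j / (1 - x j * z) - w j / x j / (1 - x j * x i)) / (z - x i)" if "j < N" for j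
      proof -
        have "x j \<noteq> 0" "1 - x j * z \<noteq> 0" "1 - x j * x i \<noteq> 0" "z - x i \<noteq> 0"
          using x_pos[OF that] xx_lt_1[OF that i] elim that by force+
        thus ?thesis by (simp add: divide_simps) (simp add: algebra_simps)
      qed
      hence "(\<Sum>j<N. w j / ((1 - x j * z) * (1 - x j * x i))) =
          ((\<Sum>j<N. w j / x j / (1 - x j * z)) - (\<Sum>j<N. w j / x j / (1 - x j * x i))) / (z - x i)"
        by (simp add: sum_divide_distrib[symmetric] sum_subtractf)
      also have "\<dots> = (\<Prod>j<N. (z - x j) / (1 - x j * z)) / (z - x i)"
        using b[of z] elim zero[OF i] by force
      also have "(\<Prod>j<N. (z - x j) / (1 - x j * z)) =
          (z - x i) * (\<Prod>j\<in>{..<N} - {i}. z - x j) / (\<Prod>j<N. 1 - x j * z)"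
        unfolding prod_dividef by (subst prod.remove[of "{..<N}" i]) (use i in auto)
      finally show ?case using elim by simp
    qed
    have "(\<Sum>j<N. w j / ((1 - x j * x i) * (1 - x j * x i))) =
        (\<Prod>j\<in>{..<N} - {i}. x i - x j) / (\<Prod>j<N. 1 - x j * x i)"
      by (rule tendsto_unique[OF trivial_limit_at lim1]) (use Lim_transform_eventually[OF lim2] ev in \<open>auto simp: eq_commute\<close>)
    also have "\<dots> = 1 / w i" by (simp add: w_def mult.commute)
    finally have "w i * (\<Sum>j<N. w j / ((1 - x j * x i) * (1 - x j * x i))) = 1"
      using w_nonzero[OF i] by simp
    also have "w i * (\<Sum>j<N. w j / ((1 - x j * x i) * (1 - x j * x i))) = (\<Sum>j<N. C i j / (1 - x j * x k))"
      by (simp add: sum_distrib_left C_def True mult.commute)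
    finally show ?thesis using True by simp
  qed
qed

text \<open>The geometric series over y puts the Cauchy matrix between two copies of
  \<open>C\<close>, one of which cancels it.\<close>

lemma has_sum_K_K: "((\<lambda>y. K a y * K y b) has_sum K a b) UNIV"
proof -
  have "((\<lambda>y. \<Sum>i<N. \<Sum>k<N. \<Sum>j<N. \<Sum>l<N. C i j * C k l * x i ^ a * x l ^ b * (x j * x k) ^ y) has_sum
      (\<Sum>i<N. \<Sum>k<N. \<Sum>j<N. \<Sum>l<N. C i j * C k l * x i ^ a * x l ^ b * (1 / (1 - x j * x k)))) UNIV"
    by (intro has_sum_sum' has_sum_cmult_right has_sum_geometric_real abs_xx_lt_1) auto
  also have "(\<lambda>y. \<Sum>i<N. \<Sum>k<N. \<Sum>j<N. \<Sum>l<N. C i j * C k l * x i ^ a * x l ^ b * (x j * x k) ^ y) =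
      (\<lambda>y. K a y * K y b)"
    unfolding K_def sum_product by (simp add: power_mult_distrib mult_ac)
  also have "(\<Sum>i<N. \<Sum>k<N. \<Sum>j<N. \<Sum>l<N. C i j * C k l * x i ^ a * x l ^ b * (1 / (1 - x j * x k))) =
      (\<Sum>i<N. \<Sum>k<N. (\<Sum>j<N. C i j / (1 - x j * x k)) * (\<Sum>l<N. C k l * x i ^ a * x l ^ b))"
    by (simp add: sum_product mult_ac)
  also have "\<dots> = (\<Sum>i<N. \<Sum>k<N. (if i = k then 1 else 0) * (\<Sum>l<N. C k l * x i ^ a * x l ^ b))"
    by (intro sum.cong refl) (simp add: C_inverse_Cauchy)
  also have "\<dots> = K a b"
    by (simp add: K_def sum.delta' if_distrib[of "\<lambda>t. t * _"] cong: if_cong)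
  finally show ?thesis .
qed

lemma has_sum_K_trace: "((\<lambda>y. K y y) has_sum real N) UNIV"
proof -
  have "((\<lambda>y. \<Sum>i<N. \<Sum>j<N. C i j * (x j * x i) ^ y) has_sum
      (\<Sum>i<N. \<Sum>j<N. C i j * (1 / (1 - x j * x i)))) UNIV"
    by (intro has_sum_sum' has_sum_cmult_right has_sum_geometric_real abs_xx_lt_1) auto
  also have "(\<lambda>y. \<Sum>i<N. \<Sum>j<N. C i j * (x j * x i) ^ y) = (\<lambda>y. K y y)"
    by (simp add: K_def power_mult_distrib mult_ac)
  also have "(\<Sum>i<N. \<Sum>j<N. C i j * (1 / (1 - x j * x i))) = real N"
    using C_inverse_Cauchy by simp
  finally show ?thesis .
qed

text \<open>Expanding the denominator inside \<open>C\<close> as a geometric series separates i from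
  j and leaves a tail sum of products of Blaschke coefficients.\<close>

lemma has_sum_K_\<beta>: "((\<lambda>k. \<beta> (a + k) * \<beta> (b + k)) has_sum K a b) UNIV"
proof -
  have "((\<lambda>k. \<Sum>i<N. \<Sum>j<N. w i * w j * x i ^ a * x j ^ b * (x i * x j) ^ k) has_sum
      (\<Sum>i<N. \<Sum>j<N. w i * w j * x i ^ a * x j ^ b * (1 / (1 - x i * x j)))) UNIV"
    by (intro has_sum_sum' has_sum_cmult_right has_sum_geometric_real abs_xx_lt_1) auto
  also have "(\<lambda>k. \<Sum>i<N. \<Sum>j<N. w i * w j * x i ^ a * x j ^ b * (x i * x j) ^ k) =
      (\<lambda>k. \<beta> (a + k) * \<beta> (b + k))"
    by (simp add: \<beta>_def sum_product power_mult_distrib power_add mult_ac)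
  also have "(\<Sum>i<N. \<Sum>j<N. w i * w j * x i ^ a * x j ^ b * (1 / (1 - x i * x j))) = K a b"
    by (simp add: K_def C_def)
  finally show ?thesis .
qed

text \<open>\<open>H\<close> is the power series of 1 / prod_i (1 - x_i z), kept abstract so that an
  explicit expansion can be supplied. The constant of the partial fraction affects only the
  coefficient of z^0, hence the index \<open>Suc n\<close>.\<close>

lemma fps_nth_blaschke:
  assumes "H * (\<Prod>i<N. 1 - fps_const (x i) * fps_X) = 1"
  shows "fps_nth ((\<Prod>i<N. fps_X - fps_const (x i)) * H) (Suc n) = \<beta> n"
proof -
  let ?D = "\<lambda>I. \<Prod>i\<in>I. 1 - fps_const (x i) * fps_X"
  obtain b where b: "(\<Prod>i<N. [:- x i, 1:]) =
    Polynomial.smult b (\<Prod>i<N. [:1, - x i:]) + (\<Sum>j<N. Polynomial.smult (w j / x j) (\<Prod>i\<in>{..<N} - {j}. [:1, - x i:]))"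
    by (rule partial_fraction_poly)
  have lin: "fps_of_poly [:- c, 1:] = fps_X - fps_const c"
    "fps_of_poly [:1, - c:] = 1 - fps_const c * fps_X" for c :: real
    by (simp_all add: fps_of_poly_pCons mult.commute flip: fps_const_neg)
  have geo: "(1 - fps_const c * fps_X) * Abs_fps (\<lambda>n. c ^ n) = 1" for c :: real
    by (rule fps_ext) (simp add: left_diff_distrib mult.assoc power_eq_if)
  have "(\<Prod>i<N. fps_X - fps_const (x i)) = fps_of_poly (\<Prod>i<N. [:- x i, 1:])"
    by (simp add: fps_of_poly_prod lin)
  also have "\<dots> = fps_const b * ?D {..<N} + (\<Sum>j<N. fps_const (w j / x j) * ?D ({..<N} - {j}))"
    unfolding b by (simp add: fps_of_poly_add fps_of_poly_sum fps_of_poly_smult fps_of_poly_prod lin)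
  also have "(\<Sum>j<N. fps_const (w j / x j) * ?D ({..<N} - {j})) =
      (\<Sum>j<N. fps_const (w j / x j) * Abs_fps (\<lambda>n. x j ^ n) * ?D {..<N})"
  proof (rule sum.cong[OF refl])
    fix j assume "j \<in> {..<N}"
    hence "?D {..<N} = (1 - fps_const (x j) * fps_X) * ?D ({..<N} - {j})"
      by (subst prod.remove[of _ j]) auto
    thus "fps_const (w j / x j) * ?D ({..<N} - {j}) =
        fps_const (w j / x j) * Abs_fps (\<lambda>n. x j ^ n) * ?D {..<N}"
      using geo[of "x j"] by (simp add: mult_ac)
  qed
  finally have "(\<Prod>i<N. fps_X - fps_const (x i)) * H =
      (fps_const b + (\<Sum>j<N. fps_const (w j / x j) * Abs_fps (\<lambda>n. x j ^ n))) * (H * ?D {..<N})"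
    by (simp add: algebra_simps sum_distrib_left sum_distrib_right)
  hence "fps_nth ((\<Prod>i<N. fps_X - fps_const (x i)) * H) (Suc n) =
      (\<Sum>j<N. w j / x j * x j ^ Suc n)"
    using assms by (simp add: fps_sum_nth)
  also have "\<dots> = \<beta> n" unfolding \<beta>_def
    by (intro sum.cong refl) (use x_pos in force)
  finally show ?thesis .
qed

definition \<delta> :: real where
  "\<delta> = Determinant.det (Matrix.mat N N (\<lambda>(i, j). C i j))"

lemma kdet_K:
  assumes "length ls = N"
  shows "kdet K ls = (Determinant.det (Matrix.mat N N (\<lambda>(i, j). x j ^ (ls ! i))))\<^sup>2 * \<delta>"
proof -
  define E where "E = Matrix.mat N N (\<lambda>(i, j). x j ^ (ls ! i))"
  define CM where "CM = Matrix.mat N N (\<lambda>(i, j). C i j)"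
  have carr: "E \<in> carrier_mat N N" "CM \<in> carrier_mat N N" by (auto simp: E_def CM_def)
  have "Matrix.mat (length ls) (length ls) (\<lambda>(i, j). K (ls ! i) (ls ! j)) = E * (CM * transpose_mat E)"
    by (rule eq_matI)
       (auto simp: E_def CM_def assms K_def scalar_prod_def atLeast0LessThan sum_distrib_left mult_ac)
  hence "kdet K ls = Determinant.det (E * (CM * transpose_mat E))" by (simp add: kdet_def)
  also have "\<dots> = Determinant.det E * (Determinant.det CM * Determinant.det (transpose_mat E))"
    using carr by (simp add: det_mult[of _ N])
  also have "Determinant.det (transpose_mat E) = Determinant.det E"
    by (rule det_transpose[OF carr(1)])
  finally show ?thesis by (simp add: \<delta>_def E_def CM_def power2_eq_square)
qed

text \<open>From C G = 1 and C = D G D follow det C = 1 / det G and det C = (det D)^2 det G;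
  multiplying these eliminates the Cauchy determinant det G but leaves the sign of \<delta>
  open.\<close>

lemma \<delta>_squared: "\<delta>\<^sup>2 = (\<Prod>i<N. w i)\<^sup>2"
proof -
  define CM where "CM = Matrix.mat N N (\<lambda>(i, j). C i j)"
  define G where "G = Matrix.mat N N (\<lambda>(i, j). 1 / (1 - x i * x j))"
  define D where "D = mat_diag N w"
  have carr: "CM \<in> carrier_mat N N" "G \<in> carrier_mat N N" "D \<in> carrier_mat N N"
    by (auto simp: CM_def G_def D_def)
  have "CM * G = 1\<^sub>m N"
    by (rule eq_matI)
       (auto simp: CM_def G_def scalar_prod_def atLeast0LessThan C_inverse_Cauchy[symmetric])
  hence 1: "Determinant.det CM * Determinant.det G = 1"
    using det_mult[OF carr(1,2)] by simp
  have "CM = D * (G * D)"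
    unfolding D_def mat_diag_mult_right[OF carr(2)]
    by (subst mat_diag_mult_left[of _ N N]) (auto simp: CM_def G_def C_def)
  hence 2: "Determinant.det CM = Determinant.det D * (Determinant.det G * Determinant.det D)"
    using carr by (simp add: det_mult[of _ N])
  have 3: "Determinant.det D = (\<Prod>i<N. w i)"
    by (subst det_upper_triangular[of _ N])
       (auto simp: D_def mat_diag_def prod_list_diag_prod upper_triangular_def atLeast0LessThan)
  have "(Determinant.det CM)\<^sup>2 = (Determinant.det CM * Determinant.det G) * (Determinant.det D)\<^sup>2"
    using 2 by (simp add: power2_eq_square mult_ac)
  thus ?thesis unfolding 1 by (simp add: \<delta>_def CM_def 3)
qed

end

subsection \<open>Uniqueness of Laurent coefficients\<close>

lemma has_sum_mult_abs:
  fixes f :: "'a \<Rightarrow> 'c :: {real_normed_field, banach}" and g :: "'b \<Rightarrow> 'c"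
  assumes f: "(f has_sum s) A" "(\<lambda>i. norm (f i)) summable_on A"
    and g: "(g has_sum t) B" "(\<lambda>j. norm (g j)) summable_on B"
  shows "((\<lambda>(i, j). f i * g j) has_sum (s * t)) (A \<times> B)"
proof (rule has_sum_SigmaI[where g = "\<lambda>i. f i * t"])
  have "(\<lambda>(i, j). norm (f i) * norm (g j)) summable_on A \<times> B"
    by (rule summable_on_SigmaI[where g = "\<lambda>i. norm (f i) * (\<Sum>\<^sub>\<infinity>j\<in>B. norm (g j))"])
       (use assms in \<open>auto intro!: has_sum_cmult_right summable_on_cmult_left simp del: summable_on_cmult_left'\<close>)
  hence "(\<lambda>z. norm (case z of (i, j) \<Rightarrow> f i * g j)) summable_on A \<times> B"
    by (simp add: case_prod_unfold norm_mult)
  thus "(\<lambda>(i, j). f i * g j) summable_on A \<times> B"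
    by (rule abs_summable_summable)
qed (use assms in \<open>auto intro!: has_sum_cmult_right has_sum_cmult_left\<close>)

text \<open>A discrete form of Cauchy's coefficient integral. Convergence at z = 1 is absolute, so
  outside a finite set F the coefficients have total mass at most e, and on F an average over
  finitely many points of the circle is exact.\<close>

lemma laurent_coeffs_zero:
  fixes d :: "int \<Rightarrow> complex"
  assumes "\<And>z. norm z = 1 \<Longrightarrow> ((\<lambda>m. z powi m * d m) has_sum 0) UNIV"
  shows "d j = 0"
proof -
  have "(\<lambda>m. 1 powi m * d m) summable_on UNIV"
    by (rule has_sum_imp_summable[OF assms]) simp
  hence abs: "(\<lambda>m. norm (d m)) summable_on UNIV"
    by (simp add: summable_on_iff_abs_summable_on_complex)
  have "norm (d j) \<le> e" if e_pos: "e > 0" for e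
  proof -
    obtain F0 where F0: "finite F0"
      "dist (sum (\<lambda>m. norm (d m)) F0) (\<Sum>\<^sub>\<infinity>m\<in>UNIV. norm (d m)) \<le> e"
      using infsum_finite_approximation[of "\<lambda>m. norm (d m)" UNIV e] abs e_pos by auto
    define F where "F = insert j F0"
    have F: "finite F" "j \<in> F" using F0 by (auto simp: F_def)
    have tail: "(\<Sum>\<^sub>\<infinity>m\<in>-F. norm (d m)) \<le> e"
    proof -
      have "(\<Sum>\<^sub>\<infinity>m\<in>-F. norm (d m)) = (\<Sum>\<^sub>\<infinity>m\<in>UNIV. norm (d m)) - sum (\<lambda>m. norm (d m)) F"
        using infsum_Diff[OF abs, of F] F by (simp add: Compl_eq_Diff_UNIV)
      moreover have "sum (\<lambda>m. norm (d m)) F0 \<le> sum (\<lambda>m. norm (d m)) F"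
        using F by (intro sum_mono2) (auto simp: F_def)
      ultimately show ?thesis using F0(2) by (auto simp: dist_real_def abs_le_iff)
    qed
    \<comment> \<open>Since n exceeds all distances |m - j| with m in F, it divides m - j only for m
      = j. One more than the sum of the distances is large enough.\<close>
    obtain n :: nat where n: "n > 0" "\<And>m. m \<in> F \<Longrightarrow> \<bar>m - j\<bar> < int n"
    proof (rule that[of "Suc (\<Sum>m\<in>F. nat \<bar>m - j\<bar>)"])
      fix m assume "m \<in> F"
      hence "nat \<bar>m - j\<bar> \<le> (\<Sum>m\<in>F. nat \<bar>m - j\<bar>)"
        using F by (intro member_le_sum) auto
      thus "\<bar>m - j\<bar> < int (Suc (\<Sum>m\<in>F. nat \<bar>m - j\<bar>))" by linarith
    qed simp
    \<comment> \<open>averaging over \<open>n\<close>-th roots of unity annihilates all coefficients in \<open>F\<close> except \<open>d j\<close>\<close>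
    define z where "z k = cis (2 * pi * real k / real n)" for k
    define c where "c m = (\<Sum>k<n. z k powi (m - j))" for m
    have [simp]: "norm (z k) = 1" "z k \<noteq> 0" for k by (auto simp: z_def)
    have cj: "c j = of_nat n" by (simp add: c_def)
    have c0: "c m = 0" if "m \<in> F" "m \<noteq> j" for m
    proof -
      define t where "t = cis (2 * pi * of_int (m - j) / real n)"
      have zt: "z k powi (m - j) = t ^ k" for k
      proof -
        have "of_int (m - j) * (2 * pi * real k / real n) = real k * (2 * pi * of_int (m - j) / real n)"
          by simp
        thus ?thesis by (simp only: z_def t_def cis_power_int Complex.DeMoivre)
      qed
      have "real n * (2 * pi * of_int (m - j) / real n) = 2 * pi * of_int (m - j)"
        using n(1) by simp
      hence "t ^ n = 1"
        using cis_multiple_2pi[of "of_int (m - j)"] by (simp only: t_def Complex.DeMoivre) simp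
      moreover have "t \<noteq> 1"
      proof
        assume "t = 1"
        hence "cos (2 * pi * of_int (m - j) / real n) = 1"
          by (simp only: t_def complex_eq_iff) simp
        then obtain i :: int where "2 * pi * of_int (m - j) / real n = of_int i * 2 * pi"
          by (subst (asm) cos_one_2pi_int) auto
        hence "pi * of_int (m - j) = pi * (of_int i * real n)"
          using n(1) by (simp only: field_simps)
        hence "of_int (m - j) = of_int i * real n" by simp
        hence eq: "m - j = i * int n" by (metis of_int_eq_iff of_int_mult of_int_of_nat_eq)
        hence "i \<noteq> 0" using that(2) by auto
        hence "1 * int n \<le> \<bar>i\<bar> * int n" by (intro mult_right_mono) auto
        with n(2)[OF that(1)] show False unfolding eq abs_mult by simp
      qed
      ultimately have "(\<Sum>k<n. t ^ k) = 0" by (simp add: geometric_sum)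
      thus ?thesis by (simp add: c_def zt)
    qed
    have c_le: "norm (c m) \<le> real n" for m
      unfolding c_def by (rule order.trans[OF norm_sum]) (simp add: norm_power_int)
    have "((\<lambda>m. \<Sum>k<n. z k powi (- j) * (z k powi m * d m)) has_sum (\<Sum>k<n. z k powi (-j) * 0)) UNIV"
      by (intro has_sum_sum' has_sum_cmult_right assms) auto
    also have "(\<lambda>m. \<Sum>k<n. z k powi (- j) * (z k powi m * d m)) = (\<lambda>m. c m * d m)"
      unfolding c_def sum_distrib_right
      by (intro ext sum.cong refl) (simp add: power_int_diff power_int_minus field_simps)
    finally have cd: "((\<lambda>m. c m * d m) has_sum 0) UNIV" by simp
    have abs': "(\<lambda>m. real n * norm (d m)) summable_on -F"
      by (intro summable_on_cmult_right summable_on_subset_banach[OF abs]) auto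
    have abs2: "(\<lambda>m. norm (c m * d m)) summable_on -F"
      by (rule summable_on_comparison_test[OF abs']) (auto simp: norm_mult intro!: mult_right_mono c_le)
    have "(\<Sum>\<^sub>\<infinity>m\<in>-F. c m * d m) = 0 - (\<Sum>m\<in>F. c m * d m)"
      using infsum_Diff[OF has_sum_imp_summable[OF cd], of F] F infsumI[OF cd]
      by (simp add: Compl_eq_Diff_UNIV)
    also have "(\<Sum>m\<in>F. c m * d m) = (\<Sum>m\<in>{j}. c m * d m)"
      using F c0 by (intro sum.mono_neutral_right) auto
    finally have "real n * norm (d j) = norm (\<Sum>\<^sub>\<infinity>m\<in>-F. c m * d m)"
      by (simp add: cj norm_mult)
    also have "\<dots> \<le> (\<Sum>\<^sub>\<infinity>m\<in>-F. norm (c m * d m))"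
      by (rule norm_infsum_bound) (use abs2 in auto)
    also have "\<dots> \<le> (\<Sum>\<^sub>\<infinity>m\<in>-F. real n * norm (d m))"
      by (rule infsum_mono[OF abs2 abs']) (auto simp: norm_mult intro!: mult_right_mono c_le)
    also have "\<dots> = real n * (\<Sum>\<^sub>\<infinity>m\<in>-F. norm (d m))"
      by (intro infsum_cmult_right) (use abs summable_on_subset_banach in blast)
    also have "\<dots> \<le> real n * e" using tail by (intro mult_left_mono) auto
    finally show ?thesis using n(1) by simp
  qed
  hence "norm (d j) \<le> 0" by (rule field_le_epsilon) simp
  thus ?thesis by simp
qed

subsection \<open>Hahn--Exton $q$-Bessel functions\<close>

lemma qpoch_inf_LIMSEQ:
  fixes a q :: "'a :: {real_normed_field, banach}"
  assumes "norm q < 1"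
  shows "(\<lambda>n. \<Prod>k<n. 1 - a * q ^ k) \<longlonglongrightarrow> qpoch_inf a q"
proof -
  have "abs_convergent_prod (\<lambda>k. 1 - a * q ^ k)"
    using assms
    by (intro summable_imp_abs_convergent_prod)
       (auto simp: norm_mult norm_power intro!: summable_mult summable_geometric)
  hence "convergent_prod (\<lambda>k. 1 - a * q ^ k)"
    by (rule abs_convergent_prod_imp_convergent_prod)
  hence "(\<lambda>n. \<Prod>k\<le>n. 1 - a * q ^ k) \<longlonglongrightarrow> qpoch_inf a q"
    unfolding qpoch_inf_def by (rule convergent_prod_LIMSEQ)
  hence "(\<lambda>n. \<Prod>k<Suc n. 1 - a * q ^ k) \<longlonglongrightarrow> qpoch_inf a q"
    by (simp only: lessThan_Suc_atMost)
  thus ?thesis by (rule LIMSEQ_imp_Suc)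
qed

definition int_ext :: "(nat \<Rightarrow> real) \<Rightarrow> int \<Rightarrow> real" where
  "int_ext h m = (if m < 0 then 0 else h (nat m))"

lemma int_ext_of_nat [simp]: "int_ext h (int m) = h m"
  by (simp add: int_ext_def)

locale q_bessel =
  fixes q \<xi> :: real
  assumes q_nonneg: "0 \<le> q" and q_lt_1: "q < 1" and \<xi>_nonneg: "0 \<le> \<xi>" and \<xi>_lt_1: "\<xi> < 1"
begin

text \<open>In closed form \<xi>^m / (q;q)_m, and \<xi>^j q^(j(j+1)/2) / (q;q)_j for
  \<open>\<epsilon> j\<close>: by Euler's identities the coefficients of 1/(\<xi> z; q)_inf and, up
  to the sign (-1)^j, of (q \<xi> w; q)_inf.\<close>

definition \<eta> :: "nat \<Rightarrow> real" where
  "\<eta> m = (\<Prod>i<m. \<xi> / (1 - q ^ Suc i))"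

definition \<epsilon> :: "nat \<Rightarrow> real" where
  "\<epsilon> j = (\<Prod>i<j. \<xi> * q ^ Suc i / (1 - q ^ Suc i))"

text \<open>The coefficient of z^n in the product of Euler's two series with w = 1/z. This form is
  uniform in the sign of n; \<open>int_ext\<close> encodes the restriction n + j >= 0.\<close>

definition J :: "int \<Rightarrow> real" where
  "J n = (\<Sum>j. (-1) ^ j * \<epsilon> j * int_ext \<eta> (n + int j))"

lemma q_Suc_lt_1: "q ^ Suc i < 1"
proof -
  have "q * q ^ i \<le> q * 1"
    using q_nonneg q_lt_1 by (intro mult_left_mono power_le_one) auto
  thus ?thesis using q_lt_1 by simp
qed

lemma q_pow_le_1: "q ^ i \<le> 1"
  using q_nonneg q_lt_1 by (simp add: power_le_one)

lemma one_minus_q_Suc: "1 - q ^ Suc i > 0" "1 - q ^ Suc i \<noteq> 0"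
  using q_Suc_lt_1[of i] by auto

lemma \<eta>_0 [simp]: "\<eta> 0 = 1" and \<epsilon>_0 [simp]: "\<epsilon> 0 = 1"
  by (auto simp: \<eta>_def \<epsilon>_def)

lemma \<eta>_Suc: "\<eta> (Suc m) * (1 - q ^ Suc m) = \<xi> * \<eta> m"
  using one_minus_q_Suc(2)[of m] by (simp add: \<eta>_def del: power_Suc)

lemma \<epsilon>_Suc: "\<epsilon> (Suc j) * (1 - q ^ Suc j) = \<xi> * q ^ Suc j * \<epsilon> j"
  using one_minus_q_Suc(2)[of j] by (simp add: \<epsilon>_def del: power_Suc)

lemma \<eta>_nonneg: "0 \<le> \<eta> m"
  unfolding \<eta>_def using \<xi>_nonneg one_minus_q_Suc(1)
  by (intro prod_nonneg ballI divide_nonneg_pos) auto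

lemma \<epsilon>_nonneg: "0 \<le> \<epsilon> j"
  unfolding \<epsilon>_def using \<xi>_nonneg one_minus_q_Suc(1) q_nonneg
  by (intro prod_nonneg ballI divide_nonneg_pos) auto

lemma q_power_tendsto_0: "(\<lambda>m. q ^ Suc m) \<longlonglongrightarrow> 0"
  using q_nonneg q_lt_1 by (intro LIMSEQ_Suc LIMSEQ_power_zero) auto

lemma summable_\<eta>_power:
  assumes "0 \<le> r" "\<xi> * r < 1"
  shows "summable (\<lambda>m. \<eta> m * r ^ m)"
proof -
  define c where "c = (1 + \<xi> * r) / 2"
  have c: "\<xi> * r < c" "c < 1" using assms by (auto simp: c_def)
  have "(\<lambda>m. \<xi> * r / (1 - q ^ Suc m)) \<longlonglongrightarrow> \<xi> * r / (1 - 0)"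
    by (intro tendsto_intros q_power_tendsto_0) auto
  hence "eventually (\<lambda>m. \<xi> * r / (1 - q ^ Suc m) < c) sequentially"
    by (rule order_tendstoD) (use c in simp)
  then obtain M where M: "\<And>m. m \<ge> M \<Longrightarrow> \<xi> * r / (1 - q ^ Suc m) < c"
    by (auto simp: eventually_sequentially)
  show ?thesis
  proof (rule summable_ratio_test[OF c(2)])
    fix m assume "m \<ge> M"
    have eq: "\<eta> (Suc m) * r ^ Suc m = \<xi> * r / (1 - q ^ Suc m) * (\<eta> m * r ^ m)"
      by (simp add: \<eta>_def)
    have le: "\<bar>\<xi> * r / (1 - q ^ Suc m)\<bar> \<le> c"
      using M[OF \<open>m \<ge> M\<close>] \<xi>_nonneg assms one_minus_q_Suc(1)[of m]
      by (subst abs_of_nonneg) auto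
    show "norm (\<eta> (Suc m) * r ^ Suc m) \<le> c * norm (\<eta> m * r ^ m)"
      unfolding eq real_norm_def abs_mult[of _ "\<eta> m * r ^ m"] using le by (intro mult_right_mono) auto
  qed
qed

lemma summable_\<epsilon>_power:
  assumes "0 \<le> r"
  shows "summable (\<lambda>j. \<epsilon> j * r ^ j)"
proof -
  have "(\<lambda>m. \<xi> * q ^ Suc m * r / (1 - q ^ Suc m)) \<longlonglongrightarrow> \<xi> * 0 * r / (1 - 0)"
    by (intro tendsto_intros q_power_tendsto_0) auto
  hence "eventually (\<lambda>m. \<xi> * q ^ Suc m * r / (1 - q ^ Suc m) < 1 / 2) sequentially"
    by (rule order_tendstoD) simp
  then obtain M where M: "\<And>m. m \<ge> M \<Longrightarrow> \<xi> * q ^ Suc m * r / (1 - q ^ Suc m) < 1 / 2"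
    by (auto simp: eventually_sequentially)
  show ?thesis
  proof (rule summable_ratio_test[of "1 / 2"])
    fix m assume "m \<ge> M"
    have eq: "\<epsilon> (Suc m) * r ^ Suc m = \<xi> * q ^ Suc m * r / (1 - q ^ Suc m) * (\<epsilon> m * r ^ m)"
      by (simp add: \<epsilon>_def)
    have le: "\<bar>\<xi> * q ^ Suc m * r / (1 - q ^ Suc m)\<bar> \<le> 1 / 2"
      using M[OF \<open>m \<ge> M\<close>] \<xi>_nonneg q_nonneg assms one_minus_q_Suc(1)[of m]
      by (subst abs_of_nonneg) auto
    show "norm (\<epsilon> (Suc m) * r ^ Suc m) \<le> 1 / 2 * norm (\<epsilon> m * r ^ m)"
      unfolding eq real_norm_def abs_mult[of _ "\<epsilon> m * r ^ m"] using le by (intro mult_right_mono) auto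
  qed simp
qed

lemma summable_\<eta>: "summable \<eta>" and summable_\<epsilon>: "summable \<epsilon>"
  using summable_\<eta>_power[of 1] summable_\<epsilon>_power[of 1] \<xi>_lt_1 by simp_all

definition B :: real where "B = suminf \<eta>"

lemma \<eta>_le_B: "\<eta> m \<le> B"
  unfolding B_def using sum_le_suminf[OF summable_\<eta>, of "{m}"] \<eta>_nonneg by simp

lemma B_nonneg: "0 \<le> B"
  using \<eta>_le_B[of 0] by simp

lemma abs_int_ext_\<eta>_le: "\<bar>int_ext \<eta> m\<bar> \<le> B"
  using \<eta>_le_B \<eta>_nonneg B_nonneg by (simp add: int_ext_def)

lemma abs_J_term_le: "\<bar>(-1) ^ j * \<epsilon> j * int_ext \<eta> n\<bar> \<le> \<epsilon> j * B"
  by (simp add: abs_mult power_abs \<epsilon>_nonneg mult_left_mono abs_int_ext_\<eta>_le)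

lemma summable_abs_J: "summable (\<lambda>j. \<bar>(-1) ^ j * \<epsilon> j * int_ext \<eta> (n + int j)\<bar>)"
  by (rule summable_comparison_test'[of "\<lambda>j. \<epsilon> j * B" 0])
     (use summable_mult2[OF summable_\<epsilon>, of B] abs_J_term_le in auto)

lemma J_sums: "(\<lambda>j. (-1) ^ j * \<epsilon> j * int_ext \<eta> (n + int j)) sums J n"
  unfolding J_def by (rule summable_sums[OF summable_rabs_cancel[OF summable_abs_J]])

text \<open>Closes the iteration of a q-difference equation: q^n z tends to 0, so only the constant
  coefficient survives.\<close>

lemma power_series_at_q_power:
  fixes c :: "nat \<Rightarrow> complex"
  assumes "summable (\<lambda>m. c m * z ^ m)"
  shows "(\<lambda>n. \<Sum>m. c m * (of_real q ^ n * z) ^ m) \<longlonglongrightarrow> c 0"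
proof (cases "z = 0")
  case True
  thus ?thesis by (simp add: powser_zero)
next
  case False
  have "isCont (\<lambda>x. \<Sum>m. c m * x ^ m) 0"
    by (rule isCont_powser[OF assms]) (use False in auto)
  moreover have "(\<lambda>n. of_real q ^ n * z) \<longlonglongrightarrow> 0 * z"
    using q_nonneg q_lt_1 by (intro tendsto_intros LIMSEQ_power_zero) auto
  ultimately show ?thesis
    using isCont_tendsto_compose[of 0 "\<lambda>x. \<Sum>m. c m * x ^ m" "\<lambda>n. of_real q ^ n * z"]
    by (simp add: powser_zero)
qed

lemma summable_complex_\<eta>:
  assumes "\<xi> * norm z < 1"
  shows "summable (\<lambda>m. norm (complex_of_real (\<eta> m) * z ^ m))"
  using summable_\<eta>_power[of "norm z"] assms \<eta>_nonneg by (simp add: norm_mult norm_power)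

lemma summable_complex_\<epsilon>: "summable (\<lambda>j. norm (complex_of_real ((-1) ^ j * \<epsilon> j) * z ^ j))"
  using summable_\<epsilon>_power[of "norm z"] \<epsilon>_nonneg by (simp add: norm_mult norm_power abs_mult power_abs)

text \<open>The recurrence \<open>\<eta>_Suc\<close> says f(q w) = (1 - \<xi> w) f(w); after n
  iterations there remains f(q^n z), which tends to 1. The product form also yields that the
  denominator of the generating function does not vanish.\<close>

lemma q_binomial_series_reciprocal:
  assumes "\<xi> * norm z < 1"
  shows "(\<Sum>m. complex_of_real (\<eta> m) * z ^ m) * qpoch_inf (of_real \<xi> * z) (of_real q) = 1"
proof -
  define f where "f w = (\<Sum>m. complex_of_real (\<eta> m) * w ^ m)" for w
  have le: "\<xi> * norm (of_real q ^ n * z) < 1" for n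
  proof -
    have "\<xi> * norm (of_real q ^ n * z) = q ^ n * (\<xi> * norm z)"
      using q_nonneg by (simp add: norm_mult norm_power)
    also have "\<dots> \<le> 1 * (\<xi> * norm z)"
      using \<xi>_nonneg q_pow_le_1 by (intro mult_right_mono) auto
    finally show ?thesis using assms by simp
  qed
  have step: "f (of_real q * w) = (1 - of_real \<xi> * w) * f w" if w: "\<xi> * norm w < 1" for w
  proof -
    have S1: "summable (\<lambda>m. complex_of_real (\<eta> m) * w ^ m)"
      by (rule summable_norm_cancel[OF summable_complex_\<eta>[OF w]])
    have "\<xi> * norm (of_real q * w) < 1"
    proof -
      have "\<xi> * norm (of_real q * w) = q * (\<xi> * norm w)"
        using q_nonneg by (simp add: norm_mult)
      also have "\<dots> \<le> 1 * (\<xi> * norm w)"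
        using \<xi>_nonneg q_lt_1 by (intro mult_right_mono) auto
      finally show ?thesis using w by simp
    qed
    hence S2: "summable (\<lambda>m. complex_of_real (\<eta> m) * (of_real q * w) ^ m)"
      by (rule summable_norm_cancel[OF summable_complex_\<eta>])
    have "f w - f (of_real q * w) = (\<Sum>m. complex_of_real (\<eta> m) * w ^ m - complex_of_real (\<eta> m) * (of_real q * w) ^ m)"
      unfolding f_def by (rule suminf_diff[OF S1 S2])
    also have "\<dots> = (\<Sum>m. complex_of_real (\<eta> (Suc m)) * w ^ Suc m - complex_of_real (\<eta> (Suc m)) * (of_real q * w) ^ Suc m)"
      by (subst suminf_split_head[OF summable_diff[OF S1 S2]]) simp
    also have "(\<lambda>m. complex_of_real (\<eta> (Suc m)) * w ^ Suc m - complex_of_real (\<eta> (Suc m)) * (of_real q * w) ^ Suc m) =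
        (\<lambda>m. (of_real \<xi> * w) * (complex_of_real (\<eta> m) * w ^ m))"
    proof
      fix m
      have "complex_of_real (\<eta> (Suc m)) * w ^ Suc m - complex_of_real (\<eta> (Suc m)) * (of_real q * w) ^ Suc m
        = complex_of_real (\<eta> (Suc m) * (1 - q ^ Suc m)) * w ^ Suc m"
        by (simp add: algebra_simps)
      thus "complex_of_real (\<eta> (Suc m)) * w ^ Suc m - complex_of_real (\<eta> (Suc m)) * (of_real q * w) ^ Suc m
        = (of_real \<xi> * w) * (complex_of_real (\<eta> m) * w ^ m)"
        unfolding \<eta>_Suc by (simp add: mult_ac)
    qed
    also have "(\<Sum>m. (of_real \<xi> * w) * (complex_of_real (\<eta> m) * w ^ m)) = of_real \<xi> * w * f w"
      unfolding f_def by (rule suminf_mult[OF S1])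
    finally show ?thesis by (simp add: algebra_simps)
  qed
  have "f (of_real q ^ n * z) = (\<Prod>k<n. 1 - of_real \<xi> * z * of_real q ^ k) * f z" for n
  proof (induction n)
    case (Suc n)
    have "f (of_real q ^ Suc n * z) = f (of_real q * (of_real q ^ n * z))" by (simp add: mult_ac)
    also have "\<dots> = (1 - of_real \<xi> * (of_real q ^ n * z)) * f (of_real q ^ n * z)"
      by (rule step[OF le])
    also have "\<dots> = (\<Prod>k<Suc n. 1 - of_real \<xi> * z * of_real q ^ k) * f z"
      unfolding Suc by (simp add: mult_ac)
    finally show ?case .
  qed simp
  moreover have "(\<lambda>n. f (of_real q ^ n * z)) \<longlonglongrightarrow> complex_of_real (\<eta> 0)"
    unfolding f_def
    by (rule power_series_at_q_power[OF summable_norm_cancel[OF summable_complex_\<eta>[OF assms]]])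
  moreover have "(\<lambda>n. (\<Prod>k<n. 1 - of_real \<xi> * z * of_real q ^ k) * f z) \<longlonglongrightarrow>
      qpoch_inf (of_real \<xi> * z) (of_real q) * f z"
    using q_nonneg q_lt_1 by (intro tendsto_intros qpoch_inf_LIMSEQ) auto
  ultimately have "qpoch_inf (of_real \<xi> * z) (of_real q) * f z = complex_of_real (\<eta> 0)"
    by (simp add: LIMSEQ_unique)
  thus ?thesis by (simp add: f_def mult.commute)
qed

text \<open>The q-difference equation is now g(w) = (1 - q \<xi> w) g(q w), for all w because the
  series is entire.\<close>

lemma q_exponential_series:
  "(\<Sum>j. complex_of_real ((-1) ^ j * \<epsilon> j) * w ^ j) = qpoch_inf (of_real q * of_real \<xi> * w) (of_real q)"
proof -
  define g where "g w = (\<Sum>j. complex_of_real ((-1) ^ j * \<epsilon> j) * w ^ j)" for w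
  have S: "summable (\<lambda>j. complex_of_real ((-1) ^ j * \<epsilon> j) * w ^ j)" for w
    by (rule summable_norm_cancel[OF summable_complex_\<epsilon>])
  have step: "g w = (1 - of_real q * of_real \<xi> * w) * g (of_real q * w)" for w
  proof -
    let ?a = "\<lambda>j. complex_of_real ((-1) ^ j * \<epsilon> j)"
    have "g w - g (of_real q * w) = (\<Sum>j. ?a j * w ^ j - ?a j * (of_real q * w) ^ j)"
      unfolding g_def by (rule suminf_diff[OF S S])
    also have "\<dots> = (\<Sum>j. ?a (Suc j) * w ^ Suc j - ?a (Suc j) * (of_real q * w) ^ Suc j)"
      by (subst suminf_split_head[OF summable_diff[OF S S]]) simp
    also have "(\<lambda>j. ?a (Suc j) * w ^ Suc j - ?a (Suc j) * (of_real q * w) ^ Suc j) =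
        (\<lambda>j. (- (of_real q * of_real \<xi> * w)) * (?a j * (of_real q * w) ^ j))"
    proof
      fix j
      have "?a (Suc j) * w ^ Suc j - ?a (Suc j) * (of_real q * w) ^ Suc j
        = complex_of_real ((-1) ^ Suc j * (\<epsilon> (Suc j) * (1 - q ^ Suc j))) * w ^ Suc j"
        by (simp add: algebra_simps)
      thus "?a (Suc j) * w ^ Suc j - ?a (Suc j) * (of_real q * w) ^ Suc j
        = (- (of_real q * of_real \<xi> * w)) * (?a j * (of_real q * w) ^ j)"
        unfolding \<epsilon>_Suc by (simp add: mult_ac power_mult_distrib)
    qed
    also have "(\<Sum>j. (- (of_real q * of_real \<xi> * w)) * (?a j * (of_real q * w) ^ j)) =
        - (of_real q * of_real \<xi> * w) * g (of_real q * w)"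
      unfolding g_def by (rule suminf_mult[OF S])
    finally show ?thesis by (simp add: algebra_simps)
  qed
  have "g w = (\<Prod>k<n. 1 - of_real q * of_real \<xi> * w * of_real q ^ k) * g (of_real q ^ n * w)" for n
  proof (induction n)
    case (Suc n)
    have "g (of_real q ^ n * w) = (1 - of_real q * of_real \<xi> * (of_real q ^ n * w)) * g (of_real q * (of_real q ^ n * w))"
      by (rule step)
    thus ?case by (subst Suc) (simp add: mult_ac)
  qed simp
  moreover have "(\<lambda>n. (\<Prod>k<n. 1 - of_real q * of_real \<xi> * w * of_real q ^ k) * g (of_real q ^ n * w))
      \<longlonglongrightarrow> qpoch_inf (of_real q * of_real \<xi> * w) (of_real q) * complex_of_real ((-1) ^ 0 * \<epsilon> 0)"
    unfolding g_def using q_nonneg q_lt_1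
    by (intro tendsto_mult power_series_at_q_power S qpoch_inf_LIMSEQ) auto
  ultimately have "(\<lambda>n. g w) \<longlonglongrightarrow> qpoch_inf (of_real q * of_real \<xi> * w) (of_real q)"
    by (simp flip: ext)
  hence "g w = qpoch_inf (of_real q * of_real \<xi> * w) (of_real q)"
    by (simp add: LIMSEQ_const_iff)
  thus ?thesis by (simp add: g_def)
qed

lemma J_generating_function:
  assumes z: "z \<noteq> 0" "\<xi> * norm z < 1"
  shows "((\<lambda>n. z powi n * complex_of_real (J n)) has_sum
           qpoch_inf (of_real q * of_real \<xi> / z) (of_real q) / qpoch_inf (of_real \<xi> * z) (of_real q)) UNIV"
proof -
  let ?e = "\<lambda>j. complex_of_real ((-1) ^ j * \<epsilon> j) * (1 / z) ^ j"
  let ?h = "\<lambda>m. complex_of_real (\<eta> m) * z ^ m"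
  let ?S = "qpoch_inf (of_real q * of_real \<xi> / z) (of_real q) / qpoch_inf (of_real \<xi> * z) (of_real q)"
  let ?F = "\<lambda>n j. z powi n * complex_of_real ((-1) ^ j * \<epsilon> j * int_ext \<eta> (n + int j))"
  have e: "(?e has_sum qpoch_inf (of_real q * of_real \<xi> / z) (of_real q)) UNIV"
    using summable_complex_\<epsilon>[of "1 / z"] q_exponential_series[of "1 / z"]
    by (intro norm_summable_imp_has_sum) (auto simp: sums_iff summable_norm_cancel)
  have nz: "qpoch_inf (of_real \<xi> * z) (of_real q) \<noteq> 0"
    using q_binomial_series_reciprocal[OF z(2)] by auto
  have h: "(?h has_sum 1 / qpoch_inf (of_real \<xi> * z) (of_real q)) UNIV"
    using summable_complex_\<eta>[OF z(2)] q_binomial_series_reciprocal[OF z(2)] nz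
    by (intro norm_summable_imp_has_sum) (auto simp: sums_iff summable_norm_cancel field_simps)
  have "((\<lambda>(j, m). ?e j * ?h m) has_sum ?S) (UNIV \<times> UNIV)"
    using has_sum_mult_abs[OF e _ h] summable_complex_\<epsilon>[of "1 / z"] summable_complex_\<eta>[OF z(2)]
    by (simp add: norm_summable_imp_summable_on)
  \<comment> \<open>The exponents j of 1/z and m of z are regrouped by the total degree n = m - j;
    pairs with n + j < 0 are then added as zeros.\<close>
  also have "?this \<longleftrightarrow> ((\<lambda>(n, j). ?F n j) has_sum ?S) {(n, j). n + int j \<ge> 0}"
  proof (rule has_sum_reindex_bij_witness[of _ "\<lambda>(n, j). (j, nat (n + int j))" "\<lambda>(j, m). (int m - int j, j)"])
    fix a :: "nat \<times> nat" assume "a \<in> UNIV \<times> UNIV"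
    obtain j m where a: "a = (j, m)" by (cases a)
    have "z powi (int m - int j) = z ^ m * (1 / z) ^ j"
      using z(1) by (simp add: power_int_diff power_divide)
    thus "(case case a of (j, m) \<Rightarrow> (int m - int j, j) of (n, j) \<Rightarrow> ?F n j) = (case a of (j, m) \<Rightarrow> ?e j * ?h m)"
      by (simp add: a mult_ac)
  qed auto
  also have "\<dots> \<longleftrightarrow> ((\<lambda>(n, j). ?F n j) has_sum ?S) (UNIV \<times> UNIV)"
    by (rule has_sum_cong_neutral) (auto simp: int_ext_def)
  finally show ?thesis
  proof (rule has_sum_SigmaD)
    fix n :: int
    have "((\<lambda>j. (-1) ^ j * \<epsilon> j * int_ext \<eta> (n + int j)) has_sum J n) UNIV"
      using J_sums[of n] summable_abs_J[of n] by (intro norm_summable_imp_has_sum) auto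
    hence "((\<lambda>j. z powi n * complex_of_real ((-1) ^ j * \<epsilon> j * int_ext \<eta> (n + int j))) has_sum
        z powi n * complex_of_real (J n)) UNIV"
      by (intro has_sum_cmult_right) (rule has_sum_of_real)
    thus "((\<lambda>j. case (n, j) of (n, j) \<Rightarrow> ?F n j) has_sum z powi n * complex_of_real (J n)) UNIV" by simp
  qed
qed

lemma hahn_exton_J_eq: "hahn_exton_J n (2 * \<xi>) q = J n"
proof -
  let ?P = "\<lambda>J' :: int \<Rightarrow> real. \<forall>z::complex. z \<noteq> 0 \<and> norm (of_real (2 * \<xi>) * z) < 2 \<longrightarrow>
        ((\<lambda>m. z powi m * of_real (J' m)) has_sum
           qpoch_inf (of_real q * of_real (2 * \<xi>) / (2 * z)) (of_real q) /
           qpoch_inf (of_real (2 * \<xi>) * z / 2) (of_real q)) UNIV"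
  have norm_eq: "norm (of_real (2 * \<xi>) * z) = 2 * (\<xi> * norm z)" for z :: complex
    using \<xi>_nonneg by (simp add: norm_mult)
  have PJ: "?P J"
  proof (intro allI impI)
    fix z :: complex assume "z \<noteq> 0 \<and> norm (of_real (2 * \<xi>) * z) < 2"
    hence "z \<noteq> 0" "\<xi> * norm z < 1" unfolding norm_eq by auto
    from J_generating_function[OF this]
    show "((\<lambda>m. z powi m * of_real (J m)) has_sum
           qpoch_inf (of_real q * of_real (2 * \<xi>) / (2 * z)) (of_real q) /
           qpoch_inf (of_real (2 * \<xi>) * z / 2) (of_real q)) UNIV" by simp
  qed
  \<comment> \<open>Because \<xi> < 1, the unit circle lies in the region of definition, and a
    comparison there determines all coefficients.\<close>
  have uniq: "J' = J" if P: "?P J'" for J'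
  proof
    fix m
    have "complex_of_real (J' m - J m) = 0"
    proof (rule laurent_coeffs_zero[where d = "\<lambda>m. complex_of_real (J' m - J m)"])
      fix z :: complex assume z: "norm z = 1"
      hence *: "z \<noteq> 0 \<and> norm (of_real (2 * \<xi>) * z) < 2" unfolding norm_eq using \<xi>_lt_1 by auto
      show "((\<lambda>m. z powi m * complex_of_real (J' m - J m)) has_sum 0) UNIV"
        using has_sum_diff[OF P[rule_format, OF *] PJ[rule_format, OF *]]
        by (simp add: algebra_simps)
    qed
    thus "J' m = J m" by simp
  qed
  have "(THE J'. ?P J') = J"
  proof (rule the_equality)
    show "?P J" by (rule PJ)
  next
    fix J' assume "?P J'"
    thus "J' = J" by (rule uniq)
  qed
  thus ?thesis by (simp add: hahn_exton_J_def)
qed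

text \<open>The generating function converges at z = 1, and unordered summability is
  absolute.\<close>

lemma J_tendsto_0: "(\<lambda>k. J (a + int k)) \<longlonglongrightarrow> 0"
proof -
  have "(\<lambda>n. 1 powi n * complex_of_real (J n)) summable_on UNIV"
    by (rule has_sum_imp_summable[OF J_generating_function]) (use \<xi>_lt_1 in auto)
  hence "(\<lambda>n. \<bar>J n\<bar>) summable_on UNIV"
    by (simp add: summable_on_iff_abs_summable_on_complex)
  hence "(\<lambda>n. \<bar>J n\<bar>) summable_on range (\<lambda>k. a + int k)"
    by (rule summable_on_subset_banach) auto
  hence "(\<lambda>k. \<bar>J (a + int k)\<bar>) summable_on UNIV"
    by (subst (asm) summable_on_reindex) (auto simp: o_def inj_on_def)
  hence "summable (\<lambda>k. \<bar>J (a + int k)\<bar>)"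
    by (simp add: summable_on_UNIV_nonneg_real_iff)
  hence "(\<lambda>k. \<bar>J (a + int k)\<bar>) \<longlonglongrightarrow> 0" by (rule summable_LIMSEQ_zero)
  thus ?thesis by (rule tendsto_rabs_zero_cancel)
qed

text \<open>In the series for J n, the factor q^n splits as q^(n + j) / q^j. The first-order
  recurrences of \<open>\<eta>\<close> and \<open>\<epsilon>\<close> turn each part into a
  difference of neighbours, and the product expands into four series, each a J of order n - 1, n or
  n + 1.\<close>

lemma J_recurrence:
  assumes "0 < q"
  shows "\<xi> * (J (n + 1) + J (n - 1)) = (1 + \<xi>\<^sup>2 - q powi n) * J n"
proof -
  define e where "e j = (-1) ^ j * \<epsilon> j" for j
  define e' where "e' j = (if j = 0 then 0 else e (j - 1))" for j
  have e_q: "e j / q ^ j = e j - \<xi> * e' j" for j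
  proof (cases j)
    case (Suc i)
    have "e j * (1 - q ^ j) = (-1) ^ j * (\<epsilon> (Suc i) * (1 - q ^ Suc i))"
      by (simp add: e_def Suc)
    also have "\<dots> = - (\<xi> * q ^ j * e' j)"
      unfolding \<epsilon>_Suc by (simp add: e'_def e_def Suc)
    finally have "e j = q ^ j * (e j - \<xi> * e' j)" by (simp add: algebra_simps)
    thus ?thesis using assms by (simp add: field_simps)
  qed (simp add: e'_def)
  have h_q: "q powi m * int_ext \<eta> m = int_ext \<eta> m - \<xi> * int_ext \<eta> (m - 1)" for m
  proof (cases "m \<le> 0")
    case True
    thus ?thesis by (cases "m = 0") (auto simp: int_ext_def)
  next
    case False
    then obtain i where i: "m = int (Suc i)" by (metis not_le zero_less_imp_eq_int gr0_conv_Suc)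
    have "m - 1 = int i" "q powi m = q ^ Suc i" unfolding i by (simp, rule power_int_of_nat)
    moreover have "int_ext \<eta> m = \<eta> (Suc i)" unfolding i by (rule int_ext_of_nat)
    ultimately show ?thesis using \<eta>_Suc[of i] by (simp add: algebra_simps)
  qed
  have J: "(\<lambda>j. e j * int_ext \<eta> (m + int j)) sums J m" for m
    unfolding e_def by (rule J_sums)
  have J': "(\<lambda>j. e' j * int_ext \<eta> (m + int j)) sums J (m + 1)" for m
  proof -
    have "(\<lambda>j. e' (Suc j) * int_ext \<eta> (m + int (Suc j))) sums J (m + 1)"
      using J[of "m + 1"] by (simp add: e'_def add_ac)
    thus ?thesis by (subst (asm) sums_Suc_iff) (simp add: e'_def)
  qed
  have "(\<lambda>j. e j * int_ext \<eta> (n + int j) - \<xi> * (e j * int_ext \<eta> (n - 1 + int j))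
          - \<xi> * (e' j * int_ext \<eta> (n + int j)) + \<xi>\<^sup>2 * (e' j * int_ext \<eta> (n - 1 + int j))) sums
        (J n - \<xi> * J (n - 1) - \<xi> * J (n + 1) + \<xi>\<^sup>2 * J (n - 1 + 1))"
    by (intro sums_add sums_diff sums_mult J J')
  also have "(\<lambda>j. e j * int_ext \<eta> (n + int j) - \<xi> * (e j * int_ext \<eta> (n - 1 + int j))
          - \<xi> * (e' j * int_ext \<eta> (n + int j)) + \<xi>\<^sup>2 * (e' j * int_ext \<eta> (n - 1 + int j))) =
      (\<lambda>j. q powi n * (e j * int_ext \<eta> (n + int j)))"
  proof
    fix j
    have "q powi n = q powi (n + int j) / q ^ j"
      using assms by (simp add: power_int_add)
    hence "q powi n * (e j * int_ext \<eta> (n + int j)) =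
        (e j / q ^ j) * (q powi (n + int j) * int_ext \<eta> (n + int j))" by simp
    also have "\<dots> = (e j - \<xi> * e' j) * (int_ext \<eta> (n + int j) - \<xi> * int_ext \<eta> (n + int j - 1))"
      unfolding e_q h_q ..
    finally show "e j * int_ext \<eta> (n + int j) - \<xi> * (e j * int_ext \<eta> (n - 1 + int j))
          - \<xi> * (e' j * int_ext \<eta> (n + int j)) + \<xi>\<^sup>2 * (e' j * int_ext \<eta> (n - 1 + int j)) =
        q powi n * (e j * int_ext \<eta> (n + int j))"
      by (simp add: algebra_simps power2_eq_square)
  qed
  finally have "(\<lambda>j. q powi n * (e j * int_ext \<eta> (n + int j))) sums
      (J n - \<xi> * J (n - 1) - \<xi> * J (n + 1) + \<xi>\<^sup>2 * J n)" by simp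
  moreover have "(\<lambda>j. q powi n * (e j * int_ext \<eta> (n + int j))) sums (q powi n * J n)"
    by (intro sums_mult J)
  ultimately have "q powi n * J n = J n - \<xi> * J (n - 1) - \<xi> * J (n + 1) + \<xi>\<^sup>2 * J n"
    by (rule sums_unique2[symmetric])
  thus ?thesis by (simp add: algebra_simps)
qed

end

subsection \<open>The $q$-Bessel kernel as a limit\<close>

lemma suminf_tendsto_dominated:
  fixes f :: "nat \<Rightarrow> nat \<Rightarrow> real"
  assumes "\<And>k. (\<lambda>N. f N k) \<longlonglongrightarrow> g k" "\<And>N k. \<bar>f N k\<bar> \<le> M k" "summable M"
  shows "(\<lambda>N. suminf (f N)) \<longlonglongrightarrow> suminf g"
  using tannerys_theorem[of "\<lambda>k N. f N k" g sequentially M] assms by (simp add: case_prod_unfold)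

locale q_bessel_pos = q_bessel +
  assumes q_pos: "0 < q" and \<xi>_pos: "0 < \<xi>"
begin

text \<open>Half-integer powers of q, in the nodes and in the kernel, become integer powers of
  p.\<close>

definition p :: real where "p = sqrt q"

lemma p_pos: "0 < p" and p_lt_1: "p < 1" and p_squared: "p * p = q"
  using q_pos q_lt_1 by (auto simp: p_def)

lemma p_powi_double: "p powi (2 * n) = q powi n"
  using p_squared by (simp add: power_int_mult power2_eq_square)

lemma p_powi_add: "p powi (m + n) = p powi m * p powi n"
  using p_pos by (intro power_int_add) auto

lemma p_powi_eq_powr: "p powi n = q powr (of_int n / 2)"
proof -
  have "p powi n = p powr of_int n" using p_pos by (simp add: powr_real_of_int')
  also have "\<dots> = (q powr (1 / 2)) powr of_int n" using q_pos by (simp add: p_def powr_half_sqrt)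
  finally show ?thesis by (simp add: powr_powr)
qed

text \<open>The points are r = a + 1/2 and s = b + 1/2, and the index of the q-Bessel series is k +
  1/2; the power of p equals q^((r + s)/2 + 1/2).\<close>

definition Kser :: "int \<Rightarrow> int \<Rightarrow> real" where
  "Kser a b = (\<Sum>k. p powi (a + b + 2) * q ^ k * (J (a + 1 + int k) * J (b + 1 + int k)))"

lemma Kser_eq_quotient:
  assumes "a \<noteq> b"
  shows "Kser a b = \<xi> * (J (a + 1) * J b - J a * J (b + 1)) / (p powi (a - b) - p powi (b - a))"
proof -
  \<comment> \<open>A Casoratian of the recurrence: in its differences the common coefficient 1 +
    \<xi>^2 cancels and only powers of q survive, which gives the summand of \<open>Kser\<close>
    times \<open>D\<close>.\<close>
  define L where "L a b = \<xi> * (J (a + 1) * J b - J a * J (b + 1))" for a b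
  define D where "D = p powi (a - b) - p powi (b - a)"
  have D: "D \<noteq> 0"
  proof
    assume "D = 0"
    hence "q powr (of_int (a - b) / 2) = q powr (of_int (b - a) / 2)"
      by (simp only: D_def p_powi_eq_powr)
    hence "real_of_int (a - b) / 2 = of_int (b - a) / 2"
      using q_pos q_lt_1 by (subst (asm) powr_inj) auto
    hence "real_of_int (a - b) = of_int (b - a)" by simp
    thus False using assms by (simp only: of_int_eq_iff) 
  qed
  have step: "L a b - L (a + 1) (b + 1) = (q powi (a + 1) - q powi (b + 1)) * (J (a + 1) * J (b + 1))" for a b
  proof -
    have "L a b - L (a + 1) (b + 1) =
        J (a + 1) * (\<xi> * (J (b + 1 + 1) + J (b + 1 - 1))) - J (b + 1) * (\<xi> * (J (a + 1 + 1) + J (a + 1 - 1)))"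
      by (simp add: L_def algebra_simps)
    also have "\<dots> = (q powi (a + 1) - q powi (b + 1)) * (J (a + 1) * J (b + 1))"
      unfolding J_recurrence[OF q_pos] by (simp add: algebra_simps)
    finally show ?thesis .
  qed
  have step': "L (a + int k) (b + int k) - L (a + int (Suc k)) (b + int (Suc k)) =
      D * (p powi (a + b + 2) * q ^ k * (J (a + 1 + int k) * J (b + 1 + int k)))" for k
  proof -
    have "q powi (a + int k + 1) - q powi (b + int k + 1) = D * (p powi (a + b + 2) * q ^ k)"
    proof -
      have q1: "q ^ k = p powi (2 * int k)" by (simp add: p_powi_double)
      have "D * (p powi (a + b + 2) * q ^ k) = p powi (a - b + (a + b + 2) + 2 * int k) - p powi (b - a + (a + b + 2) + 2 * int k)"
        by (simp only: q1 D_def left_diff_distrib p_powi_add mult.assoc)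
      also have "a - b + (a + b + 2) + 2 * int k = 2 * (a + int k + 1)" by simp
      also have "b - a + (a + b + 2) + 2 * int k = 2 * (b + int k + 1)" by simp
      finally show ?thesis by (simp only: p_powi_double)
    qed
    moreover have "a + int (Suc k) = a + int k + 1" "b + int (Suc k) = b + int k + 1"
      "a + 1 + int k = a + int k + 1" "b + 1 + int k = b + int k + 1" by simp_all
    ultimately show ?thesis using step[of "a + int k" "b + int k"]
      by (simp only: mult.assoc)
  qed
  have "(\<lambda>k. L (a + int k) (b + int k)) \<longlonglongrightarrow> \<xi> * (0 * 0 - 0 * 0)"
  proof -
    have "(\<lambda>k. J (c + int k + 1)) \<longlonglongrightarrow> 0" for c
      using J_tendsto_0[of "c + 1"] by (simp add: add_ac)
    thus ?thesis unfolding L_def by (intro tendsto_intros J_tendsto_0)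
  qed
  hence "(\<lambda>k. L (a + int k) (b + int k) - L (a + int (Suc k)) (b + int (Suc k))) sums (L (a + int 0) (b + int 0) - 0)"
    by (intro telescope_sums') simp
  hence "(\<lambda>k. D * (p powi (a + b + 2) * q ^ k * (J (a + 1 + int k) * J (b + 1 + int k)))) sums L a b"
    unfolding step' by simp
  hence "(\<lambda>k. inverse D * (D * (p powi (a + b + 2) * q ^ k * (J (a + 1 + int k) * J (b + 1 + int k))))) sums (inverse D * L a b)"
    by (rule sums_mult)
  hence "(\<lambda>k. p powi (a + b + 2) * q ^ k * (J (a + 1 + int k) * J (b + 1 + int k))) sums (inverse D * L a b)"
    using D by (simp add: mult.assoc[symmetric])
  hence "Kser a b = inverse D * L a b" by (simp add: Kser_def sums_iff)
  thus ?thesis by (simp add: D_def L_def field_simps)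
qed

lemma qBessel_kernel_eq_Kser: "qBessel_kernel \<xi> q (of_int a + 1 / 2) (of_int b + 1 / 2) = Kser a b"
proof (cases "a = b")
  case True
  have fl: "\<lfloor>real_of_int c + 1 / 2 + (real k + 1 / 2)\<rfloor> = c + 1 + int k" for c k by linarith
  have "q powi (a + 1 + int k) = p powi (a + a + 2) * q ^ k" for k
  proof -
    have "q powi (a + 1 + int k) = q powi (a + 1) * q ^ k"
      using q_pos by (simp add: power_int_add)
    also have "q powi (a + 1) = p powi (2 * (a + 1))" by (rule p_powi_double[symmetric])
    also have "2 * (a + 1) = a + a + 2" by simp
    finally show ?thesis .
  qed
  thus ?thesis using True
    by (simp only: qBessel_kernel_def Let_def fl hahn_exton_J_eq Kser_def power2_eq_square refl if_True)
next
  case False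
  have fl: "\<lfloor>real_of_int c + 1 / 2 + 1 / 2\<rfloor> = c + 1" "\<lfloor>real_of_int c + 1 / 2 - 1 / 2\<rfloor> = c" for c
    by linarith+
  have "(real_of_int a + 1 / 2 - (real_of_int b + 1 / 2)) / 2 = of_int (a - b) / 2"
    "- ((real_of_int a + 1 / 2 - (real_of_int b + 1 / 2)) / 2) = of_int (b - a) / 2"
    by (simp_all add: field_simps)
  moreover have "real_of_int a + 1 / 2 \<noteq> real_of_int b + 1 / 2" using False by simp
  ultimately show ?thesis
    by (simp only: qBessel_kernel_def Let_def fl hahn_exton_J_eq Kser_eq_quotient[OF False] p_powi_eq_powr if_False)
qed

section \<open>Finite-N analogues of the q-Bessel functions\<close>

definition x :: "nat \<Rightarrow> real" where "x i = \<xi> * p * q ^ i"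

text \<open>\<open>p ^ m * \<eta>N N m\<close> and \<open>\<epsilon>N N j / p ^ j\<close> are the complete and elementary symmetric functions of
  $x_0, \ldots, x_{N-1}$. A vanishing factor makes \<open>\<epsilon>N N j\<close> zero for \<open>j > N\<close>.\<close>

definition \<eta>N :: "nat \<Rightarrow> nat \<Rightarrow> real" where
  "\<eta>N N m = (\<Prod>i<m. \<xi> * (1 - q ^ (N + i)) / (1 - q ^ Suc i))"

definition \<epsilon>N :: "nat \<Rightarrow> nat \<Rightarrow> real" where
  "\<epsilon>N N j = (\<Prod>i<j. \<xi> * q ^ Suc i * (1 - q ^ (N - i)) / (1 - q ^ Suc i))"

text \<open>The Blaschke coefficient seen from position N, freed from its power of p
  (\<open>\<beta>_eq_JN\<close>). Writing the finite sum as a series over all j permits a termwise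
  comparison with \<open>J\<close>.\<close>

definition JN :: "nat \<Rightarrow> int \<Rightarrow> real" where
  "JN N n = (\<Sum>j. (-1) ^ j * \<epsilon>N N j * int_ext (\<eta>N N) (n + int j))"

lemma blaschke_nodes_x: "blaschke_nodes N x"
proof
  fix i
  show "0 < x i" using q_pos \<xi>_pos p_pos by (simp add: x_def)
  have "\<xi> * p * q ^ i \<le> \<xi> * 1 * 1"
    using \<xi>_pos p_pos p_lt_1 q_pos q_pow_le_1 by (intro mult_mono) auto
  thus "x i < 1" using \<xi>_lt_1 by (simp add: x_def)
next
  show "inj_on x {..<N}"
    using q_pos q_lt_1 \<xi>_pos p_pos by (auto simp: inj_on_def x_def power_inject_exp')
qed

text \<open>Each factor 1 - q^c introduced by the truncation lies in [0, 1], so the limiting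
  coefficients dominate uniformly in N.\<close>

lemma \<eta>N_bounds: "0 \<le> \<eta>N N m" "\<eta>N N m \<le> \<eta> m"
proof -
  have *: "0 \<le> \<xi> * (1 - q ^ (N + i)) / (1 - q ^ Suc i) \<and>
      \<xi> * (1 - q ^ (N + i)) / (1 - q ^ Suc i) \<le> \<xi> / (1 - q ^ Suc i)" for i
  proof -
    have "0 \<le> \<xi> * (1 - q ^ (N + i))" "\<xi> * (1 - q ^ (N + i)) \<le> \<xi> * 1"
      using \<xi>_nonneg q_pow_le_1[of "N + i"] q_nonneg by (auto intro!: mult_left_mono mult_nonneg_nonneg simp del: mult_1_right)
    thus ?thesis using one_minus_q_Suc(1)[of i]
      by (auto intro!: divide_nonneg_pos divide_right_mono simp del: power_Suc)
  qed
  show "0 \<le> \<eta>N N m" unfolding \<eta>N_def using * by (intro prod_nonneg) auto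
  show "\<eta>N N m \<le> \<eta> m" unfolding \<eta>N_def \<eta>_def using * by (intro prod_mono) auto
qed

lemma \<epsilon>N_bounds: "0 \<le> \<epsilon>N N m" "\<epsilon>N N m \<le> \<epsilon> m"
proof -
  have *: "0 \<le> \<xi> * q ^ Suc i * (1 - q ^ (N - i)) / (1 - q ^ Suc i) \<and>
      \<xi> * q ^ Suc i * (1 - q ^ (N - i)) / (1 - q ^ Suc i) \<le> \<xi> * q ^ Suc i / (1 - q ^ Suc i)" for i
  proof -
    have "0 \<le> \<xi> * q ^ Suc i" using \<xi>_nonneg q_nonneg by simp
    hence "0 \<le> \<xi> * q ^ Suc i * (1 - q ^ (N - i))" "\<xi> * q ^ Suc i * (1 - q ^ (N - i)) \<le> \<xi> * q ^ Suc i * 1"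
      using q_pow_le_1[of "N - i"] q_nonneg
      by (auto intro!: mult_left_mono mult_nonneg_nonneg simp del: mult_1_right power_Suc)
    thus ?thesis using one_minus_q_Suc(1)[of i]
      by (auto intro!: divide_nonneg_pos divide_right_mono simp del: power_Suc)
  qed
  show "0 \<le> \<epsilon>N N m" unfolding \<epsilon>N_def using * by (intro prod_nonneg) auto
  show "\<epsilon>N N m \<le> \<epsilon> m" unfolding \<epsilon>N_def \<epsilon>_def using * by (intro prod_mono) auto
qed

lemma abs_JN_term_le: "\<bar>(-1) ^ j * \<epsilon>N N j * int_ext (\<eta>N N) n\<bar> \<le> \<epsilon> j * B"
proof -
  have "\<bar>int_ext (\<eta>N N) n\<bar> \<le> B"
    using \<eta>N_bounds[of N "nat n"] \<eta>_le_B[of "nat n"] B_nonneg by (simp add: int_ext_def)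
  thus ?thesis using \<epsilon>N_bounds[of N j] \<epsilon>_nonneg[of j]
    by (simp add: abs_mult power_abs mult_mono)
qed

lemma summable_\<epsilon>_B: "summable (\<lambda>j. \<epsilon> j * B)"
  by (rule summable_mult2[OF summable_\<epsilon>])

lemma abs_JN_le: "\<bar>JN N n\<bar> \<le> (\<Sum>j. \<epsilon> j * B)"
proof -
  have s: "summable (\<lambda>j. \<bar>(-1) ^ j * \<epsilon>N N j * int_ext (\<eta>N N) (n + int j)\<bar>)"
    by (rule summable_comparison_test'[OF summable_\<epsilon>_B, of 0]) (use abs_JN_term_le in auto)
  show ?thesis unfolding JN_def
    by (rule order.trans[OF summable_rabs[OF s] suminf_le[OF abs_JN_term_le s summable_\<epsilon>_B]])
qed

lemma q_power_add_tendsto_0: "(\<lambda>N. q ^ (N + i)) \<longlonglongrightarrow> 0"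
  using q_nonneg q_lt_1 by (intro LIMSEQ_ignore_initial_segment LIMSEQ_power_zero) auto

lemma \<eta>N_tendsto: "(\<lambda>N. \<eta>N N m) \<longlonglongrightarrow> \<eta> m"
proof -
  have "(\<lambda>N. \<eta>N N m) \<longlonglongrightarrow> (\<Prod>i<m. \<xi> * (1 - 0) / (1 - q ^ Suc i))"
    unfolding \<eta>N_def using one_minus_q_Suc(2)
    by (intro tendsto_intros q_power_add_tendsto_0) auto
  thus ?thesis by (simp add: \<eta>_def)
qed

lemma \<epsilon>N_tendsto: "(\<lambda>N. \<epsilon>N N m) \<longlonglongrightarrow> \<epsilon> m"
proof -
  have "(\<lambda>N. q ^ (N - i)) \<longlonglongrightarrow> 0" for i
    by (rule LIMSEQ_offset[where k = i]) (use q_power_add_tendsto_0[of 0] in simp)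
  hence "(\<lambda>N. \<epsilon>N N m) \<longlonglongrightarrow> (\<Prod>i<m. \<xi> * q ^ Suc i * (1 - 0) / (1 - q ^ Suc i))"
    unfolding \<epsilon>N_def using one_minus_q_Suc(2)
    by (intro tendsto_intros) auto
  thus ?thesis by (simp add: \<epsilon>_def)
qed

lemma JN_tendsto: "(\<lambda>N. JN N n) \<longlonglongrightarrow> J n"
proof -
  have "(\<lambda>N. int_ext (\<eta>N N) m) \<longlonglongrightarrow> int_ext \<eta> m" for m
    by (simp add: int_ext_def \<eta>N_tendsto)
  hence lim: "(\<lambda>N. (-1) ^ j * \<epsilon>N N j * int_ext (\<eta>N N) (n + int j)) \<longlonglongrightarrow>
      (-1) ^ j * \<epsilon> j * int_ext \<eta> (n + int j)" for j
    by (intro tendsto_intros \<epsilon>N_tendsto)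
  show ?thesis
    unfolding JN_def J_def by (rule suminf_tendsto_dominated[OF lim abs_JN_term_le summable_\<epsilon>_B])
qed

text \<open>The rule h_(m+1)(x_0..x_N) - x_N h_m(x_0..x_N) = h_(m+1)(x_0..x_(N-1)) with the powers
  of p removed. Both sides are multiples of \<open>\<eta>N (Suc N) m\<close>: splitting off the last
  factor treats the left side, splitting off the first the right side.\<close>

lemma \<eta>N_recurrence: "\<eta>N (Suc N) (Suc m) - \<xi> * q ^ N * \<eta>N (Suc N) m = \<eta>N N (Suc m)"
proof -
  have shift: "\<eta>N N (Suc m) * (1 - q ^ Suc m) = \<xi> * (1 - q ^ N) * \<eta>N (Suc N) m"
  proof -
    have "\<eta>N N (Suc m) = (\<Prod>i<Suc m. \<xi> * (1 - q ^ (N + i))) / (\<Prod>i<Suc m. 1 - q ^ Suc i)"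
      unfolding \<eta>N_def by (rule prod_dividef)
    also have "(\<Prod>i<Suc m. \<xi> * (1 - q ^ (N + i))) = \<xi> * (1 - q ^ N) * (\<Prod>i<m. \<xi> * (1 - q ^ (Suc N + i)))"
      by (subst prod.lessThan_Suc_shift) simp
    also have "(\<Prod>i<Suc m. 1 - q ^ Suc i) = (\<Prod>i<m. 1 - q ^ Suc i) * (1 - q ^ Suc m)" by simp
    finally show ?thesis using one_minus_q_Suc(2)[of m]
      by (simp add: \<eta>N_def prod_dividef del: power_Suc)
  qed
  have last: "\<eta>N (Suc N) (Suc m) * (1 - q ^ Suc m) = \<xi> * (1 - q ^ (Suc N + m)) * \<eta>N (Suc N) m"
    using one_minus_q_Suc(2)[of m] by (simp add: \<eta>N_def del: power_Suc)
  have "(\<eta>N (Suc N) (Suc m) - \<xi> * q ^ N * \<eta>N (Suc N) m) * (1 - q ^ Suc m) =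
      \<xi> * (1 - q ^ (Suc N + m)) * \<eta>N (Suc N) m - \<xi> * q ^ N * \<eta>N (Suc N) m * (1 - q ^ Suc m)"
    unfolding left_diff_distrib last ..
  also have "\<dots> = \<xi> * (1 - q ^ N) * \<eta>N (Suc N) m" by (simp add: algebra_simps power_add)
  also have "\<dots> = \<eta>N N (Suc m) * (1 - q ^ Suc m)" by (rule shift[symmetric])
  finally show ?thesis using one_minus_q_Suc(2)[of m] by (simp del: power_Suc)
qed

lemma fps_\<eta>N: "Abs_fps (\<lambda>m. p ^ m * \<eta>N N m) * (\<Prod>i<N. 1 - fps_const (x i) * fps_X) = 1"
proof (induction N)
  case 0
  \<comment> \<open>Without variables the factor 1 - q^0 at i = 0 vanishes.\<close>
  have "\<eta>N 0 m = (if m = 0 then 1 else 0)" for m by (auto simp: \<eta>N_def intro!: bexI[of _ 0])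
  thus ?case by (auto simp: fps_eq_iff)
next
  case (Suc N)
  let ?A = "\<lambda>N. Abs_fps (\<lambda>m. p ^ m * \<eta>N N m)"
  have "?A (Suc N) * (1 - fps_const (x N) * fps_X) = ?A N"
  proof (rule fps_ext)
    fix m
    have "fps_nth (?A (Suc N) * (1 - fps_const (x N) * fps_X)) m =
        fps_nth (?A (Suc N)) m - x N * (if m = 0 then 0 else fps_nth (?A (Suc N)) (m - 1))"
      by (simp add: right_diff_distrib mult.assoc mult.left_commute[of _ "fps_const _"])
    also have "\<dots> = fps_nth (?A N) m"
    proof (cases m)
      case 0 thus ?thesis by (simp add: \<eta>N_def)
    next
      case (Suc l)
      show ?thesis using \<eta>N_recurrence[of N l] by (simp add: Suc x_def algebra_simps flip: \<eta>N_recurrence[of N l])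
    qed
    finally show "fps_nth (?A (Suc N) * (1 - fps_const (x N) * fps_X)) m = fps_nth (?A N) m" .
  qed
  thus ?case using Suc by (simp add: mult_ac) (metis (no_types, lifting) mult.assoc mult.commute)
qed

text \<open>The rule e_(j+1)(x_0..x_N) = e_(j+1)(x_0..x_(N-1)) + x_N e_j(x_0..x_(N-1)), where
  clearing the powers of p turns q^N into q^(N+1). The bound on j keeps \<open>N - j\<close> from
  truncating.\<close>

lemma \<epsilon>N_recurrence:
  assumes "j \<le> N"
  shows "\<epsilon>N (Suc N) (Suc j) = \<epsilon>N N (Suc j) + \<xi> * q ^ Suc N * \<epsilon>N N j"
proof -
  have shift: "\<epsilon>N (Suc N) (Suc j) * (1 - q ^ Suc j) = \<xi> * q ^ Suc j * (1 - q ^ Suc N) * \<epsilon>N N j"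
  proof -
    have split: "\<epsilon>N M l = (\<Prod>i<l. \<xi> * q ^ Suc i) * (\<Prod>i<l. 1 - q ^ (M - i)) / (\<Prod>i<l. 1 - q ^ Suc i)" for M l
      unfolding \<epsilon>N_def prod_dividef prod.distrib ..
    have "(\<Prod>i<Suc j. 1 - q ^ (Suc N - i)) = (1 - q ^ Suc N) * (\<Prod>i<j. 1 - q ^ (N - i))"
      by (subst prod.lessThan_Suc_shift) simp
    moreover have "(\<Prod>i<Suc j. \<xi> * q ^ Suc i) = (\<Prod>i<j. \<xi> * q ^ Suc i) * (\<xi> * q ^ Suc j)" by simp
    moreover have "(\<Prod>i<Suc j. 1 - q ^ Suc i) = (\<Prod>i<j. 1 - q ^ Suc i) * (1 - q ^ Suc j)" by simp
    ultimately show ?thesis unfolding split using one_minus_q_Suc(2)[of j]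
      by (simp only:) (simp del: power_Suc)
  qed
  have last: "\<epsilon>N N (Suc j) * (1 - q ^ Suc j) = \<xi> * q ^ Suc j * (1 - q ^ (N - j)) * \<epsilon>N N j"
    using one_minus_q_Suc(2)[of j] by (simp add: \<epsilon>N_def del: power_Suc)
  have qN: "q ^ Suc j * q ^ (N - j) = q ^ Suc N" using assms by (simp flip: power_add)
  have "(\<epsilon>N N (Suc j) + \<xi> * q ^ Suc N * \<epsilon>N N j) * (1 - q ^ Suc j) =
      \<xi> * q ^ Suc j * (1 - q ^ (N - j)) * \<epsilon>N N j + \<xi> * q ^ Suc N * \<epsilon>N N j * (1 - q ^ Suc j)"
    unfolding distrib_right last ..
  also have "\<dots> = (\<xi> * \<epsilon>N N j) * (q ^ Suc j - q ^ Suc j * q ^ (N - j) + q ^ Suc N * (1 - q ^ Suc j))"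
    by (simp add: algebra_simps)
  also have "\<dots> = \<xi> * q ^ Suc j * (1 - q ^ Suc N) * \<epsilon>N N j"
    unfolding qN by (simp add: algebra_simps)
  also have "\<dots> = \<epsilon>N (Suc N) (Suc j) * (1 - q ^ Suc j)" by (rule shift[symmetric])
  finally show ?thesis using one_minus_q_Suc(2)[of j] by (simp del: power_Suc)
qed

lemma \<epsilon>N_eq_0: "N < j \<Longrightarrow> \<epsilon>N N j = 0"
  unfolding \<epsilon>N_def by (rule prod_zero) (auto intro!: bexI[of _ N])

lemma fps_\<epsilon>N:
  "fps_nth (\<Prod>i<N. fps_X - fps_const (x i)) k =
     (if k \<le> N then (-1) ^ (N - k) * (\<epsilon>N N (N - k) / p ^ (N - k)) else 0)"
proof (induction N arbitrary: k)
  case 0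
  thus ?case by (auto simp: \<epsilon>N_def)
next
  case (Suc N)
  have e0: "\<epsilon>N M 0 = 1" for M by (simp add: \<epsilon>N_def)
  have rec: "\<epsilon>N (Suc N) (Suc j) / p ^ Suc j = \<epsilon>N N (Suc j) / p ^ Suc j + x N * (\<epsilon>N N j / p ^ j)" if "j \<le> N" for j
    unfolding \<epsilon>N_recurrence[OF that] x_def using p_pos p_squared by (simp add: field_simps)
  have "fps_nth (\<Prod>i<Suc N. fps_X - fps_const (x i)) k =
      (if k = 0 then 0 else fps_nth (\<Prod>i<N. fps_X - fps_const (x i)) (k - 1)) -
      x N * fps_nth (\<Prod>i<N. fps_X - fps_const (x i)) k"
    unfolding prod.lessThan_Suc mult.commute[of _ "fps_X - fps_const (x N)"]
    by (simp add: left_diff_distrib)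
  also have "\<dots> = (if k \<le> Suc N then (-1) ^ (Suc N - k) * (\<epsilon>N (Suc N) (Suc N - k) / p ^ (Suc N - k)) else 0)"
  proof -
    consider "k = 0" | l where "k = Suc l" "l < N" | "k = Suc N" | "k > Suc N"
      by (metis Suc_lessI less_antisym not_less_eq old.nat.exhaust)
    thus ?thesis
    proof cases
      case 1
      have "\<epsilon>N N (Suc N) = 0" by (rule \<epsilon>N_eq_0) simp
      thus ?thesis using rec[of N] 1 by (simp add: Suc.IH)
    next
      case (2 l)
      define j where "j = N - Suc l"
      have j: "N - l = Suc j" "N - Suc l = j" "j \<le> N" using 2 by (auto simp: j_def)
      show ?thesis using 2 rec[OF j(3)] by (simp add: Suc.IH j algebra_simps)
    next
      case 3
      thus ?thesis by (simp add: Suc.IH e0)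
    next
      case 4
      thus ?thesis by (simp add: Suc.IH)
    qed
  qed
  finally show ?case .
qed

text \<open>The coefficient of z^i in the numerator is an elementary function of index N - i, so the
  convolution at z^(b+1) pairs complete and elementary functions whose indices differ by n, and the
  powers of p combine to p^n. Hence only the position relative to N matters in the limit.\<close>

lemma \<beta>_eq_JN:
  assumes "n = int (Suc b) - int N"
  shows "blaschke_nodes.\<beta> N x b = p powi n * JN N n"
proof -
  interpret blaschke_nodes N x by (rule blaschke_nodes_x)
  let ?a = "\<lambda>i. fps_nth (\<Prod>i<N. fps_X - fps_const (x i)) i"
  have "\<beta> b = fps_nth ((\<Prod>i<N. fps_X - fps_const (x i)) * Abs_fps (\<lambda>m. p ^ m * \<eta>N N m)) (Suc b)"
    by (rule fps_nth_blaschke[OF fps_\<eta>N, symmetric])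
  also have "\<dots> = (\<Sum>i=0..Suc b. ?a i * (p ^ (Suc b - i) * \<eta>N N (Suc b - i)))"
    by (simp add: fps_mult_nth)
  also have "\<dots> = (\<Sum>i\<in>{..N} \<inter> {..Suc b}. ?a i * (p ^ (Suc b - i) * \<eta>N N (Suc b - i)))"
    by (rule sum.mono_neutral_right) (auto simp: fps_\<epsilon>N)
  also have "\<dots> = (\<Sum>j\<in>{j. j \<le> N \<and> 0 \<le> n + int j}. p powi n * ((-1) ^ j * \<epsilon>N N j * int_ext (\<eta>N N) (n + int j)))"
  proof (rule sum.reindex_bij_witness[of _ "\<lambda>j. N - j" "\<lambda>i. N - i"])
    fix i assume i: "i \<in> {..N} \<inter> {..Suc b}"
    have eq: "n + int (N - i) = int (Suc b - i)" using i assms by (auto simp: of_nat_diff)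
    have "p powi n = p powi (int (Suc b - i) - int (N - i))" using eq by (simp flip: eq)
    also have "\<dots> = p ^ (Suc b - i) / p ^ (N - i)" using p_pos by (simp add: power_int_diff)
    finally show "p powi n * ((-1) ^ (N - i) * \<epsilon>N N (N - i) * int_ext (\<eta>N N) (n + int (N - i))) =
        ?a i * (p ^ (Suc b - i) * \<eta>N N (Suc b - i))"
      using i unfolding eq int_ext_of_nat fps_\<epsilon>N by simp
  qed (use assms in auto)
  also have "\<dots> = p powi n * (\<Sum>j\<in>{j. j \<le> N \<and> 0 \<le> n + int j}. (-1) ^ j * \<epsilon>N N j * int_ext (\<eta>N N) (n + int j))"
    by (simp add: sum_distrib_left)
  also have "(\<Sum>j\<in>{j. j \<le> N \<and> 0 \<le> n + int j}. (-1) ^ j * \<epsilon>N N j * int_ext (\<eta>N N) (n + int j)) = JN N n"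
    unfolding JN_def by (rule suminf_finite[symmetric]) (auto simp: int_ext_def \<epsilon>N_eq_0)
  finally show ?thesis .
qed

text \<open>Tannery's theorem for the tail sum: \<open>JN\<close> is bounded uniformly in N and in
  its order, so the terms are dominated by a geometric series in q. For large N the arguments of
  \<open>nat\<close> are nonnegative.\<close>

lemma K_tendsto_Kser:
  "(\<lambda>N. blaschke_nodes.K N x (nat (int N + a)) (nat (int N + b))) \<longlonglongrightarrow> Kser a b"
proof -
  define E where "E = (\<Sum>j. \<epsilon> j * B)"
  define t where "t N k = p powi (a + b + 2) * q ^ k * (JN N (a + 1 + int k) * JN N (b + 1 + int k))" for N k
  have E: "0 \<le> E" using abs_JN_le[of 0 0] unfolding E_def by linarith
  have eq: "blaschke_nodes.K N x (nat (int N + a)) (nat (int N + b)) = suminf (t N)"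
    if N: "int N + a \<ge> 0" "int N + b \<ge> 0" for N
  proof -
    interpret blaschke_nodes N x by (rule blaschke_nodes_x)
    have \<beta>: "\<beta> (nat (int N + c) + k) = p powi (c + 1 + int k) * JN N (c + 1 + int k)" if "int N + c \<ge> 0" for c k
      by (rule \<beta>_eq_JN) (use that in auto)
    have tt: "t N k = \<beta> (nat (int N + a) + k) * \<beta> (nat (int N + b) + k)" for k
    proof -
      have "q ^ k = p powi (2 * int k)" by (simp add: p_powi_double)
      hence "p powi (a + b + 2) * q ^ k = p powi ((a + b + 2) + 2 * int k)"
        using p_pos by (subst power_int_add) auto
      also have "(a + b + 2) + 2 * int k = (a + 1 + int k) + (b + 1 + int k)" by simp
      also have "p powi \<dots> = p powi (a + 1 + int k) * p powi (b + 1 + int k)"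
        using p_pos by (subst power_int_add) auto
      finally show ?thesis unfolding t_def \<beta>[OF N(1)] \<beta>[OF N(2)] by simp
    qed
    have "t N sums K (nat (int N + a)) (nat (int N + b))"
      using has_sum_K_\<beta>[of "nat (int N + a)" "nat (int N + b)"] unfolding tt[symmetric]
      by (rule has_sum_imp_sums)
    thus ?thesis by (simp add: sums_iff)
  qed
  have "(\<lambda>N. suminf (t N)) \<longlonglongrightarrow> Kser a b"
  proof -
    have lim: "(\<lambda>N. t N k) \<longlonglongrightarrow> p powi (a + b + 2) * q ^ k * (J (a + 1 + int k) * J (b + 1 + int k))" for k
      unfolding t_def by (intro tendsto_intros JN_tendsto)
    have bound: "\<bar>t N k\<bar> \<le> p powi (a + b + 2) * q ^ k * (E * E)" for N k
      unfolding t_def using p_pos q_pos abs_JN_le E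
      by (auto simp: abs_mult E_def intro!: mult_left_mono mult_mono)
    have "summable (\<lambda>k. p powi (a + b + 2) * q ^ k * (E * E))"
      using q_pos q_lt_1 by (intro summable_mult2 summable_mult summable_geometric) auto
    thus ?thesis unfolding Kser_def by (rule suminf_tendsto_dominated[OF lim bound])
  qed
  moreover have "eventually (\<lambda>N. suminf (t N) = blaschke_nodes.K N x (nat (int N + a)) (nat (int N + b))) sequentially"
    using eventually_ge_at_top[of "nat \<bar>a\<bar> + nat \<bar>b\<bar>"]
    by eventually_elim (rule eq[symmetric], auto)
  ultimately show ?thesis by (rule Lim_transform_eventually)
qed

end

subsection \<open>Partitions and point configurations\<close>

definition part_bounded :: "nat \<Rightarrow> (nat \<Rightarrow> nat) set" where
  "part_bounded N = {lam \<in> partitions. \<forall>i\<ge>N. lam i = 0}"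

text \<open>For i < N this is the i-th point of \<open>Xi lam\<close> shifted by N - 1/2 into the
  naturals.\<close>

definition bead :: "nat \<Rightarrow> (nat \<Rightarrow> nat) \<Rightarrow> nat \<Rightarrow> nat" where
  "bead N lam i = lam i + (N - Suc i)"

definition beads :: "nat \<Rightarrow> (nat \<Rightarrow> nat) \<Rightarrow> nat set" where
  "beads N lam = bead N lam ` {..<N}"

lemma partition_antimono: "lam \<in> partitions \<Longrightarrow> i \<le> k \<Longrightarrow> lam k \<le> lam i"
  by (auto simp: partitions_def dest: antimonoD)

lemma part_boundedD: "lam \<in> part_bounded N \<Longrightarrow> lam \<in> partitions" "lam \<in> part_bounded N \<Longrightarrow> N \<le> i \<Longrightarrow> lam i = 0"
  by (auto simp: part_bounded_def)

lemma image_reverse_lessThan: "(\<lambda>i. N - Suc i) ` {..<N} = {..<N}"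
proof
  show "{..<N} \<subseteq> (\<lambda>i. N - Suc i) ` {..<N}"
  proof
    fix i assume "i \<in> {..<N}"
    hence "i = N - Suc (N - Suc i)" "N - Suc i \<in> {..<N}" by auto
    thus "i \<in> (\<lambda>i. N - Suc i) ` {..<N}" by (rule image_eqI)
  qed
qed auto

lemma part_bounded_nonzero_less: "lam \<in> part_bounded N \<Longrightarrow> lam i \<noteq> 0 \<Longrightarrow> i < N"
  using part_boundedD(2)[of lam N i] by (cases "i < N") auto

lemma bead_strict:
  assumes "lam \<in> partitions" "i < k" "k < N"
  shows "bead N lam k < bead N lam i"
  using partition_antimono[OF assms(1), of i k] assms(2,3) by (simp add: bead_def)

lemma inj_on_bead:
  assumes "lam \<in> partitions"
  shows "inj_on (bead N lam) {..<N}"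
proof (rule inj_onI)
  fix i k assume "i \<in> {..<N}" "k \<in> {..<N}" "bead N lam i = bead N lam k"
  thus "i = k" using bead_strict[OF assms, of i k N] bead_strict[OF assms, of k i N]
    by (cases i k rule: linorder_cases) auto
qed

lemma card_beads: "lam \<in> partitions \<Longrightarrow> card (beads N lam) = N"
  by (simp add: beads_def card_image inj_on_bead)

lemma sorted_list_of_beads:
  assumes "lam \<in> partitions"
  shows "sorted_list_of_set (beads N lam) = rev (map (bead N lam) [0..<N])"
proof -
  have "sorted_wrt (<) (rev (map (bead N lam) [0..<N]))"
    by (auto simp: sorted_wrt_iff_nth_less rev_nth intro!: bead_strict[OF assms])
  hence "sorted_list_of_set (set (rev (map (bead N lam) [0..<N]))) = rev (map (bead N lam) [0..<N])"
    by (intro sorted_list_of_set.idem_if_sorted_distinct) (auto simp: strict_sorted_iff)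
  thus ?thesis by (simp add: beads_def atLeast0LessThan)
qed

lemma bij_betw_beads: "bij_betw (beads N) (part_bounded N) {S. finite S \<and> card S = N}"
proof (rule bij_betwI')
  fix lam mu assume *: "lam \<in> part_bounded N" "mu \<in> part_bounded N"
  show "beads N lam = beads N mu \<longleftrightarrow> lam = mu"
  proof
    assume "beads N lam = beads N mu"
    hence "rev (map (bead N lam) [0..<N]) = rev (map (bead N mu) [0..<N])"
      using sorted_list_of_beads * part_boundedD(1) by metis
    hence "bead N lam i = bead N mu i" if "i < N" for i
      using that by (auto simp: map_eq_conv)
    thus "lam = mu" using part_boundedD(2)[OF *(1)] part_boundedD(2)[OF *(2)]
      by (intro ext) (metis bead_def add_right_cancel not_le)
  qed simp
next
  fix lam assume "lam \<in> part_bounded N"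
  thus "beads N lam \<in> {S. finite S \<and> card S = N}"
    by (auto simp: card_beads part_boundedD) (simp add: beads_def)
next
  fix S :: "nat set" assume "S \<in> {S. finite S \<and> card S = N}"
  hence S: "finite S" "card S = N" by auto
  define ys where "ys = sorted_list_of_set S"
  have ys: "sorted_wrt (<) ys" "length ys = N" "set ys = S" using S by (auto simp: ys_def)
  \<comment> \<open>The inverse map lists S decreasingly and subtracts the staircase N - 1, ..., 0.
    An increasing list of naturals satisfies ys ! k >= k, so the subtraction in \<open>lam\<close>
    is exact.\<close>
  define l where "l i = ys ! (N - Suc i)" for i
  define lam where "lam i = (if i < N then l i - (N - Suc i) else 0)" for i
  have ge: "N - Suc i \<le> l i" if "i < N" for i
    unfolding l_def by (rule sorted_wrt_less_idx[OF ys(1)]) (use ys that in auto)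
  have dec: "l (Suc i) < l i" if "Suc i < N" for i
    unfolding l_def by (rule sorted_wrt_nth_less[OF ys(1)]) (use ys that in auto)
  have "lam (Suc i) \<le> lam i" for i
  proof (cases "Suc i < N")
    case True
    thus ?thesis using dec[OF True] ge[of "Suc i"] ge[of i] by (simp add: lam_def)
  qed (simp add: lam_def)
  hence "antimono lam" by (simp add: decseq_Suc_iff)
  moreover have "finite {i. lam i \<noteq> 0}"
    by (rule finite_subset[of _ "{..<N}"]) (auto simp: lam_def split: if_splits)
  ultimately have lam: "lam \<in> part_bounded N"
    by (auto simp: part_bounded_def partitions_def lam_def)
  have "beads N lam = l ` {..<N}"
  proof -
    have "bead N lam i = l i" if "i < N" for i
      using ge[OF that] that by (simp add: bead_def lam_def)
    thus ?thesis by (simp add: beads_def)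
  qed
  also have "\<dots> = (\<lambda>i. ys ! i) ` {..<N}"
  proof -
    have "l ` {..<N} = (\<lambda>i. ys ! i) ` (\<lambda>i. N - Suc i) ` {..<N}" by (simp add: image_image l_def)
    also note image_reverse_lessThan
    finally show ?thesis .
  qed
  also have "\<dots> = S" using ys by (auto simp: set_conv_nth)
  finally show "\<exists>lam\<in>part_bounded N. S = beads N lam" using lam by auto
qed

lemma Xi_iff_beads:
  assumes lam: "lam \<in> part_bounded N" and a: "0 \<le> int N + a"
  shows "of_int a + 1 / 2 \<in> Xi lam \<longleftrightarrow> nat (int N + a) \<in> beads N lam"
proof -
  have "of_int a + 1 / 2 \<in> Xi lam \<longleftrightarrow> (\<exists>i. real_of_int a = of_int (int (lam i) - int (Suc i)))"
    by (auto simp: Xi_def image_iff algebra_simps)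
  also have "\<dots> \<longleftrightarrow> (\<exists>i. a = int (lam i) - int (Suc i))" by (simp only: of_int_eq_iff)
  \<comment> \<open>An index i >= N belongs to a zero part and gives the value -(i + 1), which is
    less than -N and so cannot be a.\<close>
  also have "\<dots> \<longleftrightarrow> (\<exists>i<N. a = int (lam i) - int (Suc i))"
  proof -
    have "i < N" if "a = int (lam i) - int (Suc i)" for i
    proof (rule ccontr)
      assume "\<not> i < N"
      hence "lam i = 0" using part_boundedD(2)[OF lam] by simp
      thus False using that a \<open>\<not> i < N\<close> by simp
    qed
    thus ?thesis by blast
  qed
  also have "\<dots> \<longleftrightarrow> nat (int N + a) \<in> beads N lam"
    using a by (auto simp: beads_def bead_def image_iff of_nat_diff nat_eq_iff)
  finally show ?thesis .
qed

text \<open>The set of rows reaching column j is an initial segment of the naturals, so it consists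
  of the numbers below its cardinality.\<close>

lemma less_ptranspose_iff:
  assumes lam: "lam \<in> partitions"
  shows "k < ptranspose lam j \<longleftrightarrow> j < lam k"
proof -
  define X where "X = {i. j < lam i}"
  have fin: "finite X"
    by (rule finite_subset[of _ "{i. lam i \<noteq> 0}"]) (use lam in \<open>auto simp: X_def partitions_def\<close>)
  have down: "i \<in> X" if "k \<in> X" "i \<le> k" for i k
    using that partition_antimono[OF lam that(2)] by (auto simp: X_def)
  have "j < lam k" if "k < card X"
  proof (rule ccontr)
    assume "\<not> j < lam k"
    hence "X \<subseteq> {..<k}" using down[of _ k] by (auto simp: X_def not_less) (metis X_def down linorder_not_le mem_Collect_eq)
    hence "card X \<le> k" using card_mono[of "{..<k}" X] by simp
    thus False using that by simp
  qed
  moreover have "k < card X" if "j < lam k"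
  proof -
    have "{..k} \<subseteq> X" using that down[of k] by (auto simp: X_def)
    hence "Suc k \<le> card X" using card_mono[OF fin, of "{..k}"] by simp
    thus ?thesis by simp
  qed
  ultimately show ?thesis by (auto simp: ptranspose_def X_def)
qed

lemma cells_part_bounded:
  "lam \<in> part_bounded N \<Longrightarrow> cells lam = Sigma {..<N} (\<lambda>i. {..<lam i})"
  using part_boundedD(2)[of lam N] by (force simp: cells_def not_less[symmetric])

lemma finite_cells: 
  assumes "lam \<in> partitions"
  shows "finite (cells lam)"
proof -
  have "cells lam = Sigma {i. lam i \<noteq> 0} (\<lambda>i. {..<lam i})" by (auto simp: cells_def)
  thus ?thesis using assms by (simp add: partitions_def)
qed

lemma int_hook:
  assumes lam: "lam \<in> partitions" and j: "j < lam i"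
  shows "int (hook lam i j) = int (lam i) + int (ptranspose lam j) - int i - int j - 1"
  using j less_ptranspose_iff[OF lam, of i j] by (simp add: hook_def)

text \<open>In row \<open>i\<close> the hook lengths and the bead differences \<open>bead i - bead k\<close> for \<open>k > i\<close> together
  exhaust \<open>{1..bead i}\<close>.\<close>

lemma hook_row_prod:
  fixes f :: "nat \<Rightarrow> 'a :: comm_monoid_mult"
  assumes lam: "lam \<in> part_bounded N" and i: "i < N"
  shows "(\<Prod>j<lam i. f (hook lam i j)) * (\<Prod>k\<in>{i<..<N}. f (bead N lam i - bead N lam k)) =
         (\<Prod>t\<in>{1..bead N lam i}. f t)"
proof -
  note lamP = part_boundedD(1)[OF lam]
  define A where "A = hook lam i ` {..<lam i}"
  define B where "B = (\<lambda>k. bead N lam i - bead N lam k) ` {i<..<N}"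
  have tr_antimono: "ptranspose lam j' \<le> ptranspose lam j" if "j \<le> j'" for j j'
  proof (rule ccontr)
    assume "\<not> ?thesis"
    hence "j' < lam (ptranspose lam j)"
      using less_ptranspose_iff[OF lamP, of "ptranspose lam j" j'] by simp
    hence "ptranspose lam j < ptranspose lam j"
      using that less_ptranspose_iff[OF lamP, of "ptranspose lam j" j] by simp
    thus False by simp
  qed
  have tr_le: "ptranspose lam j \<le> N" for j
    using less_ptranspose_iff[OF lamP, of N j] part_boundedD(2)[OF lam, of N] by (simp add: not_less)
  have hook_strict: "hook lam i j' < hook lam i j" if "j < j'" "j' < lam i" for j j'
    using int_hook[OF lamP, of j i] int_hook[OF lamP, of j' i] tr_antimono[of j j'] that by simp
  have injA: "inj_on (hook lam i) {..<lam i}"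
  proof (rule inj_onI)
    fix j j' assume "j \<in> {..<lam i}" "j' \<in> {..<lam i}" "hook lam i j = hook lam i j'"
    thus "j = j'" using hook_strict[of j j'] hook_strict[of j' j]
      by (cases j j' rule: linorder_cases) auto
  qed
  have bead_diff: "int (bead N lam i - bead N lam k) = int (lam i) - int (lam k) + int k - int i" if "i < k" "k < N" for k
    using bead_strict[OF lamP that] that by (simp add: bead_def of_nat_diff)
  have injB: "inj_on (\<lambda>k. bead N lam i - bead N lam k) {i<..<N}"
  proof (rule inj_onI)
    fix k k' assume k: "k \<in> {i<..<N}" "k' \<in> {i<..<N}"
      "bead N lam i - bead N lam k = bead N lam i - bead N lam k'"
    hence "bead N lam k = bead N lam k'"
      using bead_strict[OF lamP, of i k N] bead_strict[OF lamP, of i k' N] by auto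
    thus "k = k'" using k inj_on_bead[OF lamP, of N] by (auto simp: inj_on_def)
  qed
  \<comment> \<open>Equality would mean \<open>ptranspose lam j\<close> - k = j + 1 -
    \<open>lam k\<close> over the integers. The left side is positive exactly if (k, j) is a cell,
    and the right side exactly if it is not.\<close>
  have disj: "A \<inter> B = {}"
  proof -
    have "hook lam i j \<noteq> bead N lam i - bead N lam k" if "j < lam i" "i < k" "k < N" for j k
    proof
      assume "hook lam i j = bead N lam i - bead N lam k"
      hence "int (ptranspose lam j) - int j - 1 = int k - int (lam k)"
        using int_hook[OF lamP that(1)] bead_diff[OF that(2,3)] by linarith
      thus False using less_ptranspose_iff[OF lamP, of k j] by (cases "j < lam k") auto
    qed
    thus ?thesis by (auto simp: A_def B_def)
  qed
  have sub: "A \<union> B \<subseteq> {1..bead N lam i}"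
  proof -
    have "1 \<le> hook lam i j \<and> hook lam i j \<le> bead N lam i" if "j < lam i" for j
      using int_hook[OF lamP that] tr_le[of j] less_ptranspose_iff[OF lamP, of i j] that i
      by (simp add: bead_def)
    moreover have "1 \<le> bead N lam i - bead N lam k \<and> bead N lam i - bead N lam k \<le> bead N lam i"
      if "i < k" "k < N" for k
      using bead_strict[OF lamP that] by simp
    ultimately show ?thesis by (auto simp: A_def B_def)
  qed
  \<comment> \<open>The number lam i + (N - 1 - i) of elements is the length of the interval, so the
    inclusion is an equality.\<close>
  have "card (A \<union> B) = lam i + (N - Suc i)"
    using disj by (subst card_Un_disjoint) (auto simp: A_def B_def card_image injA injB)
  hence "A \<union> B = {1..bead N lam i}"
    using sub by (intro card_subset_eq) (auto simp: bead_def)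
  hence "(\<Prod>t\<in>{1..bead N lam i}. f t) = (\<Prod>t\<in>A. f t) * (\<Prod>t\<in>B. f t)"
    using disj prod.union_disjoint[of A B f] by (simp add: A_def B_def)
  also have "(\<Prod>t\<in>A. f t) = (\<Prod>j<lam i. f (hook lam i j))"
    unfolding A_def by (subst prod.reindex[OF injA]) simp
  also have "(\<Prod>t\<in>B. f t) = (\<Prod>k\<in>{i<..<N}. f (bead N lam i - bead N lam k))"
    unfolding B_def by (subst prod.reindex[OF injB]) simp
  finally show ?thesis by simp
qed

text \<open>With f t = 1 - q^t this trades the hook product of the weight for a product over bead
  differences, that is, for a Vandermonde product.\<close>

lemma hook_prod:
  fixes f :: "nat \<Rightarrow> 'a :: comm_monoid_mult"
  assumes lam: "lam \<in> part_bounded N"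
  shows "(\<Prod>(i, j)\<in>cells lam. f (hook lam i j)) * (\<Prod>k<N. \<Prod>i<k. f (bead N lam i - bead N lam k)) =
         (\<Prod>i<N. \<Prod>t\<in>{1..bead N lam i}. f t)"
proof -
  have "(\<Prod>(i, j)\<in>cells lam. f (hook lam i j)) = (\<Prod>i<N. \<Prod>j<lam i. f (hook lam i j))"
    unfolding cells_part_bounded[OF lam] by (simp add: prod.Sigma)
  moreover have "(\<Prod>k<N. \<Prod>i<k. f (bead N lam i - bead N lam k)) =
      (\<Prod>i<N. \<Prod>k\<in>{i<..<N}. f (bead N lam i - bead N lam k))"
  proof -
    have "(\<Prod>k<N. \<Prod>i<k. f (bead N lam i - bead N lam k)) =
        (\<Prod>(k, i)\<in>Sigma {..<N} (\<lambda>k. {..<k}). f (bead N lam i - bead N lam k))"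
      by (simp add: prod.Sigma)
    also have "\<dots> = (\<Prod>(i, k)\<in>Sigma {..<N} (\<lambda>i. {i<..<N}). f (bead N lam i - bead N lam k))"
      by (rule prod.reindex_bij_witness[of _ "\<lambda>(i, k). (k, i)" "\<lambda>(k, i). (i, k)"]) auto
    finally show ?thesis by (simp add: prod.Sigma)
  qed
  ultimately show ?thesis
    using hook_row_prod[OF lam, of _ f] by (simp flip: prod.distrib)
qed

lemma psize_part_bounded: "lam \<in> part_bounded N \<Longrightarrow> psize lam = (\<Sum>i<N. lam i)"
  unfolding psize_def
  by (intro sum.mono_neutral_left) (use part_bounded_nonzero_less in auto)

lemma pb_part_bounded: "lam \<in> part_bounded N \<Longrightarrow> pb lam = (\<Sum>i<N. i * lam i)"
  unfolding pb_def
  by (intro sum.mono_neutral_left) (use part_bounded_nonzero_less in auto)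

lemma zero_part_bounded: "(\<lambda>_. 0) \<in> part_bounded N"
  by (auto simp: part_bounded_def partitions_def monotone_def)

lemma beads_zero: "beads N (\<lambda>_. 0) = {..<N}"
  by (simp add: beads_def bead_def[abs_def] image_reverse_lessThan)

subsection \<open>Truncated measures and their limit\<close>

lemma nn_integral_count_space_has_sum:
  fixes f :: "'a \<Rightarrow> real"
  assumes "(f has_sum s) A" "\<And>x. x \<in> A \<Longrightarrow> 0 \<le> f x"
  shows "(\<integral>\<^sup>+ x. ennreal (f x) \<partial>count_space A) = ennreal s"
proof -
  have "Infinite_Sum.abs_summable_on f A"
    by (rule summable_on_iff_abs_summable_on_real[THEN iffD1, OF has_sum_imp_summable[OF assms(1)]])
  hence s: "Infinite_Set_Sum.abs_summable_on f A" by (rule abs_summable_equivalent[THEN iffD1])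
  have "(\<integral>\<^sup>+ x. ennreal (f x) \<partial>count_space A) = ennreal (infsetsum f A)"
    using nn_integral_conv_infsetsum[OF s] assms(2) by simp
  also have "infsetsum f A = s"
    using infsetsum_infsum[OF s] infsumI[OF assms(1)] by simp
  finally show ?thesis .
qed

lemma tendsto_det:
  fixes f :: "'a \<Rightarrow> nat \<Rightarrow> nat \<Rightarrow> real"
  assumes "\<And>i j. i < n \<Longrightarrow> j < n \<Longrightarrow> ((\<lambda>t. f t i j) \<longlongrightarrow> g i j) F"
  shows "((\<lambda>t. Determinant.det (Matrix.mat n n (\<lambda>(i, j). f t i j))) \<longlongrightarrow>
          Determinant.det (Matrix.mat n n (\<lambda>(i, j). g i j))) F"
proof -
  have eq: "Determinant.det (Matrix.mat n n (\<lambda>(i, j). h i j)) =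
      (\<Sum>\<pi> | \<pi> permutes {0..<n}. signof \<pi> * (\<Prod>i = 0..<n. h i (\<pi> i)))" for h :: "nat \<Rightarrow> nat \<Rightarrow> real"
    by (subst det_def'[of _ n])
       (auto intro!: sum.cong prod.cong simp: permutes_in_image[where S = "{0..<n}", simplified])
  show ?thesis unfolding eq
  proof (intro tendsto_sum tendsto_mult tendsto_const tendsto_prod assms)
    fix \<pi> i assume "\<pi> \<in> {\<pi>. \<pi> permutes {0..<n}}" "i \<in> {0..<n}"
    thus "i < n" "\<pi> i < n" using permutes_in_image[of \<pi> "{0..<n}" i] by auto
  qed
qed

lemma prod_antimono_set:
  fixes f :: "'a \<Rightarrow> real"
  assumes "finite T" "S \<subseteq> T" "\<And>t. t \<in> T \<Longrightarrow> 0 \<le> f t \<and> f t \<le> 1"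
  shows "prod f T \<le> prod f S"
proof -
  have "prod f T = prod f (T - S) * prod f S"
    using assms(1,2) by (rule prod.subset_diff[rotated])
  also have "\<dots> \<le> 1 * prod f S"
    using assms by (intro mult_right_mono prod_le_1 prod_nonneg) auto
  finally show ?thesis by simp
qed

lemma prod_off_diagonal:
  fixes g :: "nat \<Rightarrow> nat \<Rightarrow> 'a :: comm_monoid_mult"
  shows "(\<Prod>i<N. \<Prod>k\<in>{..<N} - {i}. g i k) = (\<Prod>j<N. \<Prod>i<j. g i j * g j i)"
proof (induction N)
  case (Suc N)
  have "(\<Prod>k\<in>{..<Suc N} - {i}. g i k) = (\<Prod>k\<in>{..<N} - {i}. g i k) * g i N" if "i < N" for i
  proof -
    have "{..<Suc N} - {i} = insert N ({..<N} - {i})" using that by auto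
    thus ?thesis by (simp add: mult.commute)
  qed
  moreover have "{..<Suc N} - {N} = {..<N}" by auto
  ultimately show ?case by (simp add: Suc.IH prod.distrib mult_ac)
qed simp

context q_bessel
begin

definition W :: "(nat \<Rightarrow> nat) \<Rightarrow> real" where
  "W lam = (\<xi>\<^sup>2 * q) ^ psize lam * q ^ (2 * pb lam) * (\<Prod>(i, j)\<in>cells lam. 1 / (1 - q ^ hook lam i j)\<^sup>2)"

lemma qPP_weight_eq: "qPP_weight \<xi> q lam = inverse (qPP_norm \<xi> q) * W lam"
  by (simp add: qPP_weight_def W_def mult.assoc)

lemma W_nonneg: "0 \<le> W lam"
  unfolding W_def using q_nonneg by (intro mult_nonneg_nonneg prod_nonneg) auto

text \<open>The product of all 1 - x_i x_k, because x_i x_k = \<xi>^2 q^(i+k+1); by Cauchy's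
  identity its reciprocal is the total mass of the truncated weights.\<close>

definition M_fin :: "nat \<Rightarrow> real" where
  "M_fin N = (\<Prod>i<N. \<Prod>k<N. 1 - \<xi>\<^sup>2 * q ^ Suc (i + k))"

lemma \<xi>2q_bounds: "0 \<le> \<xi>\<^sup>2 * q ^ Suc n" "\<xi>\<^sup>2 * q ^ Suc n < 1"
proof -
  have "\<xi>\<^sup>2 * q ^ Suc n \<le> 1 * q ^ Suc n"
    using \<xi>_nonneg \<xi>_lt_1 q_nonneg by (intro mult_right_mono) (auto simp: power_le_one)
  thus "\<xi>\<^sup>2 * q ^ Suc n < 1" using q_Suc_lt_1[of n] by simp
qed (use q_nonneg in auto)

lemma M_fin_pos: "0 < M_fin N"
  unfolding M_fin_def using \<xi>2q_bounds by (intro prod_pos) (auto simp del: power_Suc)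

text \<open>The factor 1 - \<xi>^2 q^(n+1) has multiplicity n + 1, the number of pairs with i + k =
  n. Partial products thus run over triangles i + k < n, and \<open>M_fin n\<close> over a square
  lying between the triangles of sizes n and 2n. As all factors lie in [0, 1], the products are
  squeezed.\<close>

lemma M_fin_tendsto: "M_fin \<longlonglongrightarrow> inverse (qPP_norm \<xi> q)" and qPP_norm_pos: "0 < qPP_norm \<xi> q"
proof -
  define a where "a n = (1 - \<xi>\<^sup>2 * q ^ Suc n) ^ Suc n" for n
  have a: "0 < a n" "a n \<le> 1" for n
    unfolding a_def using \<xi>2q_bounds[of n] by (auto intro!: power_le_one simp del: power_Suc)
  have sum: "summable (\<lambda>n. norm (a n - 1))"
  proof (rule summable_comparison_test')
    show "summable (\<lambda>n. of_nat (Suc n) * q ^ Suc n)"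
    proof -
      have "summable (\<lambda>n. (of_nat (Suc n) * q ^ n) * q)"
        using geometric_deriv_sums[of q] q_nonneg q_lt_1 by (intro summable_mult2) (auto simp: sums_iff)
      thus ?thesis by (simp add: mult_ac)
    qed
    fix n :: nat assume "0 \<le> n"
    have "1 + real (Suc n) * (- (\<xi>\<^sup>2 * q ^ Suc n)) \<le> (1 + - (\<xi>\<^sup>2 * q ^ Suc n)) ^ Suc n"
      using \<xi>2q_bounds[of n] by (intro Bernoulli_inequality) (auto simp del: power_Suc)
    hence "1 - a n \<le> real (Suc n) * (\<xi>\<^sup>2 * q ^ Suc n)" by (simp add: a_def del: power_Suc)
    also have "\<dots> \<le> real (Suc n) * (1 * q ^ Suc n)"
      using \<xi>_nonneg \<xi>_lt_1 q_nonneg by (intro mult_left_mono mult_right_mono) (auto simp: power_le_one)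
    finally show "norm (norm (a n - 1)) \<le> of_nat (Suc n) * q ^ Suc n" using a[of n] by simp
  qed
  hence conv: "convergent_prod a"
    by (intro abs_convergent_prod_imp_convergent_prod summable_imp_abs_convergent_prod)
  have nz: "prodinf a \<noteq> 0" by (rule prodinf_nonzero[OF conv]) (metis a(1) less_irrefl)
  have lim0: "(\<lambda>n. \<Prod>i<n. a i) \<longlonglongrightarrow> prodinf a"
    using convergent_prod_LIMSEQ[OF conv] unfolding lessThan_Suc_atMost[symmetric] by (rule LIMSEQ_imp_Suc)
  have "0 \<le> prodinf a"
    by (rule LIMSEQ_le_const[OF lim0]) (intro exI allI impI prod_nonneg less_imp_le a(1))
  hence pos: "0 < prodinf a" using nz by simp
  have "qPP_norm \<xi> q = (\<Prod>n. inverse (a n))"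
    by (simp add: qPP_norm_def a_def field_simps)
  also have "\<dots> = inverse (prodinf a)"
    by (rule prodinf_inverse[OF conv])
  finally have norm: "qPP_norm \<xi> q = inverse (prodinf a)" .
  show "0 < qPP_norm \<xi> q" using pos by (simp add: norm)
  let ?g = "\<lambda>(i, k). 1 - \<xi>\<^sup>2 * q ^ Suc (i + k)"
  have g: "0 \<le> ?g t \<and> ?g t \<le> 1" for t
    using \<xi>2q_bounds[of "fst t + snd t"] by (auto simp: case_prod_unfold simp del: power_Suc)
  have tri: "(\<Prod>i<n. a i) = prod ?g {(i, k). i + k < n}" for n
    by (subst prod.triangle_reindex) (simp add: a_def del: power_Suc)
  have fin: "finite {(i, k). i + k < (n :: nat)}" for n
    by (rule finite_subset[of _ "{..<n} \<times> {..<n}"]) auto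
  have M: "M_fin n = prod ?g ({..<n} \<times> {..<n})" for n
    by (simp add: M_fin_def prod.cartesian_product)
  have "(\<lambda>n. \<Prod>i<2 * n. a i) \<longlonglongrightarrow> prodinf a"
    using LIMSEQ_subseq_LIMSEQ[OF lim0, of "\<lambda>n. 2 * n"] by (simp add: strict_mono_def o_def)
  moreover have "(\<Prod>i<2 * n. a i) \<le> M_fin n" for n
    unfolding tri M by (rule prod_antimono_set[OF fin _ g]) auto
  moreover have "M_fin n \<le> (\<Prod>i<n. a i)" for n
    unfolding tri M by (rule prod_antimono_set[OF _ _ g]) auto
  ultimately have "M_fin \<longlonglongrightarrow> prodinf a"
    using tendsto_sandwich[OF always_eventually always_eventually _ lim0, of "\<lambda>n. \<Prod>i<2 * n. a i" M_fin]
    by blast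
  thus "M_fin \<longlonglongrightarrow> inverse (qPP_norm \<xi> q)" by (simp add: norm)
qed

text \<open>The ratio of the Schur function in the variables $x_0, \ldots, x_{N-1}$ to its limit. If the
  partition has more than \<open>N\<close> parts, the truncated difference \<open>N - i\<close> at the cell \<open>(N, 0)\<close> is 0, so
  the product vanishes, as it should.\<close>

definition R :: "nat \<Rightarrow> (nat \<Rightarrow> nat) \<Rightarrow> real" where
  "R N lam = (\<Prod>(i, j)\<in>cells lam. 1 - q ^ (N - i + j))"

lemma R_nonneg: "0 \<le> R N lam"
  unfolding R_def using q_pow_le_1 by (auto intro!: prod_nonneg)

lemma R_mono: "N \<le> N' \<Longrightarrow> R N lam \<le> R N' lam"
  unfolding R_def using q_pow_le_1 q_nonneg q_lt_1
  by (auto intro!: prod_mono power_decreasing)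

lemma R_eq_0:
  assumes "lam \<in> partitions" "lam \<notin> part_bounded N"
  shows "R N lam = 0"
proof -
  obtain i where "N \<le> i" "lam i \<noteq> 0" using assms by (auto simp: part_bounded_def)
  thus ?thesis unfolding R_def
    by (intro prod_zero finite_cells[OF assms(1)] bexI[of _ "(i, 0)"]) (auto simp: cells_def)
qed

lemma R_tendsto: "(\<lambda>N. R N lam) \<longlonglongrightarrow> 1"
proof -
  have "(\<lambda>N. q ^ (N - i + j)) \<longlonglongrightarrow> 0" for i j
    by (rule LIMSEQ_offset[where k = i])
       (use q_nonneg q_lt_1 in \<open>auto intro!: LIMSEQ_ignore_initial_segment LIMSEQ_power_zero\<close>)
  hence "(\<lambda>N. R N lam) \<longlonglongrightarrow> (\<Prod>(i, j)\<in>cells lam. 1 - 0)"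
    unfolding R_def case_prod_unfold by (intro tendsto_prod tendsto_diff tendsto_const)
  thus ?thesis by (simp add: case_prod_unfold)
qed

text \<open>In row i the exponents up to N - 1 - i are those of the empty partition, and the
  remaining lam i ones form row i of \<open>R\<close>. So \<open>R\<close> is the ratio of the right
  sides of \<open>hook_prod\<close> for lam and for the empty partition.\<close>

lemma prod_R:
  assumes "lam \<in> part_bounded N"
  shows "(\<Prod>i<N. \<Prod>t\<in>{1..bead N lam i}. 1 - q ^ t) = R N lam * (\<Prod>i<N. \<Prod>t\<in>{1..N - Suc i}. 1 - q ^ t)"
proof -
  have step: "(\<Prod>t\<in>{1..l + m}. 1 - q ^ t) = (\<Prod>j<l. 1 - q ^ (Suc m + j)) * (\<Prod>t\<in>{1..m}. 1 - q ^ t)" for l m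
      proof (induction l)
    case (Suc l)
    have "(\<Prod>t\<in>{1..Suc l + m}. 1 - q ^ t) = (1 - q ^ (Suc m + l)) * (\<Prod>t\<in>{1..l + m}. 1 - q ^ t)"
      by (simp add: add.commute)
    thus ?case by (simp only: Suc.IH prod.lessThan_Suc mult_ac)
  qed simp
  have "R N lam = (\<Prod>i<N. \<Prod>j<lam i. 1 - q ^ (N - i + j))"
    unfolding R_def cells_part_bounded[OF assms] by (rule prod.Sigma[symmetric]) auto
  also have "\<dots> = (\<Prod>i<N. \<Prod>j<lam i. 1 - q ^ (Suc (N - Suc i) + j))"
    by (intro prod.cong refl) (simp add: Suc_diff_Suc)
  finally show ?thesis unfolding bead_def step by (simp add: prod.distrib)
qed

end

section \<open>Ratios of alternants and the truncated measures\<close>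

context q_bessel_pos
begin

text \<open>The nodes form a geometric progression, so x_j^(l_i) = (\<xi> p)^(l_i) (q^(l_i))^j: up
  to row factors the alternant is a Vandermonde matrix in the q^(l_i).\<close>

lemma vandermonde_beads:
  "Determinant.det (Matrix.mat N N (\<lambda>(i, j). x j ^ (map l [0..<N] ! i))) =
     (\<Prod>i<N. (\<xi> * p) ^ l i) * (\<Prod>j<N. \<Prod>i<j. q ^ l j - q ^ l i)"
proof -
  define V where "V = Matrix.mat N N (\<lambda>(i, j). (q ^ l i) ^ j)"
  have V: "V \<in> carrier_mat N N" by (simp add: V_def)
  have "Matrix.mat N N (\<lambda>(i, j). x j ^ (map l [0..<N] ! i)) = mat_diag N (\<lambda>i. (\<xi> * p) ^ l i) * V"
    unfolding mat_diag_mult_left[OF V]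
    by (rule eq_matI) (auto simp: V_def x_def power_mult_distrib mult.commute simp flip: power_mult)
  also have "Determinant.det \<dots> = Determinant.det (mat_diag N (\<lambda>i. (\<xi> * p) ^ l i)) * Determinant.det V"
    by (rule det_mult[OF _ V]) simp
  also have "Determinant.det (mat_diag N (\<lambda>i. (\<xi> * p) ^ l i)) = (\<Prod>i<N. (\<xi> * p) ^ l i)"
    by (subst det_upper_triangular[of _ N])
       (auto simp: mat_diag_def prod_list_diag_prod upper_triangular_def atLeast0LessThan)
  also have "Determinant.det V = (\<Prod>j<N. \<Prod>i<j. q ^ l j - q ^ l i)"
    unfolding V_def by (rule det_vandermonde)
  finally show ?thesis .
qed

text \<open>By the bialternant formula, D lam / D 0 is the Schur function in x_0, ..., x_(N-1); the
  hook identity rewrites its square as the weight times a correction.\<close>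

lemma vandermonde_part_bounded:
  assumes lam: "lam \<in> part_bounded N"
  defines "D \<equiv> \<lambda>lam. Determinant.det (Matrix.mat N N (\<lambda>(i, j). x j ^ (map (bead N lam) [0..<N] ! i)))"
  shows "(D lam)\<^sup>2 = W lam * (R N lam)\<^sup>2 * (D (\<lambda>_. 0))\<^sup>2"
proof -
  note lamP = part_boundedD(1)[OF lam]
  define Q where "Q lam = (\<Prod>k<N. \<Prod>i<k. 1 - q ^ (bead N lam i - bead N lam k))" for lam
  \<comment> \<open>The contribution of the staircase N - 1 - i, the same for every partition and
    therefore absorbed into D 0.\<close>
  define c where "c = (\<Prod>i<N. (\<xi> * p) ^ (N - Suc i)) * (\<Prod>k<N. q ^ (k * (N - Suc k)))"
  define H where "H = (\<Prod>(i, j)\<in>cells lam. 1 - q ^ hook lam i j)"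
  have D: "D mu = (\<xi> * p) ^ psize mu * q ^ pb mu * c * Q mu" if mu: "mu \<in> part_bounded N" for mu
  proof -
    have "(\<Prod>j<N. \<Prod>i<j. q ^ bead N mu j - q ^ bead N mu i) =
        (\<Prod>k<N. \<Prod>i<k. q ^ bead N mu k * (1 - q ^ (bead N mu i - bead N mu k)))"
    proof (intro prod.cong refl)
      fix k i assume "k \<in> {..<N}" "i \<in> {..<k}"
      hence "bead N mu k < bead N mu i" using bead_strict[OF part_boundedD(1)[OF mu]] by auto
      thus "q ^ bead N mu k - q ^ bead N mu i = q ^ bead N mu k * (1 - q ^ (bead N mu i - bead N mu k))"
        by (simp add: right_diff_distrib flip: power_add)
    qed
    also have "\<dots> = (\<Prod>k<N. q ^ (k * bead N mu k)) * Q mu"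
      by (simp add: Q_def prod.distrib power_mult[symmetric] mult.commute)
    also have "(\<Prod>k<N. q ^ (k * bead N mu k)) = (\<Prod>k<N. q ^ (k * mu k)) * (\<Prod>k<N. q ^ (k * (N - Suc k)))"
      by (simp only: bead_def distrib_left power_add prod.distrib)
    also have "(\<Prod>k<N. q ^ (k * mu k)) = q ^ pb mu"
      by (simp add: pb_part_bounded[OF mu] power_sum)
    finally have 1: "(\<Prod>j<N. \<Prod>i<j. q ^ bead N mu j - q ^ bead N mu i) =
      q ^ pb mu * (\<Prod>k<N. q ^ (k * (N - Suc k))) * Q mu" .
    have "(\<Prod>i<N. (\<xi> * p) ^ bead N mu i) = (\<Prod>i<N. (\<xi> * p) ^ mu i) * (\<Prod>i<N. (\<xi> * p) ^ (N - Suc i))"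
      unfolding bead_def power_add prod.distrib ..
    also have "(\<Prod>i<N. (\<xi> * p) ^ mu i) = (\<xi> * p) ^ psize mu"
      by (simp add: psize_part_bounded[OF mu] power_sum)
    finally show ?thesis unfolding D_def vandermonde_beads 1 c_def by (simp add: mult_ac)
  qed
  have zero: "psize (\<lambda>_. 0) = 0" "pb (\<lambda>_. 0) = 0" "cells (\<lambda>_. 0) = {}"
    by (auto simp: psize_def pb_def cells_def)
  \<comment> \<open>The hook identity for lam against that for the empty partition, whose hook
    product is 1.\<close>
  have HQ: "H * Q lam = R N lam * Q (\<lambda>_. 0)"
    using hook_prod[OF lam, of "\<lambda>t. 1 - q ^ t"] hook_prod[OF zero_part_bounded[of N], of "\<lambda>t. 1 - q ^ t"]
    unfolding prod_R[OF lam] H_def Q_def zero by (simp add: bead_def)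
  have "H \<noteq> 0"
  proof -
    have "1 - q ^ hook lam i j \<noteq> 0" if "(i, j) \<in> cells lam" for i j
    proof -
      have "0 < hook lam i j" using int_hook[OF lamP, of j i] less_ptranspose_iff[OF lamP, of i j] that
        by (auto simp: cells_def)
      thus ?thesis using one_minus_q_Suc(2)[of "hook lam i j - 1"] by simp
    qed
    thus ?thesis unfolding H_def using finite_cells[OF lamP] by (auto simp: prod_zero_iff)
  qed
  hence "Q lam = R N lam * Q (\<lambda>_. 0) / H" using HQ by (simp add: field_simps)
  hence "(D lam)\<^sup>2 = ((\<xi> * p) ^ psize lam)\<^sup>2 * (q ^ pb lam)\<^sup>2 * (1 / H\<^sup>2) * (R N lam)\<^sup>2 * (c * Q (\<lambda>_. 0))\<^sup>2"
    unfolding D[OF lam] by (simp add: power_mult_distrib power_divide)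
  also have "(q ^ pb lam)\<^sup>2 = q ^ (2 * pb lam)" by (rule power_even_eq[symmetric])
  also have "((\<xi> * p) ^ psize lam)\<^sup>2 = (\<xi>\<^sup>2 * q) ^ psize lam"
  proof -
    have "((\<xi> * p) ^ psize lam)\<^sup>2 = ((\<xi> * p)\<^sup>2) ^ psize lam"
      unfolding power_even_eq[symmetric] by (rule power_mult)
    also have "(\<xi> * p)\<^sup>2 = \<xi>\<^sup>2 * (p * p)"
      by (simp add: power2_eq_square)
    also note p_squared
    finally show ?thesis .
  qed
  also have "1 / H\<^sup>2 = (\<Prod>(i, j)\<in>cells lam. 1 / (1 - q ^ hook lam i j)\<^sup>2)"
    by (simp add: H_def case_prod_unfold prod_dividef prod_power_distrib)
  also have "c * Q (\<lambda>_. 0) = D (\<lambda>_. 0)" by (simp add: D[OF zero_part_bounded] zero)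
  finally show ?thesis by (simp add: W_def)
qed

lemma kdet_set_beads:
  assumes lam: "lam \<in> part_bounded N"
  shows "kdet_set (blaschke_nodes.K N x) (beads N lam) =
    W lam * (R N lam)\<^sup>2 * kdet_set (blaschke_nodes.K N x) {..<N}"
proof -
  interpret blaschke_nodes N x by (rule blaschke_nodes_x)
  have *: "kdet_set K (beads N mu) = kdet K (map (bead N mu) [0..<N])" if "mu \<in> part_bounded N" for mu
  proof -
    have "distinct (map (bead N mu) [0..<N])"
      using inj_on_bead[OF part_boundedD(1)[OF that], of N] by (simp add: distinct_map atLeast0LessThan)
    thus ?thesis by (simp add: kdet_eq_kdet_set beads_def atLeast0LessThan)
  qed
  show ?thesis
    using vandermonde_part_bounded[OF lam]
    by (simp add: *[OF lam] *[OF zero_part_bounded] kdet_K mult_ac flip: beads_zero)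
qed

text \<open>In the product of the w_i the pairs (i, k) and (k, i) combine to -(x_i - x_k)^2, so the
  denominator cancels the squared alternant up to sign. Only the absolute value is available, since
  \<delta> is known through its square.\<close>

lemma abs_kdet_set_lessThan: "\<bar>kdet_set (blaschke_nodes.K N x) {..<N}\<bar> = M_fin N"
proof -
  interpret blaschke_nodes N x by (rule blaschke_nodes_x)
  define V where "V = (\<Prod>j<N. \<Prod>i<j. x j - x i)"
  have "kdet_set K {..<N} = kdet K [0..<N]"
    using kdet_eq_kdet_set[of "[0..<N]" K] by (simp add: atLeast0LessThan)
  also have "\<dots> = (Determinant.det (Matrix.mat N N (\<lambda>(i, j). x j ^ ([0..<N] ! i))))\<^sup>2 * \<delta>"
    by (rule kdet_K) simp
  also have "Determinant.det (Matrix.mat N N (\<lambda>(i, j). x j ^ ([0..<N] ! i))) = V"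
  proof -
    define E where "E = Matrix.mat N N (\<lambda>(i, j). x i ^ j)"
    have "Matrix.mat N N (\<lambda>(i, j). x j ^ ([0..<N] ! i)) = transpose_mat E"
      by (rule eq_matI) (auto simp: E_def)
    moreover have "Determinant.det (transpose_mat E) = Determinant.det E"
      by (rule det_transpose[of _ N]) (simp add: E_def)
    ultimately show ?thesis by (simp add: E_def det_vandermonde V_def)
  qed
  finally have 1: "\<bar>kdet_set K {..<N}\<bar> = V\<^sup>2 * \<bar>\<delta>\<bar>" by (simp add: abs_mult)
  have V0: "V \<noteq> 0" unfolding V_def using x_neq by (auto simp: prod_zero_iff)
  have "\<bar>\<delta>\<bar> = \<bar>\<Prod>i<N. w i\<bar>" using \<delta>_squared by (simp add: power2_eq_iff abs_eq_iff)
  also have "(\<Prod>i<N. w i) = (\<Prod>i<N. \<Prod>k<N. 1 - x i * x k) / (\<Prod>i<N. \<Prod>k\<in>{..<N} - {i}. x i - x k)"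
    by (simp add: w_def prod_dividef)
  also have "(\<Prod>i<N. \<Prod>k<N. 1 - x i * x k) = M_fin N"
  proof -
    have "x i * x k = \<xi>\<^sup>2 * (p * p) * q ^ (i + k)" for i k
      by (simp add: x_def power2_eq_square power_add mult_ac)
    thus ?thesis by (simp add: M_fin_def p_squared mult_ac)
  qed
  also have "(\<Prod>i<N. \<Prod>k\<in>{..<N} - {i}. x i - x k) = (\<Prod>j<N. \<Prod>i<j. - ((x j - x i)\<^sup>2))"
    unfolding prod_off_diagonal by (intro prod.cong refl) (simp add: power2_eq_square algebra_simps)
  also have "\<bar>M_fin N / (\<Prod>j<N. \<Prod>i<j. - ((x j - x i)\<^sup>2))\<bar> = M_fin N / V\<^sup>2"
    using M_fin_pos[of N] by (simp add: V_def abs_prod prod_power_distrib less_imp_le)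
  finally have "\<bar>\<delta>\<bar> = M_fin N / V\<^sup>2" .
  thus ?thesis using 1 V0 by simp
qed

text \<open>Every N-point determinant is a nonnegative multiple of \<kappa>. Multiplication by its
  sign makes all of them nonnegative, so the summation over supersets applies before that sign is
  known.\<close>

lemma kdet_set_lessThan: "kdet_set (blaschke_nodes.K N x) {..<N} = M_fin N"
  and has_sum_kdet_set: "finite A \<Longrightarrow> card A \<le> N \<Longrightarrow>
    (kdet_set (blaschke_nodes.K N x) has_sum kdet_set (blaschke_nodes.K N x) A)
      {S. finite S \<and> card S = N \<and> A \<subseteq> S}"
proof -
  interpret blaschke_nodes N x by (rule blaschke_nodes_x)
  define \<kappa> where "\<kappa> = kdet_set K {..<N}"
  have \<kappa>: "\<bar>\<kappa>\<bar> = M_fin N" using abs_kdet_set_lessThan by (simp add: \<kappa>_def)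
  define s where "s = sgn \<kappa>"
  have nonneg: "0 \<le> s * kdet_set K S" if S: "finite S" "card S = N" for S
  proof -
    obtain lam where "lam \<in> part_bounded N" "S = beads N lam"
      using bij_betw_imp_surj_on[OF bij_betw_beads[of N]] S by blast
    hence "s * kdet_set K S = W lam * (R N lam)\<^sup>2 * \<bar>\<kappa>\<bar>"
      by (simp add: kdet_set_beads s_def \<kappa>_def[symmetric] abs_sgn mult_ac)
    thus ?thesis using W_nonneg by simp
  qed
  have sum: "((\<lambda>S. s * kdet_set K S) has_sum s * kdet_set K A) {S. finite S \<and> card S = N \<and> A \<subseteq> S}"
    if "finite A" "card A \<le> N" for A
    by (rule has_sum_kdet_set_supersets[OF has_sum_K_K has_sum_K_trace nonneg that])
  \<comment> \<open>the total mass \<open>kdet_set K {} = 1\<close> determines the sign of \<open>\<kappa>\<close>\<close>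
  have "0 \<le> s * kdet_set K {}"
    by (rule has_sum_nonneg[OF sum[of "{}"]]) (simp, simp, rule nonneg, simp_all)
  hence "0 \<le> s" by (simp add: kdet_set_def)
  hence s: "s = 1" using \<kappa> M_fin_pos[of N] by (auto simp: s_def sgn_if split: if_splits)
  thus "kdet_set K {..<N} = M_fin N" using \<kappa> by (simp add: \<kappa>_def s_def sgn_if split: if_splits)
  show "(kdet_set K has_sum kdet_set K A) {S. finite S \<and> card S = N \<and> A \<subseteq> S}"
    if "finite A" "card A \<le> N"
    using sum[OF that] by (simp add: s)
qed

lemma has_sum_weights:
  assumes A: "finite A" "card A \<le> N"
  shows "((\<lambda>lam. W lam * (R N lam)\<^sup>2) has_sum kdet_set (blaschke_nodes.K N x) A / M_fin N)
    {lam \<in> part_bounded N. A \<subseteq> beads N lam}"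
proof -
  let ?K = "blaschke_nodes.K N x"
  have "bij_betw (beads N) {lam \<in> part_bounded N. A \<subseteq> beads N lam} {S. finite S \<and> card S = N \<and> A \<subseteq> S}"
  proof (rule bij_betw_subset[OF bij_betw_beads])
    have "beads N ` {lam \<in> part_bounded N. A \<subseteq> beads N lam} = {S \<in> beads N ` part_bounded N. A \<subseteq> S}"
      by blast
    also have "\<dots> = {S. finite S \<and> card S = N \<and> A \<subseteq> S}"
      unfolding bij_betw_imp_surj_on[OF bij_betw_beads[of N]] by simp
    finally show "beads N ` {lam \<in> part_bounded N. A \<subseteq> beads N lam} =
      {S. finite S \<and> card S = N \<and> A \<subseteq> S}" .
  qed auto
  from has_sum_reindex_bij_betw[OF this, of "kdet_set ?K" "kdet_set ?K A"]
  have "((\<lambda>lam. kdet_set ?K (beads N lam)) has_sum kdet_set ?K A) {lam \<in> part_bounded N. A \<subseteq> beads N lam}"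
    using has_sum_kdet_set[OF A] by simp
  hence "((\<lambda>lam. W lam * (R N lam)\<^sup>2 * M_fin N) has_sum kdet_set ?K A) {lam \<in> part_bounded N. A \<subseteq> beads N lam}"
    by (rule has_sum_cong[THEN iffD1, rotated]) (simp add: kdet_set_beads kdet_set_lessThan)
  hence "((\<lambda>lam. W lam * (R N lam)\<^sup>2 * M_fin N * inverse (M_fin N)) has_sum kdet_set ?K A * inverse (M_fin N))
      {lam \<in> part_bounded N. A \<subseteq> beads N lam}"
    by (rule has_sum_cmult_left)
  thus ?thesis using M_fin_pos[of N] by (simp add: mult.assoc divide_inverse)
qed

end

section \<open>Passage from the truncated measures to the full one\<close>

context q_bessel_pos
begin

lemma measure_eq_det:
  fixes a :: "nat \<Rightarrow> int"
  assumes inj: "inj_on a {..<k}"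
  defines "X \<equiv> {lam \<in> partitions. \<forall>i<k. of_int (a i) + 1 / 2 \<in> Xi lam}"
  shows "Sigma_Algebra.measure (qPP \<xi> q) X = Determinant.det (Matrix.mat k k (\<lambda>(i, j). Kser (a i) (a j)))"
proof -
  define m where "m = inverse (qPP_norm \<xi> q)"
  have m: "0 < m" using qPP_norm_pos by (simp add: m_def)
  define \<Delta> where "\<Delta> N = Determinant.det (Matrix.mat k k
      (\<lambda>(i, j). blaschke_nodes.K N x (nat (int N + a i)) (nat (int N + a j))))" for N
  define \<Delta>' where "\<Delta>' = Determinant.det (Matrix.mat k k (\<lambda>(i, j). Kser (a i) (a j)))"
  define f where "f N lam = W lam * (R N lam)\<^sup>2 * indicator X lam" for N lam
  have \<Delta>_lim: "\<Delta> \<longlonglongrightarrow> \<Delta>'"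
    unfolding \<Delta>_def \<Delta>'_def by (intro tendsto_det K_tendsto_Kser)
  have f_nonneg: "0 \<le> f N lam" for N lam using W_nonneg by (simp add: f_def)
  \<comment> \<open>From here on every N + a i is nonnegative, and N is at least the number k of
    points.\<close>
  define N0 where "N0 = k + (\<Sum>i<k. nat \<bar>a i\<bar>)"
  have sum_f: "(f N has_sum \<Delta> N / M_fin N) partitions" if N: "N0 \<le> N" for N
  proof -
    have a_ge: "0 \<le> int N + a i" if "i < k" for i
    proof -
      have "nat \<bar>a i\<bar> \<le> (\<Sum>i<k. nat \<bar>a i\<bar>)" using that by (intro member_le_sum) auto
      thus ?thesis using N by (simp add: N0_def)
    qed
    define ls where "ls = map (\<lambda>i. nat (int N + a i)) [0..<k]"
    define A where "A = set ls"
    have "distinct ls"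
    proof -
      have "inj_on (\<lambda>i. nat (int N + a i)) {..<k}"
        using inj a_ge by (auto simp: inj_on_def eq_nat_nat_iff)
      thus ?thesis by (simp add: ls_def distinct_map atLeast0LessThan)
    qed
    hence "kdet_set (blaschke_nodes.K N x) A = kdet (blaschke_nodes.K N x) ls"
      by (simp add: kdet_eq_kdet_set A_def)
    also have "\<dots> = \<Delta> N"
      unfolding kdet_def \<Delta>_def
      by (rule arg_cong[where f = Determinant.det]) (rule eq_matI, auto simp: ls_def)
    finally have \<Delta>: "kdet_set (blaschke_nodes.K N x) A = \<Delta> N" .
    have "card A \<le> N" using card_length[of ls] N by (simp add: A_def ls_def N0_def)
    hence "((\<lambda>lam. W lam * (R N lam)\<^sup>2) has_sum \<Delta> N / M_fin N) {lam \<in> part_bounded N. A \<subseteq> beads N lam}"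
      unfolding \<Delta>[symmetric] by (intro has_sum_weights) (simp_all add: A_def)
    \<comment> \<open>Partitions with more than N parts may be included because \<open>R\<close>
      vanishes on them.\<close>
    also have "?this \<longleftrightarrow> (f N has_sum \<Delta> N / M_fin N) partitions"
    proof (rule has_sum_cong_neutral)
      have iff: "A \<subseteq> beads N lam \<longleftrightarrow> lam \<in> X" if "lam \<in> part_bounded N" for lam
        using Xi_iff_beads[OF that a_ge] part_boundedD(1)[OF that]
        by (auto simp: A_def ls_def X_def)
      show "f N lam = 0" if "lam \<in> partitions - {lam \<in> part_bounded N. A \<subseteq> beads N lam}" for lam
        using that R_eq_0[of lam N] iff[of lam] by (cases "lam \<in> part_bounded N") (auto simp: f_def)
      show "W lam * (R N lam)\<^sup>2 = 0" if "lam \<in> {lam \<in> part_bounded N. A \<subseteq> beads N lam} - partitions" for lam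
        using that part_boundedD(1) by auto
      show "W lam * (R N lam)\<^sup>2 = f N lam" if "lam \<in> {lam \<in> part_bounded N. A \<subseteq> beads N lam} \<inter> partitions" for lam
        using that iff[of lam] by (auto simp: f_def)
    qed
    finally show ?thesis .
  qed
  have int_f: "(\<integral>\<^sup>+ lam. ennreal (f N lam) \<partial>count_space partitions) = ennreal (\<Delta> N / M_fin N)" if "N0 \<le> N" for N
    by (rule nn_integral_count_space_has_sum[OF sum_f[OF that] f_nonneg])
  have "(\<lambda>N. \<integral>\<^sup>+ lam. ennreal (f N lam) \<partial>count_space partitions) \<longlonglongrightarrow>
      (\<integral>\<^sup>+ lam. ennreal (W lam * indicator X lam) \<partial>count_space partitions)"
  proof (rule nn_integral_LIMSEQ)
    show "incseq (\<lambda>N lam. ennreal (f N lam))"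
      unfolding f_def
      by (auto simp: incseq_def le_fun_def
          intro!: ennreal_leI mult_right_mono mult_left_mono power_mono R_mono R_nonneg W_nonneg)
    show "(\<lambda>N. ennreal (f N lam)) \<longlonglongrightarrow> ennreal (W lam * indicator X lam)" for lam
    proof (rule tendsto_ennrealI)
      have "(\<lambda>N. f N lam) \<longlonglongrightarrow> W lam * 1\<^sup>2 * indicator X lam"
        unfolding f_def by (intro tendsto_intros R_tendsto)
      thus "(\<lambda>N. f N lam) \<longlonglongrightarrow> W lam * indicator X lam" by simp
    qed
  qed simp
  moreover have "(\<lambda>N. \<integral>\<^sup>+ lam. ennreal (f N lam) \<partial>count_space partitions) \<longlonglongrightarrow> ennreal (\<Delta>' / m)"
  proof (rule Lim_transform_eventually)
    show "(\<lambda>N. ennreal (\<Delta> N / M_fin N)) \<longlonglongrightarrow> ennreal (\<Delta>' / m)"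
      using M_fin_tendsto m unfolding m_def[symmetric]
      by (intro tendsto_ennrealI tendsto_divide \<Delta>_lim) auto
    show "eventually (\<lambda>N. ennreal (\<Delta> N / M_fin N) = (\<integral>\<^sup>+ lam. ennreal (f N lam) \<partial>count_space partitions)) sequentially"
      using eventually_ge_at_top[of N0] by eventually_elim (simp add: int_f)
  qed
  ultimately have int_W: "(\<integral>\<^sup>+ lam. ennreal (W lam * indicator X lam) \<partial>count_space partitions) = ennreal (\<Delta>' / m)"
    by (rule LIMSEQ_unique)
  \<comment> \<open>\<open>ennreal\<close> maps negative reals to 0, so the sign is needed to return
    from the integrals to real numbers.\<close>
  have "0 \<le> \<Delta>'"
  proof (rule LIMSEQ_le_const[OF \<Delta>_lim], intro exI allI impI)
    fix N assume "N0 \<le> N"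
    from has_sum_nonneg[OF sum_f[OF this] f_nonneg]
    show "0 \<le> \<Delta> N" using M_fin_pos[of N] by (simp add: zero_le_divide_iff)
  qed
  have X: "X \<in> sets (count_space partitions)" by (auto simp: X_def)
  have "emeasure (qPP \<xi> q) X =
      (\<integral>\<^sup>+ lam. ennreal (qPP_weight \<xi> q lam) * indicator X lam \<partial>count_space partitions)"
    unfolding qPP_def point_measure_def by (rule emeasure_density[OF _ X]) simp
  also have "\<dots> = (\<integral>\<^sup>+ lam. ennreal m * ennreal (W lam * indicator X lam) \<partial>count_space partitions)"
    using m W_nonneg
    by (intro nn_integral_cong) (auto simp: qPP_weight_eq m_def[symmetric] ennreal_mult indicator_def)
  also have "\<dots> = ennreal m * ennreal (\<Delta>' / m)"
    by (subst nn_integral_cmult) (auto simp: int_W)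
  also have "\<dots> = ennreal \<Delta>'"
    using m \<open>0 \<le> \<Delta>'\<close> by (simp flip: ennreal_mult)
  finally show ?thesis using \<open>0 \<le> \<Delta>'\<close> by (simp add: Sigma_Algebra.measure_def \<Delta>'_def)
qed

end

section \<open>The degenerate parameters \<xi> = 0 and q = 0\<close>

context q_bessel
begin

lemma J_degenerate:
  assumes "\<xi> = 0 \<or> q = 0"
  shows "J n = int_ext \<eta> n"
proof -
  have "\<epsilon> j = (if j = 0 then 1 else 0)" for j
    using assms unfolding \<epsilon>_def by (cases j) auto
  hence "(\<lambda>j. (-1) ^ j * \<epsilon> j * int_ext \<eta> (n + int j)) = (\<lambda>j. if j = 0 then int_ext \<eta> n else 0)" by auto
  thus ?thesis
    using suminf_finite[of "{0}" "\<lambda>j. if j = 0 then int_ext \<eta> n else 0"] by (simp add: J_def)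
qed

text \<open>Off the diagonal either \<xi> = 0 is a factor, or q = 0 makes both powers in the
  denominator 0 and the quotient is 0 by division by zero. On the diagonal only the term with J of
  order 0 survives, and it occurs exactly if a < 0.\<close>

lemma qBessel_kernel_degenerate:
  assumes "\<xi> = 0 \<or> q = 0"
  shows "qBessel_kernel \<xi> q (of_int a + 1 / 2) (of_int b + 1 / 2) = (if a = b \<and> a < 0 then 1 else 0)"
proof (cases "a = b")
  case False
  thus ?thesis using assms by (auto simp: qBessel_kernel_def)
next
  case True
  have fl: "\<lfloor>real_of_int c + 1 / 2 + (real k + 1 / 2)\<rfloor> = c + 1 + int k" for c k by linarith
  have *: "q powi m * (J m)\<^sup>2 = (if m = 0 then 1 else 0)" for m
  proof -
    consider "m < 0" | "m = 0" | l where "m = int (Suc l)"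
      by (metis linorder_cases zero_less_imp_eq_int gr0_conv_Suc)
    thus ?thesis
    proof cases
      case 3
      have "q powi m * (\<eta> (Suc l))\<^sup>2 = 0"
        using assms unfolding 3 \<eta>_def power_int_of_nat by auto
      moreover have "J m = \<eta> (Suc l)"
        unfolding 3 J_degenerate[OF assms] by (rule int_ext_of_nat)
      ultimately show ?thesis using 3 by simp
    qed (auto simp: J_degenerate[OF assms] int_ext_def)
  qed
  have "qBessel_kernel \<xi> q (of_int a + 1 / 2) (of_int b + 1 / 2) = (\<Sum>k. if a + 1 + int k = 0 then 1 else 0)"
    using True by (simp only: qBessel_kernel_def Let_def fl hahn_exton_J_eq * refl if_True)
  also have "\<dots> = (\<Sum>k\<in>{k. a + 1 + int k = 0}. 1)"
  proof -
    have "finite {k. a + 1 + int k = 0}" by (rule finite_subset[of _ "{..nat \<bar>a\<bar>}"]) auto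
    thus ?thesis by (subst suminf_finite) auto
  qed
  also have "{k. a + 1 + int k = 0} = (if a < 0 then {nat (- a - 1)} else {})" by auto
  finally show ?thesis using True by auto
qed

text \<open>The factor (\<xi>^2 q)^|lam| kills every partition but the empty one.\<close>

lemma measure_degenerate:
  assumes "\<xi> = 0 \<or> q = 0" "X \<subseteq> partitions"
  shows "Sigma_Algebra.measure (qPP \<xi> q) X = (if (\<lambda>_. 0) \<in> X then 1 else 0)"
proof -
  have norm: "qPP_norm \<xi> q = 1" using assms by (auto simp: qPP_norm_def)
  have "W lam = (if lam = (\<lambda>_. 0) then 1 else 0)" if lam: "lam \<in> partitions" for lam
  proof (cases "psize lam = 0")
    case True
    hence "lam = (\<lambda>_. 0)" using lam by (auto simp: psize_def partitions_def)
    thus ?thesis by (simp add: W_def psize_def pb_def cells_def)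
  next
    case False
    hence "lam \<noteq> (\<lambda>_. 0)" by (auto simp: psize_def)
    thus ?thesis using False assms by (auto simp: W_def)
  qed
  hence w: "qPP_weight \<xi> q lam = (if lam = (\<lambda>_. 0) then 1 else 0)" if "lam \<in> partitions" for lam
    using that by (simp add: qPP_weight_eq norm)
  have eq: "{lam \<in> X. 0 < ennreal (qPP_weight \<xi> q lam)} = X \<inter> {\<lambda>_. 0}"
    using w assms(2) by (auto split: if_splits)
  have "emeasure (qPP \<xi> q) X = (\<Sum>lam\<in>X \<inter> {\<lambda>_. 0}. ennreal (qPP_weight \<xi> q lam))"
    unfolding qPP_def by (subst emeasure_point_measure[OF _ assms(2)]) (simp_all only: eq, simp)
  also have "\<dots> = (if (\<lambda>_. 0) \<in> X then 1 else 0)"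
    using w[of "\<lambda>_. 0"] assms(2) by (auto simp: Int_insert_right)
  finally show ?thesis by (simp add: Sigma_Algebra.measure_def)
qed

lemma det_degenerate:
  fixes a :: "nat \<Rightarrow> int"
  assumes "\<xi> = 0 \<or> q = 0" "inj_on a {..<k}"
  shows "Determinant.det (Matrix.mat k k (\<lambda>(i, j). qBessel_kernel \<xi> q (of_int (a i) + 1 / 2) (of_int (a j) + 1 / 2))) =
           (if \<forall>i<k. a i < 0 then 1 else 0)"
proof -
  have "a i = a j \<longleftrightarrow> i = j" if "i < k" "j < k" for i j
    using assms(2) that by (auto simp: inj_on_def)
  hence "Matrix.mat k k (\<lambda>(i, j). qBessel_kernel \<xi> q (of_int (a i) + 1 / 2) (of_int (a j) + 1 / 2)) =
      mat_diag k (\<lambda>i. if a i < 0 then 1 else 0)"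
    by (intro eq_matI) (auto simp: qBessel_kernel_degenerate[OF assms(1)] mat_diag_def)
  also have "Determinant.det \<dots> = (\<Prod>i<k. if a i < 0 then 1 else 0)"
    by (subst det_upper_triangular[of _ k])
       (auto simp: mat_diag_def prod_list_diag_prod upper_triangular_def atLeast0LessThan)
  also have "\<dots> = (if \<forall>i<k. a i < 0 then 1 else 0)"
    by (auto simp: prod_zero_iff)
  finally show ?thesis .
qed

lemma Xi_zero_iff: "of_int a + 1 / 2 \<in> Xi (\<lambda>_. 0) \<longleftrightarrow> a < 0"
proof
  assume "of_int a + 1 / 2 \<in> Xi (\<lambda>_. 0)"
  thus "a < 0" by (auto simp: Xi_def)
next
  assume "a < 0"
  hence "of_int a + 1 / 2 = real 0 - real (Suc (nat (- a - 1))) + 1 / 2" by simp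
  thus "of_int a + 1 / 2 \<in> Xi (\<lambda>_. 0)" unfolding Xi_def by (rule range_eqI)
qed

end

theorem theorem1p1:
  fixes q \<xi> :: real and k :: nat and z :: "nat \<Rightarrow> real"
  assumes "0 \<le> q" "q < 1" and "0 \<le> \<xi>" "\<xi> < 1"
    and "\<And>i. i < k \<Longrightarrow> z i \<in> half_ints"
    and "inj_on z {..<k}"
  shows "correlation \<xi> q (z ` {..<k}) =
           Determinant.det (Matrix.mat k k (\<lambda>(i, j). qBessel_kernel \<xi> q (z i) (z j)))"
proof -
  interpret q_bessel q \<xi> using assms by unfold_locales
  define a where "a i = \<lfloor>z i\<rfloor>" for i
  have z: "z i = of_int (a i) + 1 / 2" if i: "i < k" for i
  proof -
    obtain n :: int where n: "z i = of_int n + 1 / 2" using assms(5)[OF i] by (auto simp: half_ints_def)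
    moreover have "\<lfloor>of_int n + 1 / 2 :: real\<rfloor> = n" by linarith
    ultimately show ?thesis by (simp add: a_def)
  qed
  have inj: "inj_on a {..<k}"
  proof (rule inj_onI)
    fix i j assume "i \<in> {..<k}" "j \<in> {..<k}" "a i = a j"
    thus "i = j" using assms(6) z[of i] z[of j] by (auto simp: inj_on_def)
  qed
  define X where "X = {lam \<in> partitions. \<forall>i<k. of_int (a i) + 1 / 2 \<in> Xi lam}"
  have corr: "correlation \<xi> q (z ` {..<k}) = Sigma_Algebra.measure (qPP \<xi> q) X"
    unfolding correlation_def X_def using z by (intro arg_cong[where f = "Sigma_Algebra.measure _"]) auto
  have det: "Determinant.det (Matrix.mat k k (\<lambda>(i, j). qBessel_kernel \<xi> q (z i) (z j))) =
    Determinant.det (Matrix.mat k k (\<lambda>(i, j). qBessel_kernel \<xi> q (of_int (a i) + 1 / 2) (of_int (a j) + 1 / 2)))"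
    by (rule arg_cong[where f = Determinant.det]) (rule eq_matI, auto simp: z)
  show ?thesis
  \<comment> \<open>If \<xi> or q is 0, all nodes x_i are 0 and there is no truncated ensemble to
    start from; measure and kernel are then computed directly.\<close>
  proof (cases "\<xi> = 0 \<or> q = 0")
    case True
    have "(\<lambda>_. 0) \<in> X \<longleftrightarrow> (\<forall>i<k. a i < 0)"
      using part_boundedD(1)[OF zero_part_bounded] by (simp add: X_def Xi_zero_iff)
    thus ?thesis unfolding corr det det_degenerate[OF True inj]
      by (subst measure_degenerate[OF True]) (auto simp: X_def)
  next
    case False
    interpret q_bessel_pos q \<xi> by unfold_locales (use False assms in auto)
    show ?thesis unfolding corr det X_def measure_eq_det[OF inj] qBessel_kernel_eq_Kser ..
  qed
qed

end
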